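(* All trajectories of the uncertain interconnection $$\dot x=Ax+Bw+B_dd,\quad z=Cx+Dw+D_dd,\quad e=C_ex+D_ew+D_{ed}d,\quad w\in\boldsymbol{\Delta_{\rm dy}}(z)$$ satisfy $$x(T)^TE(X,Z)x(T)+\int_0^T\begin{pmatrix}e(t)\\ d(t)\end{pmatrix}^TP_p\begin{pmatrix}e(t)\\ d(t)\end{pmatrix}dt\le x(0)^TX_2x(0)\quad\text{for all }T\ge0,$$ where $E(X,Z):=X_2-X_{12}^T(X_1+Z)^{-1}X_{12}$, if there exist $X=X^T=\begin{pmatrix}X_1&X_{12}\\ X_{12}^T&X_2\end{pmatrix}$ (with $X_1$ of the size of $A_\Psi$ and $X_2$ of the size of $A$), $K=K^T$ and $M\in\mathbb S^l$ such that, with $P:=P_0\otimes M$ and $Z:=P_0\otimes K$, the following three inequalities hold: $$\begin{pmatrix}X_1+Z&X_{12}\\ X_{12}^T&X_2\end{pmatrix}\succ0,$$ $$\begin{pmatrix}\mathcal A&\mathcal B\\ I&0\end{pmatrix}^T\begin{pmatrix}0&X\\ X&0\end{pmatrix}\begin{pmatrix}\mathcal A&\mathcal B\\ I&0\end{pmatrix}+\begin{pmatrix}\mathcal C&\mathcal D\end{pmatrix}^TP\begin{pmatrix}\mathcal C&\mathcal D\end{pmatrix}+\begin{pmatrix}0&C_e&D_e&D_{ed}\\ 0&0&0&I\end{pmatrix}^TP_p\begin{pmatrix}0&C_e&D_e&D_{ed}\\ 0&0&0&I\end{pmatrix}\prec0,$$ $$\begin{pmatrix}A_\psi&B_\psi\\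 I&0\end{pmatrix}^T\begin{pmatrix}0&K\\ K&0\end{pmatrix}\begin{pmatrix}A_\psi&B_\psi\\ I&0\end{pmatrix}\prec\begin{pmatrix}C_\psi&D_\psi\end{pmatrix}^TM\begin{pmatrix}C_\psi&D_\psi\end{pmatrix}.$$
   Context: Signals: all signals ($w,z$ scalar-valued; $x,d,e$ vector-valued) are piecewise continuous and right-continuous functions on $[0,\infty)$; $\mathcal S$ denotes the set of such real-valued functions. State trajectories are continuous with right-derivative $\dot x$ at every $t\ge0$ that is again piecewise continuous and right-continuous. $A,B,B_d,C,D,D_d,C_e,D_e,D_{ed}$ are given real matrices of compatible dimensions. Trajectories are all tuples of such signals satisfying the equations. $P_p=\begin{pmatrix}Q_p&S_p\\ S_p^T&R_p\end{pmatrix}$ is real symmetric, partitioned according to $(e,d)$, with $Q_p\succeq0$. Uncertainty: $P_0=\begin{pmatrix}q&s\\ s&r\end{pmatrix}$ is a fixed real symmetric matrix with $r\le0$, and for $z\in\mathcal S$ $$\boldsymbol{\Delta_{\rm dy}}(z):=\Big\{\delta z\ \Big|\ \delta\text{ a stable transfer function with }\begin{pmatrix}1\\ \delta\end{pmatrix}^*P_0\begin{pmatrix}1\\ \delta\end{pmatrix}\succ0\text{ on }i\mathbb R\cup\{\infty\}\Big\}.$$ Transfer functions are real rational and proper; stable means all poles are in the open left half-plane; $w=\delta z$ denotes the output of $\dot x_\delta=A_\delta x_\delta+B_\delta z$, $w=C_\delta x_\delta+D_\delta z$, $x_\delta(0)=0$ for a minimal realization of $\delta$. Filter: $\psi$ is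 a stable transfer matrix of dimension $l\times1$ with full column rank on $i\mathbb R\cup\{\infty\}$ and minimal realization $(A_\psi,B_\psi,C_\psi,D_\psi)$ (so $A_\psi$ is Hurwitz). $\Psi=\operatorname{diag}(\psi,\psi)$ is realized by $A_\Psi=\operatorname{diag}(A_\psi,A_\psi)$, $B_\Psi=(B_{\Psi_1}\ B_{\Psi_2})=\operatorname{diag}(B_\psi,B_\psi)$, $C_\Psi=\operatorname{diag}(C_\psi,C_\psi)$, $D_\Psi=(D_{\Psi_1}\ D_{\Psi_2})=\operatorname{diag}(D_\psi,D_\psi)$, where the column partition is according to the input $(z,w)$. Set $$\mathcal A=\begin{pmatrix}A_\Psi&B_{\Psi_1}C\\ 0&A\end{pmatrix},\ \mathcal B=\begin{pmatrix}B_{\Psi_1}D+B_{\Psi_2}&B_{\Psi_1}D_d\\ B&B_d\end{pmatrix},\ \mathcal C=\begin{pmatrix}C_\Psi&D_{\Psi_1}C\end{pmatrix},\ \mathcal D=\begin{pmatrix}D_{\Psi_1}D+D_{\Psi_2}&D_{\Psi_1}D_d\end{pmatrix}.$$ The column partition in $\begin{pmatrix}0&C_e&D_e&D_{ed}\\ 0&0&0&I\end{pmatrix}$ is compatible with (filter state, $x$, $w$, $d$). $\mathbb S^l$: real symmetric $l\times l$ matrices; $\otimes$: Kronecker product; $\succ,\prec,\succeq$: definiteness ordering of symmetric/Hermitian matrices. *)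

theory Defs
  imports
    "HOL-Analysis.Henstock_Kurzweil_Integration"
    "HOL-Computational_Algebra.Polynomial_Factorial"
    "HOL-Computational_Algebra.Field_as_Ring"
    "Jordan_Normal_Form.Gauss_Jordan_Elimination"
    "Jordan_Normal_Form.Char_Poly"
    "Jordan_Normal_Form.Schur_Decomposition"
    "Jordan_Normal_Form.DL_Rank"
begin

text \<open>All dimensions are natural numbers, possibly zero (a static filter, say, has state
  dimension 0), so vectors and matrices are those of \<^theory>\<open>Jordan_Normal_Form.Matrix\<close>.\<close>

no_notation vec_nth (infixl \<open>$\<close> 90)
hide_type (open) Finite_Cartesian_Product.vec
hide_const (open) Finite_Cartesian_Product.vec Finite_Cartesian_Product.row
  Finite_Cartesian_Product.column

section \<open>Matrices\<close>

definition symmetric_mat :: "nat \<Rightarrow> real mat \<Rightarrow> bool" where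
  "symmetric_mat n A \<longleftrightarrow> A \<in> carrier_mat n n \<and> transpose_mat A = A"

text \<open>Over the reals the conjugation is the identity. Over the complex numbers the order is the one
  of \<^theory>\<open>HOL-Library.Complex_Order\<close>, where \<open>0 < c\<close> means that \<open>c\<close> is real and positive.\<close>

definition pos_def :: "'a :: conjugatable_ordered_field mat \<Rightarrow> bool" where
  "pos_def A \<longleftrightarrow> dim_row A = dim_col A \<and> mat_adjoint A = A \<and>
     (\<forall>v \<in> carrier_vec (dim_row A). v \<noteq> 0\<^sub>v (dim_row A) \<longrightarrow> 0 < scalar_prod (A *\<^sub>v v) (conjugate v))"

definition pos_semidef :: "'a :: conjugatable_ordered_field mat \<Rightarrow> bool" where
  "pos_semidef A \<longleftrightarrow> dim_row A = dim_col A \<and> mat_adjoint A = A \<and>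
     (\<forall>v \<in> carrier_vec (dim_row A). 0 \<le> scalar_prod (A *\<^sub>v v) (conjugate v))"

definition mat_less :: "'a :: conjugatable_ordered_field mat \<Rightarrow> 'a mat \<Rightarrow> bool"
    (infix \<open>\<prec>\<^sub>m\<close> 50) where
  "A \<prec>\<^sub>m B \<longleftrightarrow> dim_row A = dim_row B \<and> dim_col A = dim_col B \<and> pos_def (B - A)"

definition kronecker :: "'a :: semiring_0 mat \<Rightarrow> 'a mat \<Rightarrow> 'a mat" (infixl \<open>\<otimes>\<^sub>k\<close> 70) where
  "A \<otimes>\<^sub>k B = mat (dim_row A * dim_row B) (dim_col A * dim_col B)
     (\<lambda>(i, j). A $$ (i div dim_row B, j div dim_col B) * B $$ (i mod dim_row B, j mod dim_col B))"

definition append_cols :: "'a :: zero mat \<Rightarrow> 'a mat \<Rightarrow> 'a mat" (infixr \<open>@\<^sub>c\<close> 66) where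
  "A @\<^sub>c B = four_block_mat A B (0\<^sub>m 0 (dim_col A)) (0\<^sub>m 0 (dim_col B))"

definition quad_form :: "real mat \<Rightarrow> real vec \<Rightarrow> real" where
  "quad_form A v = scalar_prod v (A *\<^sub>v v)"

definition scalar_vec :: "real \<Rightarrow> real vec" where
  "scalar_vec a = vec 1 (\<lambda>_. a)"


section \<open>Signals and state trajectories\<close>

text \<open>Piecewise continuous means: on each bounded interval only finitely many discontinuities, and
  one-sided limits exist everywhere. Values at negative times are irrelevant.\<close>

definition signals :: "(real \<Rightarrow> real) set" where
  "signals = {u. (\<forall>t\<ge>0. (u \<longlongrightarrow> u t) (at_right t)) \<and>
                 (\<forall>t>0. \<exists>c. (u \<longlongrightarrow> c) (at_left t)) \<and>
                 (\<forall>T. finite {t \<in> {0<..T}. \<not> isCont u t})}"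

definition vec_signals :: "nat \<Rightarrow> (real \<Rightarrow> real vec) set" where
  "vec_signals n = {u. (\<forall>t\<ge>0. u t \<in> carrier_vec n) \<and> (\<forall>i<n. (\<lambda>t. u t $ i) \<in> signals)}"

text \<open>\<open>state_trajectory n x v\<close>: \<open>x\<close> is an \<open>n\<close>-dimensional state trajectory whose right-derivative
  is \<open>v\<close>.\<close>

definition state_trajectory :: "nat \<Rightarrow> (real \<Rightarrow> real vec) \<Rightarrow> (real \<Rightarrow> real vec) \<Rightarrow> bool" where
  "state_trajectory n x v \<longleftrightarrow>
     (\<forall>t\<ge>0. x t \<in> carrier_vec n) \<and> v \<in> vec_signals n \<and>
     (\<forall>i<n. continuous_on {0..} (\<lambda>t. x t $ i) \<and>
       (\<forall>t\<ge>0. ((\<lambda>\<tau>. x \<tau> $ i) has_real_derivative v t $ i) (at_right t)))"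


section \<open>Transfer functions\<close>

text \<open>Real rational functions are elements of the fraction field of the real polynomials;
  \<^const>\<open>quot_of_fract\<close> yields the coprime representation with monic denominator.\<close>

definition tf_num :: "real poly fract \<Rightarrow> real poly" where
  "tf_num g = fst (quot_of_fract g)"

definition tf_den :: "real poly fract \<Rightarrow> real poly" where
  "tf_den g = snd (quot_of_fract g)"

definition tf_proper :: "real poly fract \<Rightarrow> bool" where
  "tf_proper g \<longleftrightarrow> degree (tf_num g) \<le> degree (tf_den g)"

definition tf_poles :: "real poly fract \<Rightarrow> complex set" where
  "tf_poles g = {s. poly (map_poly of_real (tf_den g)) s = 0}"

definition tf_stable :: "real poly fract \<Rightarrow> bool" where
  "tf_stable g \<longleftrightarrow> tf_proper g \<and> (\<forall>s \<in> tf_poles g. Re s < 0)"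

definition tf_at :: "complex \<Rightarrow> real poly fract \<Rightarrow> complex" where
  "tf_at s g = poly (map_poly of_real (tf_num g)) s / poly (map_poly of_real (tf_den g)) s"

text \<open>The value at infinity, for proper \<open>g\<close>.\<close>

definition tf_at_infinity :: "real poly fract \<Rightarrow> complex" where
  "tf_at_infinity g = of_real (coeff (tf_num g) (degree (tf_den g)) / lead_coeff (tf_den g))"

definition tm_stable :: "real poly fract mat \<Rightarrow> bool" where
  "tm_stable G \<longleftrightarrow> (\<forall>i < dim_row G. \<forall>j < dim_col G. tf_stable (G $$ (i, j)))"

definition imag_axis_values :: "real poly fract mat \<Rightarrow> complex mat set" where
  "imag_axis_values G =
     {map_mat (tf_at (\<i> * of_real \<omega>)) G | \<omega>. True} \<union> {map_mat tf_at_infinity G}"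

definition const_tm :: "real mat \<Rightarrow> real poly fract mat" where
  "const_tm = map_mat (\<lambda>a. to_fract [:a:])"

text \<open>\<open>G = C (s I - A)\<^sup>-\<^sup>1 B + D\<close> over the field of rational functions in \<open>s\<close>; the matrix
  \<open>s I - A\<close> is \<^const>\<open>char_poly_matrix\<close>, and it is always invertible over this field.\<close>

definition realization ::
  "nat \<Rightarrow> real mat \<Rightarrow> real mat \<Rightarrow> real mat \<Rightarrow> real mat \<Rightarrow> real poly fract mat \<Rightarrow> bool" where
  "realization n A B C D G \<longleftrightarrow>
     A \<in> carrier_mat n n \<and> B \<in> carrier_mat n (dim_col G) \<and>
     C \<in> carrier_mat (dim_row G) n \<and> D \<in> carrier_mat (dim_row G) (dim_col G) \<and>
     G = const_tm C * the (mat_inverse (map_mat to_fract (char_poly_matrix A))) * const_tm B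
         + const_tm D"

definition minimal_realization ::
  "nat \<Rightarrow> real mat \<Rightarrow> real mat \<Rightarrow> real mat \<Rightarrow> real mat \<Rightarrow> real poly fract mat \<Rightarrow> bool" where
  "minimal_realization n A B C D G \<longleftrightarrow> realization n A B C D G \<and>
     (\<forall>n' A' B' C' D'. realization n' A' B' C' D' G \<longrightarrow> n \<le> n')"

text \<open>\<open>tf_output \<delta> z w\<close>: \<open>w = \<delta> z\<close> on \<open>[0, \<infinity>)\<close>. The output does not depend on the chosen minimal
  realization.\<close>

definition tf_output :: "real poly fract \<Rightarrow> (real \<Rightarrow> real) \<Rightarrow> (real \<Rightarrow> real) \<Rightarrow> bool" where
  "tf_output \<delta> z w \<longleftrightarrow>
     (\<exists>n A B C D x. minimal_realization n A B C D (mat 1 1 (\<lambda>_. \<delta>)) \<and>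
        state_trajectory n x (\<lambda>t. A *\<^sub>v x t + B *\<^sub>v scalar_vec (z t)) \<and> x 0 = 0\<^sub>v n \<and>
        (\<forall>t\<ge>0. scalar_vec (w t) = C *\<^sub>v x t + D *\<^sub>v scalar_vec (z t)))"


section \<open>The uncertain interconnection\<close>

definition Delta_dy :: "real mat \<Rightarrow> (real \<Rightarrow> real) \<Rightarrow> (real \<Rightarrow> real) set" where
  "Delta_dy P\<^sub>0 z = {w. \<exists>\<delta>. tf_stable \<delta> \<and>
     (\<forall>H \<in> imag_axis_values (mat_of_rows_list 1 [[1], [\<delta>]]).
        pos_def (mat_adjoint H * map_mat of_real P\<^sub>0 * H)) \<and>
     tf_output \<delta> z w}"

definition interconnection_trajectory where
  "interconnection_trajectory P\<^sub>0 A B B\<^sub>d C D D\<^sub>d C\<^sub>e D\<^sub>e D\<^sub>e\<^sub>d x w z e d \<longleftrightarrow>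
     w \<in> signals \<and> z \<in> signals \<and>
     e \<in> vec_signals (dim_row C\<^sub>e) \<and> d \<in> vec_signals (dim_col B\<^sub>d) \<and>
     state_trajectory (dim_row A) x (\<lambda>t. A *\<^sub>v x t + B *\<^sub>v scalar_vec (w t) + B\<^sub>d *\<^sub>v d t) \<and>
     (\<forall>t\<ge>0. scalar_vec (z t) = C *\<^sub>v x t + D *\<^sub>v scalar_vec (w t) + D\<^sub>d *\<^sub>v d t) \<and>
     (\<forall>t\<ge>0. e t = C\<^sub>e *\<^sub>v x t + D\<^sub>e *\<^sub>v scalar_vec (w t) + D\<^sub>e\<^sub>d *\<^sub>v d t) \<and>
     w \<in> Delta_dy P\<^sub>0 z"


section \<open>The filter and the augmented system\<close>

definition diag2 :: "real mat \<Rightarrow> real mat" where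
  "diag2 F = four_block_mat F (0\<^sub>m (dim_row F) (dim_col F)) (0\<^sub>m (dim_row F) (dim_col F)) F"

text \<open>The two block columns of \<open>diag2 F\<close>.\<close>

definition diag2_col1 :: "real mat \<Rightarrow> real mat" where
  "diag2_col1 F = F @\<^sub>r 0\<^sub>m (dim_row F) (dim_col F)"

definition diag2_col2 :: "real mat \<Rightarrow> real mat" where
  "diag2_col2 F = 0\<^sub>m (dim_row F) (dim_col F) @\<^sub>r F"

definition aug_A where
  "aug_A A\<^sub>\<psi> B\<^sub>\<psi> A C =
     four_block_mat (diag2 A\<^sub>\<psi>) (diag2_col1 B\<^sub>\<psi> * C) (0\<^sub>m (dim_row A) (2 * dim_row A\<^sub>\<psi>)) A"

definition aug_B where
  "aug_B B\<^sub>\<psi> B B\<^sub>d D D\<^sub>d =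
     four_block_mat (diag2_col1 B\<^sub>\<psi> * D + diag2_col2 B\<^sub>\<psi>) (diag2_col1 B\<^sub>\<psi> * D\<^sub>d) B B\<^sub>d"

definition aug_C where
  "aug_C C\<^sub>\<psi> D\<^sub>\<psi> C = diag2 C\<^sub>\<psi> @\<^sub>c diag2_col1 D\<^sub>\<psi> * C"

definition aug_D where
  "aug_D D\<^sub>\<psi> D D\<^sub>d = (diag2_col1 D\<^sub>\<psi> * D + diag2_col2 D\<^sub>\<psi>) @\<^sub>c diag2_col1 D\<^sub>\<psi> * D\<^sub>d"

text \<open>The matrices \<open>(A B; I 0)\<^sup>T (0 X; X 0) (A B; I 0)\<close>.\<close>

definition kyp_form :: "real mat \<Rightarrow> real mat \<Rightarrow> real mat \<Rightarrow> real mat" where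
  "kyp_form A B X =
     (let n = dim_row A; F = four_block_mat A B (1\<^sub>m n) (0\<^sub>m n (dim_col B))
      in transpose_mat F * four_block_mat (0\<^sub>m n n) X X (0\<^sub>m n n) * F)"

text \<open>The matrix \<open>(0 C\<^sub>e D\<^sub>e D\<^sub>e\<^sub>d; 0 0 0 I)\<close> with zero first block column of width \<open>k\<close>.\<close>

definition perf_outer :: "nat \<Rightarrow> real mat \<Rightarrow> real mat \<Rightarrow> real mat \<Rightarrow> real mat" where
  "perf_outer k C\<^sub>e D\<^sub>e D\<^sub>e\<^sub>d =
     (let n = dim_col C\<^sub>e; n\<^sub>d = dim_col D\<^sub>e\<^sub>d
      in (0\<^sub>m (dim_row C\<^sub>e) k @\<^sub>c C\<^sub>e @\<^sub>c D\<^sub>e @\<^sub>c D\<^sub>e\<^sub>d)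
         @\<^sub>r (0\<^sub>m n\<^sub>d k @\<^sub>c 0\<^sub>m n\<^sub>d n @\<^sub>c 0\<^sub>m n\<^sub>d 1 @\<^sub>c 1\<^sub>m n\<^sub>d))"

definition E_mat :: "real mat \<Rightarrow> real mat \<Rightarrow> real mat \<Rightarrow> real mat \<Rightarrow> real mat" where
  "E_mat X\<^sub>1 X\<^sub>1\<^sub>2 X\<^sub>2 Z = X\<^sub>2 - transpose_mat X\<^sub>1\<^sub>2 * the (mat_inverse (X\<^sub>1 + Z)) * X\<^sub>1\<^sub>2"

end

theory Submission
  imports Defs
begin

text \<open>
  Why the certificate works. Let \<open>\<xi>1\<close> and \<open>\<xi>2\<close> be the filter states driven by \<open>z\<close> and \<open>w\<close> from
  rest, and \<open>y1\<close>, \<open>y2\<close> the filtered signals. The system inequality is a dissipation inequality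
  for \<open>(\<xi>1, \<xi>2, x)\<close> with storage matrix \<open>X\<close>; integrating it bounds the performance integral by
  storage terms and \<open>- \<integral> y\<^sup>T P y\<close>, where \<open>y = (y1, y2)\<close>. What is needed is therefore the
  integral quadratic constraint with terminal cost
  \<open>\<integral>\<^sub>0\<^sup>T y\<^sup>T (P\<^sub>0 \<otimes> M) y dt \<ge> \<xi>(T)\<^sup>T (P\<^sub>0 \<otimes> K) \<xi>(T)\<close>.
  It replaces \<open>X\<^sub>1\<close> by \<open>X\<^sub>1 + Z\<close> in the storage at time \<open>T\<close>, and minimizing the storage over the
  filter state leaves the Schur complement \<open>E\<close> (\<open>schur_complement_le\<close>).

  To get the constraint, let \<open>N\<close> be the positive definite difference of the two sides of the filter
  inequality. The derivative of \<open>\<xi>i\<^sup>T K \<xi>j\<close> and \<open>yi\<^sup>T M yj\<close> differ exactly by the bilinear form of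
  \<open>N\<close> at the pairs (filter state, filter input), so the constraint says that
  \<open>\<integral> \<Sum>\<^sub>i\<^sub>j (P\<^sub>0)\<^sub>i\<^sub>j vi\<^sup>T N vj \<ge> 0\<close> for \<open>v1 = (\<xi>1, z)\<close> and \<open>v2 = (\<xi>2, w)\<close>. Writing \<open>N = L\<^sup>T L\<close> reduces
  this to the components of \<open>L v1\<close> and \<open>L v2\<close>. As \<open>\<delta>\<close> is scalar it commutes with the filter: each
  component of \<open>L v2\<close> is \<open>\<delta>\<close> applied to the same component of \<open>L v1\<close> (\<open>filtered_iqc\<close>).

  What remains is the scalar claim (\<open>hard_iqc\<close>): if \<open>w = \<delta> v\<close> then
  \<open>\<integral>\<^sub>0\<^sup>T q v\<^sup>2 + 2 s v w + r w\<^sup>2 dt \<ge> 0\<close> for every \<open>T\<close>. Replace \<open>v\<close> by \<open>0\<close> after time \<open>T\<close>. By causality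
  \<open>w\<close> does not change before \<open>T\<close>, and after \<open>T\<close> the integrand is \<open>r w\<^sup>2 \<le> 0\<close>, so it suffices to show
  that the integral over the whole half line is nonnegative. There the frequency domain
  inequality applies, by an algebraic form of Plancherel's theorem (\<open>plancherel\<close>): with
  \<open>\<delta> = n / d\<close> and \<open>d(D) \<eta> = v\<close>, all signals are combinations of the derivatives of \<open>\<eta>\<close>. Integration
  by parts has no boundary terms in the limit, because \<open>d\<close> is Hurwitz and \<open>v\<close> has compact support,
  so \<open>\<integral> |f(D) \<eta>|\<^sup>2\<close> depends on the polynomial \<open>|f(i \<omega>)|\<^sup>2\<close> in \<open>\<omega>\<close> only. By the frequency domain
  inequality, \<open>q |d|\<^sup>2 + 2 s Re (d n\<^sup>*) + r |n|\<^sup>2\<close> is positive on the imaginary axis, hence equal to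
  \<open>|g|\<^sup>2\<close> there for some polynomial \<open>g\<close> (\<open>spectral_factorization\<close>). The integral over the half line
  is therefore \<open>\<integral> |g(D) \<eta>|\<^sup>2 \<ge> 0\<close>.

  Signals need not be differentiable, so differential operators are replaced by polynomials in
  the integration operator \<open>J\<close>: for zero initial conditions \<open>d(D) w = n(D) v\<close> is encoded by multiplying
  both sides with \<open>J\<^sup>m\<close>, that is, by the reversed polynomials. Polynomials in \<open>J\<close> commute, and those
  with constant term \<open>1\<close> are invertible (\<open>act_solvable\<close>, \<open>act_injective\<close>). This makes every transfer
  function computation a polynomial identity.
\<close>

section \<open>Piecewise continuous signals and their integrals\<close>

text \<open>The condition defining \<^const>\<open>signals\<close>, for values in any Hausdorff space: polynomials are factored over
  the complex numbers below, which needs complex-valued signals.\<close>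

definition pwc :: "(real \<Rightarrow> 'a::t2_space) \<Rightarrow> bool" where
  "pwc u \<longleftrightarrow> (\<forall>t\<ge>0. (u \<longlongrightarrow> u t) (at_right t)) \<and> (\<forall>t>0. \<exists>c. (u \<longlongrightarrow> c) (at_left t)) \<and>
     (\<forall>T. finite {t \<in> {0<..T}. \<not> isCont u t})"

lemma signals_iff_pwc: "u \<in> signals \<longleftrightarrow> pwc u"
  by (simp add: signals_def pwc_def)

text \<open>Together with \<open>pwc_Pair\<close> this yields closure under every continuous operation.\<close>

lemma pwc_map:
  fixes h :: "'a::t2_space \<Rightarrow> 'b::t2_space"
  assumes "continuous_on UNIV h" "pwc f"
  shows "pwc (\<lambda>t. h (f t))"
proof -
  have h: "isCont h x" for x
    using assms(1) by (simp add: continuous_on_eq_continuous_at)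
  have "finite {t \<in> {0<..T}. \<not> isCont (\<lambda>t. h (f t)) t}" for T
  proof (rule finite_subset)
    show "{t \<in> {0<..T}. \<not> isCont (\<lambda>t. h (f t)) t} \<subseteq> {t \<in> {0<..T}. \<not> isCont f t}"
      using h isCont_o2 by blast
  qed (use assms(2) in \<open>simp add: pwc_def\<close>)
  moreover have "((\<lambda>t. h (f t)) \<longlongrightarrow> h c) F" if "(f \<longlongrightarrow> c) F" for c and F :: "real filter"
    using isCont_tendsto_compose[OF h that] .
  ultimately show ?thesis
    using assms(2) unfolding pwc_def by meson
qed

lemma pwc_Pair:
  fixes f :: "real \<Rightarrow> 'a::t2_space" and g :: "real \<Rightarrow> 'b::t2_space"
  assumes f: "pwc f" and g: "pwc g"
  shows "pwc (\<lambda>t. (f t, g t))"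
  unfolding pwc_def
proof (intro conjI allI impI)
  fix t :: real assume "0 \<le> t"
  then show "((\<lambda>t. (f t, g t)) \<longlongrightarrow> (f t, g t)) (at_right t)"
    using f g by (intro tendsto_Pair) (simp_all add: pwc_def)
next
  fix t :: real assume "0 < t"
  then obtain a b where "(f \<longlongrightarrow> a) (at_left t)" "(g \<longlongrightarrow> b) (at_left t)"
    using f g unfolding pwc_def by blast
  then have "((\<lambda>t. (f t, g t)) \<longlongrightarrow> (a, b)) (at_left t)"
    by (rule tendsto_Pair)
  then show "\<exists>c. ((\<lambda>t. (f t, g t)) \<longlongrightarrow> c) (at_left t)" ..
next
  fix T
  have "{t \<in> {0<..T}. \<not> isCont (\<lambda>t. (f t, g t)) t} \<subseteq>
      {t \<in> {0<..T}. \<not> isCont f t} \<union> {t \<in> {0<..T}. \<not> isCont g t}"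
    using continuous_Pair[of _ f g] by blast
  then show "finite {t \<in> {0<..T}. \<not> isCont (\<lambda>t. (f t, g t)) t}"
    by (rule finite_subset) (use f g in \<open>simp add: pwc_def\<close>)
qed

lemma pwc_const [simp]: "pwc (\<lambda>t. c)"
  by (auto simp: pwc_def)

lemma pwc_add:
  fixes f g :: "real \<Rightarrow> 'a::real_normed_vector"
  assumes "pwc f" "pwc g"
  shows "pwc (\<lambda>t. f t + g t)"
proof -
  have "continuous_on UNIV (\<lambda>p. fst p + snd p :: 'a)"
    by (intro continuous_intros)
  from pwc_map[OF this pwc_Pair[OF assms]] show ?thesis
    by simp
qed

lemma pwc_mult:
  fixes f g :: "real \<Rightarrow> 'a::real_normed_algebra"
  assumes "pwc f" "pwc g"
  shows "pwc (\<lambda>t. f t * g t)"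
proof -
  have "continuous_on UNIV (\<lambda>p. fst p * snd p :: 'a)"
    by (intro continuous_intros)
  from pwc_map[OF this pwc_Pair[OF assms]] show ?thesis
    by simp
qed

lemma pwc_diff:
  fixes f g :: "real \<Rightarrow> 'a::real_normed_vector"
  assumes "pwc f" "pwc g"
  shows "pwc (\<lambda>t. f t - g t)"
proof -
  have "continuous_on UNIV (\<lambda>p. fst p - snd p :: 'a)"
    by (intro continuous_intros)
  from pwc_map[OF this pwc_Pair[OF assms]] show ?thesis
    by simp
qed

lemma pwc_sum: "(\<And>i. i \<in> I \<Longrightarrow> pwc (f i)) \<Longrightarrow> pwc (\<lambda>t. \<Sum>i\<in>I. f i t :: 'a::real_normed_vector)"
  by (induction I rule: infinite_finite_induct) (auto intro: pwc_add)

lemma pwc_of_real: "pwc f \<Longrightarrow> pwc (\<lambda>t. of_real (f t) :: 'a::{real_normed_algebra_1})"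
  by (rule pwc_map) (auto intro!: continuous_intros)

lemma pwc_Re: "pwc f \<Longrightarrow> pwc (\<lambda>t. Re (f t))"
  by (rule pwc_map) (auto intro!: continuous_intros)

lemma pwc_cnj: "pwc f \<Longrightarrow> pwc (\<lambda>t. cnj (f t))"
  by (rule pwc_map) (auto intro!: continuous_intros)

lemmas pwc_intros = pwc_const pwc_add pwc_mult pwc_diff pwc_sum pwc_of_real pwc_Re pwc_cnj

lemma pwc_continuous_on:
  assumes "continuous_on {0..} f"
  shows "pwc f"
proof -
  have c: "isCont f t" if "t > 0" for t
    using continuous_on_interior[OF assms] that by simp
  have "(f \<longlongrightarrow> f t) (at_right t)" if "t \<ge> 0" for t
  proof -
    have "(f \<longlongrightarrow> f t) (at t within {0..})"
      using assms that by (auto simp: continuous_on_def)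
    then show ?thesis
      by (rule tendsto_within_subset) (use that in auto)
  qed
  moreover have "\<exists>c. (f \<longlongrightarrow> c) (at_left t)" if "t > 0" for t
    using c[OF that] unfolding isCont_def by (meson tendsto_within_subset subset_UNIV)
  moreover have "{t \<in> {0<..T}. \<not> isCont f t} = {}" for T
    using c by auto
  ultimately show ?thesis
    unfolding pwc_def by (metis finite.emptyI)
qed

lemma pwc_truncate:
  assumes "pwc f"
  shows "pwc (\<lambda>t. if t < T then f t else (0::'a::real_normed_vector))"
proof -
  let ?f = "\<lambda>t. if t < T then f t else (0::'a)"
  have L: "\<forall>\<^sub>F s in at t. ?f s = f s" if "t < T" for t
    using order_tendstoD(2)[OF tendsto_ident_at that] by (rule eventually_mono) auto
  have R: "\<forall>\<^sub>F s in at t. ?f s = 0" if "t > T" for t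
    using order_tendstoD(1)[OF tendsto_ident_at that] by (rule eventually_mono) auto
  have at_le: "eventually P (at t within S)" if "eventually P (at t)" for P and t :: real and S
    using that at_le filter_leD by (metis subset_UNIV)
  have rt: "(?f \<longlongrightarrow> ?f t) (at_right t)" if "0 \<le> t" for t
  proof (cases "t < T")
    case True
    then show ?thesis
      using assms that tendsto_cong[OF at_le[OF L[OF True]]] by (auto simp: pwc_def)
  next
    case False
    have "\<forall>\<^sub>F s in at_right t. ?f s = 0"
      unfolding eventually_at_filter using False by (auto intro!: always_eventually)
    then show ?thesis
      using tendsto_eventually False by auto
  qed
  have lt: "\<exists>c. (?f \<longlongrightarrow> c) (at_left t)" if "0 < t" for t
  proof (cases "t \<le> T")
    case True
    have "\<forall>\<^sub>F s in at_left t. ?f s = f s"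
      unfolding eventually_at_filter using True by (auto intro!: always_eventually)
    then show ?thesis
      using assms that tendsto_cong by (fastforce simp: pwc_def)
  next
    case False
    then show ?thesis
      using tendsto_eventually[OF at_le[OF R]] by force
  qed
  have "{t \<in> {0<..S}. \<not> isCont ?f t} \<subseteq> insert T {t \<in> {0<..S}. \<not> isCont f t}" for S
  proof
    fix t assume t: "t \<in> {t \<in> {0<..S}. \<not> isCont ?f t}"
    have "isCont ?f t" if "t > T"
      using tendsto_eventually[OF R[OF that]] that by (simp add: isCont_def)
    moreover have "isCont ?f t" if "t < T" "isCont f t"
      using tendsto_cong[OF L[OF that(1)]] that by (simp add: isCont_def)
    ultimately show "t \<in> insert T {t \<in> {0<..S}. \<not> isCont f t}"
      using t by fastforce
  qed
  then have "finite {t \<in> {0<..S}. \<not> isCont ?f t}" for S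
    by (rule finite_subset) (use assms in \<open>simp add: pwc_def\<close>)
  then show ?thesis
    using rt lt unfolding pwc_def by blast
qed

text \<open>Integrability is a local property. Next to a given point the signal is continuous on either side
  after adjusting its value at that point, since one-sided limits exist and discontinuities do not
  accumulate.\<close>

lemma pwc_integrable:
  fixes f :: "real \<Rightarrow> 'a::banach"
  assumes "pwc f"
  shows "f integrable_on {0..T}"
proof -
  let ?D = "{t \<in> {0<..T}. \<not> isCont f t}"
  have fin: "finite ?D"
    using assms by (simp add: pwc_def)
  have R: "f integrable_on {x..v}"
    if x: "0 \<le> x" "x \<le> v" "v \<le> T" and cont: "\<And>t. x < t \<Longrightarrow> t \<le> v \<Longrightarrow> isCont f t" for x v
  proof (rule integrable_continuous_interval, unfold continuous_on_def, intro ballI)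
    fix t assume t: "t \<in> {x..v}"
    show "(f \<longlongrightarrow> f t) (at t within {x..v})"
    proof (cases "t = x")
      case True
      have "(f \<longlongrightarrow> f x) (at_right x)"
        using assms x by (simp add: pwc_def)
      then have "(f \<longlongrightarrow> f x) (at x within {x..v} - {x})"
        by (rule tendsto_within_subset) auto
      then show ?thesis
        using True by (simp add: at_within_def)
    next
      case False
      then show ?thesis
        using cont[of t] t unfolding isCont_def by (auto intro: tendsto_within_subset)
    qed
  qed
  have L: "f integrable_on {u..x}"
    if x: "0 \<le> u" "u \<le> x" "x \<le> T" and cont: "\<And>t. u \<le> t \<Longrightarrow> t < x \<Longrightarrow> t \<noteq> 0 \<Longrightarrow> isCont f t" for x u
  proof (cases "u = x")
    case False
    obtain c where c: "(f \<longlongrightarrow> c) (at_left x)"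
      using assms x False by (fastforce simp: pwc_def)
    define g where "g = (\<lambda>t. if t = x then c else f t)"
    have "continuous_on {u..x} g"
      unfolding continuous_on_def
    proof
      fix t assume t: "t \<in> {u..x}"
      show "(g \<longlongrightarrow> g t) (at t within {u..x})"
      proof (cases "t = x")
        case True
        have "\<forall>\<^sub>F s in at_left x. g s = f s"
          unfolding eventually_at_filter by (auto simp: g_def intro!: always_eventually)
        then have "(g \<longlongrightarrow> g t) (at_left x)"
          using c tendsto_cong True g_def by fastforce
        then have "(g \<longlongrightarrow> g t) (at x within {u..x} - {x})"
          by (rule tendsto_within_subset) auto
        then show ?thesis
          using True by (simp add: at_within_def)
      next
        case tx: False
        then have ev: "\<forall>\<^sub>F s in at t. g s = f s"
          using t by (intro eventually_mono[OF order_tendstoD(2)[OF tendsto_ident_at, of t x UNIV]])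
            (auto simp: g_def)
        show ?thesis
        proof (cases "t = 0")
          case False
          then have "(g \<longlongrightarrow> g t) (at t)"
            using cont[of t] t tx tendsto_cong[OF ev] by (auto simp: isCont_def g_def)
          then show ?thesis
            by (rule tendsto_within_subset) auto
        next
          case True
          have "(f \<longlongrightarrow> f t) (at_right t)"
            using assms True by (simp add: pwc_def)
          moreover have "\<forall>\<^sub>F s in at_right t. g s = f s"
            using ev at_le filter_leD by (metis subset_UNIV)
          ultimately have "(g \<longlongrightarrow> g t) (at_right t)"
            using tendsto_cong tx by (fastforce simp: g_def)
          then have "(g \<longlongrightarrow> g t) (at t within {u..x} - {t})"
            by (rule tendsto_within_subset) (use True x t in auto)
          then show ?thesis
            by (simp add: at_within_def)
        qed
      qed
    qed
    then have "g integrable_on {u..x}"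
      by (rule integrable_continuous_interval)
    then show ?thesis
      by (rule integrable_spike_finite[of "{x}", rotated 2]) (auto simp: g_def)
  qed (use integrable_on_refl[of f x] in simp)
  have "f integrable_on cbox 0 T"
  proof (rule integrable_on_little_subintervals, intro ballI)
    fix x assume x: "x \<in> cbox 0 T"
    have "finite (insert 0 ?D - {x})"
      using fin by simp
    then obtain d where d: "d > 0" "\<forall>t \<in> insert 0 ?D - {x}. d \<le> dist x t"
      using finite_set_avoid[of "insert 0 ?D - {x}" x] by force
    have C: "isCont f t" if "0 < t" "t \<le> T" "t \<noteq> x" "dist x t < d" for t
      using d(2)[rule_format, of t] that by force
    show "\<exists>d>0. \<forall>u v. x \<in> cbox u v \<and> cbox u v \<subseteq> ball x d \<and> cbox u v \<subseteq> cbox 0 T \<longrightarrow>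
        f integrable_on cbox u v"
    proof (intro exI[of _ d] conjI allI impI d(1))
      fix u v assume "x \<in> cbox u v \<and> cbox u v \<subseteq> ball x d \<and> cbox u v \<subseteq> cbox 0 T"
      then have uv: "u \<le> x" "x \<le> v" "0 \<le> u" "v \<le> T" and sub: "{u..v} \<subseteq> ball x d"
        by auto
      have "f integrable_on {u..x}"
      proof (rule L)
        fix t assume "u \<le> t" "t < x" "t \<noteq> 0"
        then show "isCont f t"
          using C[of t] uv sub by (auto simp: subset_iff)
      qed (use uv in auto)
      moreover have "f integrable_on {x..v}"
      proof (rule R)
        fix t assume "x < t" "t \<le> v"
        then show "isCont f t"
          using C[of t] uv sub by (auto simp: subset_iff)
      qed (use uv in auto)
      ultimately show "f integrable_on cbox u v"
        using integrable_combine uv by fastforce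
    qed
  qed
  then show ?thesis
    by simp
qed

lemma pwc_bounded:
  fixes f :: "real \<Rightarrow> 'a::real_normed_vector"
  assumes f: "pwc f" and T: "0 \<le> T"
  shows "\<exists>B\<ge>0. \<forall>t\<in>{0..T}. norm (f t) \<le> B"
proof (rule Bolzano[where P = "\<lambda>a b. \<exists>B\<ge>0. \<forall>t\<in>{a..b}. 0 \<le> t \<longrightarrow> norm (f t) \<le> B", OF T, THEN exE])
  fix a b c :: real
  assume "\<exists>B\<ge>0. \<forall>t\<in>{a..b}. 0 \<le> t \<longrightarrow> norm (f t) \<le> B"
    and "\<exists>B\<ge>0. \<forall>t\<in>{b..c}. 0 \<le> t \<longrightarrow> norm (f t) \<le> B"
  then obtain B C where "0 \<le> B" "0 \<le> C"
    "\<And>t. a \<le> t \<Longrightarrow> t \<le> b \<Longrightarrow> 0 \<le> t \<Longrightarrow> norm (f t) \<le> B"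
    "\<And>t. b \<le> t \<Longrightarrow> t \<le> c \<Longrightarrow> 0 \<le> t \<Longrightarrow> norm (f t) \<le> C"
    by auto
  then show "\<exists>B\<ge>0. \<forall>t\<in>{a..c}. 0 \<le> t \<longrightarrow> norm (f t) \<le> B"
    by (intro exI[of _ "max B C"]) (auto simp: le_max_iff_disj, meson linear)
next
  fix x assume x: "0 \<le> x" "x \<le> T"
  have near: "\<forall>\<^sub>F t in F. norm (f t) < norm c + 1" if "(f \<longlongrightarrow> c) F" for c and F :: "real filter"
    using order_tendstoD(2)[OF tendsto_norm[OF that]] by simp
  have "(f \<longlongrightarrow> f x) (at_right x)"
    using f x by (simp add: pwc_def)
  from near[OF this] obtain u where u: "x < u" "\<And>t. x < t \<Longrightarrow> t < u \<Longrightarrow> norm (f t) < norm (f x) + 1"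
    unfolding eventually_at_right_field by blast
  obtain l C where l: "l < x" "0 \<le> C" "\<And>t. 0 \<le> t \<Longrightarrow> l < t \<Longrightarrow> t < x \<Longrightarrow> norm (f t) \<le> C"
  proof (cases "x = 0")
    case True
    then show ?thesis
      using that[of "-1" 0] by simp
  next
    case False
    then have "0 < x"
      using x by simp
    then obtain c where "(f \<longlongrightarrow> c) (at_left x)"
      using f unfolding pwc_def by blast
    from near[OF this] obtain l where "l < x" "\<And>t. l < t \<Longrightarrow> t < x \<Longrightarrow> norm (f t) < norm c + 1"
      unfolding eventually_at_left_field by blast
    then show ?thesis
      using that[of l "norm c + 1"] by (simp add: less_imp_le)
  qed
  define B where "B = C + norm (f x) + 1"
  have B: "norm (f t) \<le> B" if "0 \<le> t" "l < t" "t < u" for t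
  proof -
    have "norm (f t) \<le> max C (norm (f x) + 1)"
      using l(3)[of t] u(2)[of t] that by (cases t x rule: linorder_cases) auto
    then show ?thesis
      using l(2) norm_ge_zero[of "f x"] unfolding B_def by linarith
  qed
  show "\<exists>d>0. \<forall>a b. a \<le> x \<and> x \<le> b \<and> b - a < d \<longrightarrow>
      (\<exists>B\<ge>0. \<forall>t\<in>{a..b}. 0 \<le> t \<longrightarrow> norm (f t) \<le> B)"
  proof (rule exI[of _ "min (x - l) (u - x)"], intro conjI allI impI)
    show "0 < min (x - l) (u - x)"
      using l u by simp
    fix a b assume ab: "a \<le> x \<and> x \<le> b \<and> b - a < min (x - l) (u - x)"
    show "\<exists>B\<ge>0. \<forall>t\<in>{a..b}. 0 \<le> t \<longrightarrow> norm (f t) \<le> B"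
      using B ab l(2) by (intro exI[of _ B]) (auto simp: B_def)
  qed
qed auto

text \<open>State trajectories are only known to have right derivatives. For \<open>\<epsilon> > 0\<close>, the last point at which
  the slope from \<open>a\<close> is at most \<open>\<epsilon>\<close> must be \<open>b\<close>, because a vanishing right derivative pushes it further.\<close>

lemma constant_if_right_derivative_zero:
  fixes F :: "real \<Rightarrow> 'a::real_normed_vector"
  assumes ab: "a \<le> b" and cont: "continuous_on {a..b} F"
    and der: "\<And>t. a \<le> t \<Longrightarrow> t < b \<Longrightarrow> (F has_vector_derivative 0) (at_right t)"
  shows "F b = F a"
proof -
  have "norm (F b - F a) \<le> \<epsilon> * (b - a)" if "\<epsilon> > 0" for \<epsilon>
  proof -
    define S where "S = {t \<in> {a..b}. norm (F t - F a) \<le> \<epsilon> * (t - a)}"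
    have "closed S"
      unfolding S_def by (rule continuous_on_closed_Collect_le) (intro continuous_intros cont closed_atLeastAtMost)+
    moreover have "bounded S"
      by (rule bounded_subset[of "{a..b}"]) (auto simp: S_def)
    ultimately have "compact S"
      by (simp add: compact_eq_bounded_closed)
    moreover have "a \<in> S"
      using ab by (simp add: S_def)
    ultimately obtain c where c: "c \<in> S" "\<And>t. t \<in> S \<Longrightarrow> t \<le> c"
      using compact_attains_sup[of S] by auto
    have "c = b"
    proof (rule ccontr)
      assume "c \<noteq> b"
      then have cb: "a \<le> c" "c < b"
        using c by (auto simp: S_def)
      from der[OF this] obtain d where d: "d > 0"
        "\<And>y. y \<in> {c<..} \<Longrightarrow> norm (y - c) < d \<Longrightarrow> norm (F y - F c) \<le> \<epsilon> * norm (y - c)"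
        unfolding has_vector_derivative_def has_derivative_within_alt using \<open>\<epsilon> > 0\<close> by fastforce
      define y where "y = min b (c + d / 2)"
      have y: "c < y" "y \<le> b" "y - c < d"
        using cb d(1) by (auto simp: y_def min_def)
      have "norm (F y - F a) \<le> norm (F y - F c) + norm (F c - F a)"
        by (metis norm_triangle_ineq diff_add_cancel add_diff_eq)
      also have "\<dots> \<le> \<epsilon> * (y - c) + \<epsilon> * (c - a)"
        using d(2)[of y] y c(1) by (auto simp: S_def)
      finally have "y \<in> S"
        using y cb by (auto simp: S_def algebra_simps)
      then show False
        using c(2) y by force
    qed
    then show ?thesis
      using c by (simp add: S_def)
  qed
  then have "norm (F b - F a) \<le> e" if "e > 0" for e
  proof -
    have *: "norm (F b - F a) \<le> e / (b - a + 1) * (b - a)"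
      using \<open>\<And>\<epsilon>. \<epsilon> > 0 \<Longrightarrow> norm (F b - F a) \<le> \<epsilon> * (b - a)\<close>[of "e / (b - a + 1)"] ab that by simp
    also have "\<dots> \<le> e"
      using ab that by (simp add: field_simps)
    finally show ?thesis .
  qed
  then show ?thesis
    using field_le_epsilon[of "norm (F b - F a)" 0] by auto
qed

text \<open>The integration operator \<open>J\<close>.\<close>

definition integ :: "(real \<Rightarrow> 'a::banach) \<Rightarrow> real \<Rightarrow> 'a" where
  "integ f t = integral {0..t} f"

lemma integ_nonpos [simp]: "t \<le> 0 \<Longrightarrow> integ f t = 0"
  by (cases "t = 0") (auto simp: integ_def)

lemma continuous_on_integ:
  assumes "pwc f"
  shows "continuous_on {0..} (integ f)"
proof (unfold continuous_on_def, intro ballI)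
  fix t :: real assume "t \<in> {0..}"
  then have t: "0 \<le> t" "t < t + 1" by auto
  have "continuous_on {0..t+1} (integ f)"
    unfolding integ_def by (rule indefinite_integral_continuous_1[OF pwc_integrable[OF assms]])
  then have "(integ f \<longlongrightarrow> integ f t) (at t within {0..t+1})"
    using t by (auto simp: continuous_on_def)
  moreover have "at t within {0..t+1} = at t within {0..}"
    by (rule at_within_nhd[of _ "{..<t+1}"]) auto
  ultimately show "(integ f \<longlongrightarrow> integ f t) (at t within {0..})"
    by simp
qed

lemma pwc_integ [intro]: "pwc f \<Longrightarrow> pwc (integ f)"
  by (rule pwc_continuous_on[OF continuous_on_integ])

lemma integ_right_derivative:
  assumes "pwc f" "0 \<le> t"
  shows "(integ f has_vector_derivative f t) (at_right t)"
proof -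
  have int: "f integrable_on {t..t+1}"
    by (rule integrable_subinterval_real[OF pwc_integrable[OF assms(1), of "t+1"]]) (use assms in auto)
  have "(f \<longlongrightarrow> f t) (at t within ({t..t+1} - {t}))"
    by (rule tendsto_within_subset[of _ _ _ "{t<..}"]) (use assms in \<open>auto simp: pwc_def\<close>)
  moreover have "at t within ({t..t+1} - {t}) = at t within {t..t+1}"
    by (simp add: at_within_def)
  ultimately have "((\<lambda>u. integral {t..u} f) has_vector_derivative f t) (at t within {t..t+1})"
    using integral_has_vector_derivative_continuous_at[OF int, of t "{}"]
    by (simp add: continuous_within)
  then have "((\<lambda>u. integ f t + integral {t..u} f) has_vector_derivative f t) (at t within {t..t+1})"
    by (auto intro!: derivative_eq_intros)
  then have "(integ f has_vector_derivative f t) (at t within {t..t+1})"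
  proof (rule has_vector_derivative_transform[rotated 2])
    fix u assume "u \<in> {t..t+1}"
    then show "integ f u = integ f t + integral {t..u} f"
      unfolding integ_def
      using Henstock_Kurzweil_Integration.integral_combine[of 0 t u f] pwc_integrable[OF assms(1)] assms by auto
  qed auto
  moreover have "at t within {t..t+1} = at_right t"
  proof -
    have "at t within {t..t+1} = at t within {t<..}"
      by (rule at_within_nhd[of _ "{..<t+1}"]) auto
    then show ?thesis .
  qed
  ultimately show ?thesis
    by simp
qed

text \<open>The fundamental theorem of calculus for right derivatives; the difference of both sides has right
  derivative zero.\<close>

lemma integral_right_derivative:
  fixes F :: "real \<Rightarrow> 'a::banach"
  assumes cont: "continuous_on {0..} F" and f: "pwc f"
    and der: "\<And>t. 0 \<le> t \<Longrightarrow> (F has_vector_derivative f t) (at_right t)" and T: "0 \<le> T"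
  shows "integ f T = F T - F 0"
proof -
  have "F T - integ f T = F 0 - integ f 0"
  proof (rule constant_if_right_derivative_zero[OF T, of "\<lambda>t. F t - integ f t"])
    show "continuous_on {0..T} (\<lambda>t. F t - integ f t)"
      by (intro continuous_intros continuous_on_subset[OF cont]
          continuous_on_subset[OF continuous_on_integ[OF f]]) auto
    show "((\<lambda>t. F t - integ f t) has_vector_derivative 0) (at_right t)" if "0 \<le> t" for t
      using has_vector_derivative_diff[OF der[OF that] integ_right_derivative[OF f that]] by simp
  qed
  then show ?thesis
    by (simp add: algebra_simps)
qed

lemma integ_add: "pwc f \<Longrightarrow> pwc g \<Longrightarrow> integ (\<lambda>t. f t + g t) = (\<lambda>t. integ f t + integ g t)"
  by (rule ext) (auto simp: integ_def intro!: integral_add pwc_integrable)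

lemma integ_diff: "pwc f \<Longrightarrow> pwc g \<Longrightarrow> integ (\<lambda>t. f t - g t) = (\<lambda>t. integ f t - integ g t)"
  by (rule ext) (auto simp: integ_def intro!: integral_diff pwc_integrable)

lemma integ_mult: "integ (\<lambda>t. c * f t :: 'a::{real_normed_field,banach}) = (\<lambda>t. c * integ f t)"
  by (rule ext) (simp add: integ_def)

lemma integ_sum:
  "(\<And>i. i \<in> I \<Longrightarrow> pwc (f i)) \<Longrightarrow> integ (\<lambda>t. \<Sum>i\<in>I. f i t) = (\<lambda>t. \<Sum>i\<in>I. integ (f i) t)"
proof (induction I rule: infinite_finite_induct)
  case (insert i I)
  then show ?case
    using integ_add[of "f i" "\<lambda>t. \<Sum>i\<in>I. f i t"] by (auto intro!: pwc_sum)
qed (auto simp: integ_def fun_eq_iff)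

lemma integ_cong: "(\<And>s. 0 \<le> s \<Longrightarrow> s < t \<Longrightarrow> f s = g s) \<Longrightarrow> integ f t = integ g t"
  unfolding integ_def by (rule integral_spike[of "{t}"]) auto

lemma integ_bounded_linear:
  assumes "bounded_linear h" "pwc f"
  shows "integ (\<lambda>t. h (f t)) t = h (integ f t)"
  using integral_linear[OF pwc_integrable[OF assms(2)] assms(1)] by (simp add: integ_def o_def)

lemma integ_Re: "pwc f \<Longrightarrow> integ (\<lambda>t. Re (f t)) t = Re (integ f t)"
  by (rule integ_bounded_linear[OF bounded_linear_Re])

lemma integ_of_real:
  "pwc f \<Longrightarrow> integ (\<lambda>t. of_real (f t) :: 'a::{real_normed_algebra_1,banach}) t = of_real (integ f t)"
  by (rule integ_bounded_linear[OF bounded_linear_of_real])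

lemma integ_product_rule:
  fixes F G :: "real \<Rightarrow> 'a::{real_normed_field,banach}"
  assumes "continuous_on {0..} F" "continuous_on {0..} G" "pwc f" "pwc g"
    and "\<And>t. 0 \<le> t \<Longrightarrow> (F has_vector_derivative f t) (at_right t)"
    and "\<And>t. 0 \<le> t \<Longrightarrow> (G has_vector_derivative g t) (at_right t)" and "0 \<le> T"
  shows "integ (\<lambda>t. F t * g t + f t * G t) T = F T * G T - F 0 * G 0"
proof -
  have "pwc F" "pwc G"
    using assms pwc_continuous_on by auto
  then have "pwc (\<lambda>t. F t * g t + f t * G t)"
    using assms by (intro pwc_intros)
  then show ?thesis
    using assms by (intro integral_right_derivative) (auto intro!: continuous_intros has_vector_derivative_mult)
qed

lemma integ_mono:
  fixes f g :: "real \<Rightarrow> real"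
  assumes "pwc f" "pwc g" "\<And>t. 0 \<le> t \<Longrightarrow> f t \<le> g t"
  shows "integ f T \<le> integ g T"
  unfolding integ_def by (rule integral_le) (use assms in \<open>auto intro: pwc_integrable\<close>)

section \<open>Polynomials in the integration operator\<close>

text \<open>\<open>act p f\<close> is \<open>p(J) f\<close>, in Horner form: \<open>(a + X p)(J) f = a f + J (p(J) f)\<close>.\<close>

definition act :: "complex poly \<Rightarrow> (real \<Rightarrow> complex) \<Rightarrow> real \<Rightarrow> complex" where
  "act p f = fold_coeffs (\<lambda>a h t. a * f t + integ h t) p (\<lambda>t. 0)"

lemma integ_0 [simp]: "integ (\<lambda>t. 0) = (\<lambda>t. 0)"
  by (simp add: integ_def fun_eq_iff)

lemma act_0 [simp]: "act 0 f = (\<lambda>t. 0)"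
  by (simp add: act_def)

lemma act_pCons [simp]: "act (pCons a p) f = (\<lambda>t. a * f t + integ (act p f) t)"
  by (cases "a = 0 \<and> p = 0") (auto simp: act_def)

lemma act_1 [simp]: "act 1 f = f"
  by (simp add: one_pCons)

lemma pwc_act [intro]: "pwc f \<Longrightarrow> pwc (act p f)"
  by (induction p) (auto intro!: pwc_intros)

lemma act_add_poly: "pwc f \<Longrightarrow> act (p + q) f = (\<lambda>t. act p f t + act q f t)"
proof (induction p q rule: poly_induct2)
  case (pCons a p b q)
  then show ?case
    by (intro ext) (simp add: integ_add pwc_act algebra_simps)
qed simp

lemma act_smult: "act (smult c p) f = (\<lambda>t. c * act p f t)"
  by (induction p) (auto simp: integ_mult algebra_simps)

lemma act_sum_poly: "pwc f \<Longrightarrow> act (\<Sum>i\<in>I. p i) f = (\<lambda>t. \<Sum>i\<in>I. act (p i) f t)"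
  by (induction I rule: infinite_finite_induct) (simp_all add: act_add_poly)

lemma act_add: "pwc f \<Longrightarrow> pwc g \<Longrightarrow> act p (\<lambda>t. f t + g t) = (\<lambda>t. act p f t + act p g t)"
  by (induction p) (auto simp: integ_add pwc_act algebra_simps)

lemma act_cmult: "act p (\<lambda>t. c * f t) = (\<lambda>t. c * act p f t)"
  by (induction p) (auto simp: integ_mult algebra_simps)

lemma act_diff: "pwc f \<Longrightarrow> pwc g \<Longrightarrow> act p (\<lambda>t. f t - g t) = (\<lambda>t. act p f t - act p g t)"
  by (induction p) (auto simp: integ_diff pwc_act algebra_simps)

lemma act_zero [simp]: "act p (\<lambda>t. 0) = (\<lambda>t. 0)"
  by (induction p) simp_all

lemma act_sum:
  "(\<And>i. i \<in> I \<Longrightarrow> pwc (f i)) \<Longrightarrow> act p (\<lambda>t. \<Sum>i\<in>I. f i t) = (\<lambda>t. \<Sum>i\<in>I. act p (f i) t)"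
  by (induction I rule: infinite_finite_induct) (simp_all add: act_add pwc_sum)

text \<open>Signals form a module over the polynomials. This is what makes linear time-invariant operators commute.\<close>

lemma act_mult: "pwc f \<Longrightarrow> act (p * q) f = act p (act q f)"
  by (induction p) (simp_all add: act_add_poly act_smult pwc_act)

lemma act_commute: "pwc f \<Longrightarrow> act p (act q f) = act q (act p f)"
  by (metis act_mult mult.commute)

lemma act_monom: "act (monom c i) f = (\<lambda>t. c * (integ ^^ i) f t)"
  by (induction i) (simp_all add: monom_0 monom_Suc integ_mult)

lemma pwc_integ_pow [intro]: "pwc f \<Longrightarrow> pwc ((integ ^^ i) f)"
  by (induction i) auto

text \<open>Causality: values before \<open>T\<close> are determined by the values of the input before \<open>T\<close>.\<close>

lemma act_cong:
  "(\<And>s. s < T \<Longrightarrow> f s = g s) \<Longrightarrow> t < T \<Longrightarrow> act p f t = act p g t"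
  by (induction p arbitrary: t) (auto intro!: integ_cong)

abbreviation cpoly :: "real poly \<Rightarrow> complex poly" where
  "cpoly \<equiv> map_poly of_real"

text \<open>Real polynomials commute with taking real parts, so equations with real data solved over the complex
  numbers have real solutions.\<close>

lemma act_cpoly_Re:
  "pwc f \<Longrightarrow> act (cpoly p) (\<lambda>t. of_real (Re (f t))) = (\<lambda>t. of_real (Re (act (cpoly p) f t)))"
proof (induction p)
  case (pCons a p)
  have [simp]: "cpoly (pCons a p) = pCons (of_real a) (cpoly p)"
    using pCons(1) by (simp add: map_poly_pCons)
  show ?case
    using pCons by (intro ext) (simp add: integ_of_real integ_Re pwc_Re pwc_act)
qed simp

lemma act_cpoly_real:
  assumes "pwc g"
  shows "act (cpoly p) (\<lambda>t. of_real (g t)) t \<in> \<real>"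
proof -
  have "act (cpoly p) (\<lambda>t. of_real (g t)) t = of_real (Re (act (cpoly p) (\<lambda>t. of_real (g t)) t))"
    using fun_cong[OF act_cpoly_Re[OF pwc_of_real[OF assms], of p]] by simp
  then show ?thesis
    by (metis Reals_of_real)
qed

text \<open>The solution of \<open>y' = a y + u\<close> with \<open>y(0) = 0\<close>, by variation of constants.\<close>

definition exp_filter :: "complex \<Rightarrow> (real \<Rightarrow> complex) \<Rightarrow> real \<Rightarrow> complex" where
  "exp_filter a u t = exp (a * of_real t) * integ (\<lambda>s. exp (- a * of_real s) * u s) t"

lemma exp_of_real_derivative:
  "((\<lambda>t. exp (a * complex_of_real t)) has_vector_derivative a * exp (a * of_real t)) (at t within S)"
proof -
  have "((\<lambda>z. exp (a * z)) has_field_derivative a * exp (a * of_real t)) (at (of_real t))"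
    by (auto intro!: derivative_eq_intros)
  then show ?thesis
    by (rule has_vector_derivative_real_field)
qed

lemma continuous_exp_of_real: "continuous_on S (\<lambda>t. exp (a * complex_of_real t))"
  by (intro continuous_intros)

lemma pwc_exp_mult [intro]: "pwc u \<Longrightarrow> pwc (\<lambda>s. exp (a * complex_of_real s) * u s)"
  by (intro pwc_mult pwc_continuous_on[OF continuous_exp_of_real])

lemma pwc_exp_filter [intro]: "pwc u \<Longrightarrow> pwc (exp_filter a u)"
  unfolding exp_filter_def[abs_def] by blast

lemma exp_filter_eq:
  assumes "pwc u"
  shows "exp_filter a u = integ (\<lambda>t. a * exp_filter a u t + u t)"
proof
  fix T
  let ?v = "\<lambda>s. exp (- a * of_real s) * u s"
  have v: "pwc ?v"
    using assms by blast
  show "exp_filter a u T = integ (\<lambda>t. a * exp_filter a u t + u t) T"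
  proof (cases "T \<le> 0")
    case False
    have "integ (\<lambda>t. exp (a * of_real t) * ?v t + a * exp (a * of_real t) * integ ?v t) T =
        exp (a * of_real T) * integ ?v T - exp (a * of_real 0) * integ ?v 0"
      by (rule integ_product_rule[OF continuous_exp_of_real continuous_on_integ[OF v] _ v
            exp_of_real_derivative integ_right_derivative[OF v]])
         (use False in \<open>auto intro!: pwc_continuous_on continuous_intros\<close>)
    moreover have "exp (a * of_real t) * ?v t + a * exp (a * of_real t) * integ ?v t =
        a * exp_filter a u t + u t" for t
      by (simp add: exp_filter_def exp_minus field_simps)
    ultimately show ?thesis
      by (simp only: exp_filter_def) (simp add: exp_filter_def)
  qed (simp add: exp_filter_def)
qed

lemma first_order_unique:
  fixes g :: "real \<Rightarrow> complex"
  assumes g: "pwc g" and eq: "\<And>t. t < T \<Longrightarrow> g t = a * integ g t" and t: "t < T"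
  shows "g t = 0"
proof -
  have "integ g t = 0"
  proof (cases "t \<le> 0")
    case False
    have "exp (- a * of_real t) * integ g t = exp (- a * of_real 0) * integ g 0"
    proof (rule constant_if_right_derivative_zero[where F = "\<lambda>t. exp (- a * of_real t) * integ g t"])
      show "continuous_on {0..t} (\<lambda>t. exp (- a * of_real t) * integ g t)"
        by (intro continuous_intros continuous_on_subset[OF continuous_on_integ[OF g]]) auto
      fix s assume s: "0 \<le> s" "s < t"
      have "((\<lambda>t. exp (- a * of_real t) * integ g t) has_vector_derivative
          exp (- a * of_real s) * g s + - a * exp (- a * of_real s) * integ g s) (at_right s)"
        by (rule has_vector_derivative_mult[OF exp_of_real_derivative integ_right_derivative[OF g s(1)]])
      moreover have "g s = a * integ g s"
        using eq s t by simp
      ultimately show "((\<lambda>t. exp (- a * of_real t) * integ g t) has_vector_derivative 0) (at_right s)"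
        by simp
    qed (use False in auto)
    then show ?thesis
      by simp
  qed simp
  then show ?thesis
    using eq t by simp
qed

text \<open>A polynomial with constant term \<open>1\<close> is a product of factors \<open>1 - a X\<close>, so questions about \<open>p(J)\<close> reduce to
  the first order operators \<open>1 - a J\<close>.\<close>

lemma split_linear_factor:
  fixes p :: "complex poly"
  assumes "poly p 0 = 1" "degree p > 0"
  obtains a q where "p = [:1, -a:] * q" "poly q 0 = 1" "degree q < degree p"
proof -
  have "\<not> constant (poly p)"
    using assms(2) by (simp add: constant_degree)
  then obtain z where z: "poly p z = 0"
    using fundamental_theorem_of_algebra by blast
  then have nz: "z \<noteq> 0"
    using assms(1) by auto
  obtain k where k: "p = [:-z, 1:] * k"
    using z unfolding poly_eq_0_iff_dvd by (elim dvdE)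
  have "[:1, -(1/z):] * smult (-z) k = smult (-z) [:1, -(1/z):] * k"
    by (simp only: mult_smult_left mult_smult_right)
  also have "smult (-z) [:1, -(1/z):] = [:-z, 1:]"
    using nz by simp
  finally have "p = [:1, -(1/z):] * smult (-z) k"
    using k by simp
  moreover have "poly (smult (-z) k) 0 = 1"
    using assms(1) k by simp
  moreover have "degree (smult (-z) k) < degree p"
  proof -
    have "k \<noteq> 0"
      using assms(1) k by auto
    then show ?thesis
      using k nz by (simp add: degree_mult_eq del: mult_pCons_left)
  qed
  ultimately show ?thesis
    using that by blast
qed

lemma act_linear_factor: "act [:1, -a:] f = (\<lambda>t. f t - a * integ f t)"
  using integ_mult[of "-a" f] by simp

lemma degree_0_eq_1: "degree p = 0 \<Longrightarrow> poly p 0 = 1 \<Longrightarrow> p = (1::complex poly)"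
  by (auto elim!: degree_eq_zeroE simp: one_pCons)

text \<open>The equation \<open>g - a J g = u\<close> is solved by \<open>g = u + a y\<close>, where \<open>y' = a y + u\<close>: then \<open>J g = y\<close>.\<close>

lemma act_solvable:
  assumes "poly p 0 = 1" "pwc u"
  shows "\<exists>f. pwc f \<and> act p f = u"
  using assms
proof (induction "degree p" arbitrary: p u rule: less_induct)
  case less
  show ?case
  proof (cases "degree p = 0")
    case True
    then have "p = 1"
      using less.prems(1) by (rule degree_0_eq_1)
    then show ?thesis
      using less.prems(2) by auto
  next
    case False
    then obtain a q where q: "p = [:1, -a:] * q" "poly q 0 = 1" "degree q < degree p"
      using split_linear_factor less.prems by blast
    define g where "g = (\<lambda>t. a * exp_filter a u t + u t)"
    have g: "pwc g"
      unfolding g_def by (intro pwc_intros pwc_exp_filter less.prems)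
    have "integ g = exp_filter a u"
      using exp_filter_eq[OF less.prems(2)] by (simp add: g_def)
    then have "act [:1, -a:] g = u"
      unfolding act_linear_factor by (simp add: g_def)
    moreover obtain f where "pwc f" "act q f = g"
      using less.hyps[OF q(3) q(2) g] by blast
    ultimately show ?thesis
      using act_mult q(1) by blast
  qed
qed

text \<open>The local form, on \<open>t < T\<close> only, is the one that combines with causality when an input is cut off at
  time \<open>T\<close>.\<close>

lemma act_injective:
  assumes "poly p 0 = 1" "pwc f" "\<And>t. t < T \<Longrightarrow> act p f t = 0" "t < T"
  shows "f t = 0"
  using assms
proof (induction "degree p" arbitrary: p t rule: less_induct)
  case less
  show ?case
  proof (cases "degree p = 0")
    case True
    then show ?thesis
      using less.prems degree_0_eq_1[of p] by auto
  next
    case False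
    then obtain a q where q: "p = [:1, -a:] * q" "poly q 0 = 1" "degree q < degree p"
      using split_linear_factor less.prems(1) by blast
    have "act q f t = 0" if "t < T" for t
    proof (rule first_order_unique[OF _ _ that])
      fix t assume "t < T"
      then have "act [:1, -a:] (act q f) t = 0"
        using less.prems(2,3) by (simp add: q(1) act_mult del: act_pCons mult_pCons_left)
      then show "act q f t = a * integ (act q f) t"
        unfolding act_linear_factor by simp
    qed (use less.prems in auto)
    then show ?thesis
      using less.hyps[OF q(3,2)] less.prems by blast
  qed
qed

lemma act_injective_eq:
  assumes "poly p 0 = 1" "pwc f" "pwc g" "\<And>t. t < T \<Longrightarrow> act p f t = act p g t" "t < T"
  shows "f t = g t"
proof -
  have "f t - g t = 0"
    by (rule act_injective[OF assms(1) pwc_diff[OF assms(2,3)] _ assms(5)])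
       (use assms in \<open>simp add: act_diff\<close>)
  then show ?thesis
    by simp
qed

lemma act_cpoly_solvable:
  assumes "poly p 0 = 1" "pwc u"
  shows "\<exists>f. pwc f \<and> act (cpoly p) (\<lambda>t. of_real (f t)) = (\<lambda>t. of_real (u t))"
proof -
  have "poly (cpoly p) 0 = 1"
    using assms(1) by (simp add: poly_0_coeff_0 coeff_map_poly)
  then obtain f where "pwc f" "act (cpoly p) f = (\<lambda>t. of_real (u t))"
    using act_solvable pwc_of_real[OF assms(2)] by blast
  then have "act (cpoly p) (\<lambda>t. of_real (Re (f t))) = (\<lambda>t. of_real (u t))"
    by (simp add: act_cpoly_Re)
  then show ?thesis
    using \<open>pwc f\<close> pwc_Re by blast
qed

section \<open>Stable operators preserve exponential decay\<close>

definition exp_decay :: "(real \<Rightarrow> complex) \<Rightarrow> bool" where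
  "exp_decay f \<longleftrightarrow> (\<exists>c>0. \<exists>M\<ge>0. \<forall>t\<ge>0. norm (f t) \<le> M * exp (- c * t))"

text \<open>Any smaller rate works as well. This lets two signals share a rate, and a signal be given a rate below
  that of a filter.\<close>

lemma exp_decayE:
  assumes "exp_decay f"
  obtains c M where "0 < c" "0 \<le> M" "\<And>c' t. c' \<le> c \<Longrightarrow> 0 \<le> t \<Longrightarrow> norm (f t) \<le> M * exp (- c' * t)"
proof -
  obtain c M where c: "0 < c" "0 \<le> M" "\<And>t. 0 \<le> t \<Longrightarrow> norm (f t) \<le> M * exp (- c * t)"
    using assms by (auto simp: exp_decay_def)
  have "norm (f t) \<le> M * exp (- c' * t)" if "c' \<le> c" "0 \<le> t" for c' t
  proof -
    have "M * exp (- c * t) \<le> M * exp (- c' * t)"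
      using that c(2) by (intro mult_left_mono) (simp_all add: mult_right_mono)
    then show ?thesis
      using c(3)[OF that(2)] by linarith
  qed
  then show ?thesis
    using that c by blast
qed

lemma exp_decay_add:
  assumes "exp_decay f" "exp_decay g"
  shows "exp_decay (\<lambda>t. f t + g t)"
proof -
  obtain c M d N where c: "0 < c" "0 \<le> M" "0 < d" "0 \<le> N"
    "\<And>c' t. c' \<le> c \<Longrightarrow> 0 \<le> t \<Longrightarrow> norm (f t) \<le> M * exp (- c' * t)"
    "\<And>c' t. c' \<le> d \<Longrightarrow> 0 \<le> t \<Longrightarrow> norm (g t) \<le> N * exp (- c' * t)"
    using assms by (elim exp_decayE) blast
  have "norm (f t + g t) \<le> (M + N) * exp (- min c d * t)" if "0 \<le> t" for t
    using norm_triangle_ineq[of "f t" "g t"] c(5)[OF min.cobounded1 that, of d] c(6)[OF min.cobounded2 that, of c]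
    by (simp only: distrib_right)
  then show ?thesis
    unfolding exp_decay_def using c by (intro exI[of _ "min c d"] exI[of _ "M + N"] conjI) auto
qed

lemma exp_decay_cmult: "exp_decay f \<Longrightarrow> exp_decay (\<lambda>t. a * f t)"
proof (elim exp_decayE)
  fix c M assume c: "0 < c" "0 \<le> M" "\<And>c' t. c' \<le> c \<Longrightarrow> 0 \<le> t \<Longrightarrow> norm (f t) \<le> M * exp (- c' * t)"
  have "norm (a * f t) \<le> norm a * M * exp (- c * t)" if "0 \<le> t" for t
    using c(3)[OF order_refl that] by (simp add: norm_mult mult_left_mono mult.assoc)
  then show ?thesis
    unfolding exp_decay_def using c by (intro exI[of _ c] exI[of _ "norm a * M"] conjI) auto
qed

lemma exp_decay_tendsto_0:
  assumes "exp_decay f"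
  shows "(f \<longlongrightarrow> 0) at_top"
proof -
  obtain c M where c: "0 < c" "\<And>t. 0 \<le> t \<Longrightarrow> norm (f t) \<le> M * exp (- c * t)"
    using assms by (auto simp: exp_decay_def)
  have "filterlim (\<lambda>t. c * t) at_top at_top"
    using c(1) by (intro filterlim_tendsto_pos_mult_at_top[OF tendsto_const] filterlim_ident)
  then have "((\<lambda>t. exp (- (c * t))) \<longlongrightarrow> 0) at_top"
    by (intro filterlim_compose[OF exp_at_bot]) (simp add: filterlim_uminus_at_top[symmetric] filterlim_uminus_at_bot)
  then have "((\<lambda>t. M * exp (- c * t)) \<longlongrightarrow> 0) at_top"
    using tendsto_mult_left[of "\<lambda>t. exp (- (c * t))" 0 at_top M] by simp
  then show ?thesis
    by (rule Lim_null_comparison[rotated])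
       (use c(2) in \<open>auto intro: eventually_mono[OF eventually_ge_at_top[of 0]]\<close>)
qed

text \<open>With a decay rate \<open>b\<close> of the input strictly below \<open>- Re a\<close>, the convolution integral of the two
  exponentials is of order \<open>exp (- b t)\<close>, without a factor \<open>t\<close>.\<close>

lemma exp_decay_exp_filter:
  assumes u: "pwc u" "exp_decay u" and a: "Re a < 0"
  shows "exp_decay (exp_filter a u)"
proof -
  obtain c M where c: "0 < c" "0 \<le> M"
    "\<And>c' t. c' \<le> c \<Longrightarrow> 0 \<le> t \<Longrightarrow> norm (u t) \<le> M * exp (- c' * t)"
    using u(2) by (elim exp_decayE) blast
  \<comment> \<open>a rate for the input that is below the rate of the filter\<close>
  define b where "b = min c (- Re a / 2)"
  have b: "0 < b" "b \<le> c" "0 < - Re a - b"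
    using a c(1) by (auto simp: b_def min_def)
  define r where "r = - Re a - b"
  have "norm (exp_filter a u t) \<le> M / r * exp (- b * t)" if t: "0 \<le> t" for t
  proof -
    have der: "((\<lambda>s. M / r * exp (r * s)) has_real_derivative M * exp (r * s)) (at s within {0..t})" for s
      using b(3) by (auto intro!: derivative_eq_intros simp: r_def)
    then have int: "((\<lambda>s. M * exp (r * s)) has_integral M / r * exp (r * t) - M / r * exp (r * 0)) {0..t}"
      by (intro fundamental_theorem_of_calculus t) (simp add: has_real_derivative_iff_has_vector_derivative)
    have "norm (integ (\<lambda>s. exp (- a * of_real s) * u s) t) \<le> integral {0..t} (\<lambda>s. M * exp (r * s))"
      unfolding integ_def
    proof (rule integral_norm_bound_integral)
      show "(\<lambda>s. exp (- a * of_real s) * u s) integrable_on {0..t}"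
        using u(1) by (intro pwc_integrable) blast
      show "(\<lambda>s. M * exp (r * s)) integrable_on {0..t}"
        using int by blast
      fix s assume s: "s \<in> {0..t}"
      have "norm (exp (- a * of_real s) * u s) = exp (- Re a * s) * norm (u s)"
        by (simp add: norm_mult)
      also have "\<dots> \<le> exp (- Re a * s) * (M * exp (- b * s))"
        using c(3)[OF b(2), of s] s by (intro mult_left_mono) auto
      also have "\<dots> = M * exp (r * s)"
        by (simp add: r_def algebra_simps flip: exp_add)
      finally show "norm (exp (- a * of_real s) * u s) \<le> M * exp (r * s)" .
    qed
    also have "\<dots> \<le> M / r * exp (r * t)"
      unfolding integral_unique[OF int] using c(2) b(3) by (simp add: r_def)
    finally have "exp (Re a * t) * norm (integ (\<lambda>s. exp (- a * of_real s) * u s) t) \<le>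
        exp (Re a * t) * (M / r * exp (r * t))"
      by (rule mult_left_mono) simp
    then have "norm (exp_filter a u t) \<le> exp (Re a * t) * (M / r * exp (r * t))"
      unfolding exp_filter_def by (simp add: norm_mult)
    also have "\<dots> = M / r * exp (- b * t)"
      by (simp add: r_def algebra_simps flip: exp_add)
    finally show ?thesis .
  qed
  then show ?thesis
    unfolding exp_decay_def using b c by (intro exI[of _ b] exI[of _ "M / r"] conjI) (auto simp: r_def)
qed

lemma first_order_solution_unique:
  assumes "pwc y" "pwc u" "y = integ (\<lambda>t. a * y t + u t)"
  shows "y = exp_filter a u"
proof
  fix t :: real
  let ?e = "exp_filter a u"
  have e: "pwc ?e"
    using assms(2) by (rule pwc_exp_filter)
  have eq: "y s - ?e s = a * integ (\<lambda>t. y t - ?e t) s" for s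
  proof -
    have "y s - ?e s = integ (\<lambda>t. a * y t + u t) s - integ (\<lambda>t. a * ?e t + u t) s"
      by (rule arg_cong2[where f = "(-)", OF fun_cong[OF assms(3)] fun_cong[OF exp_filter_eq[OF assms(2)]]])
    also have "\<dots> = integ (\<lambda>t. (a * y t + u t) - (a * ?e t + u t)) s"
      by (subst integ_diff) (intro pwc_add pwc_mult pwc_const e assms(1,2) refl)+
    also have "(\<lambda>t. (a * y t + u t) - (a * ?e t + u t)) = (\<lambda>t. a * (y t - ?e t))"
      by (simp add: algebra_simps)
    finally show ?thesis
      by (simp only: integ_mult)
  qed
  have "y t - ?e t = 0"
    by (rule first_order_unique[OF pwc_diff[OF assms(1) e] eq, of t "t + 1"]) simp
  then show "y t = ?e t"
    by simp
qed

text \<open>\<open>X\<^sup>m p(1/X)\<close> for \<open>degree p \<le> m\<close>. Applied to \<open>J\<close>, it stands for \<open>J\<^sup>m p(D)\<close>.\<close>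

definition reversal :: "nat \<Rightarrow> 'a::comm_semiring_1 poly \<Rightarrow> 'a poly" where
  "reversal m p = (\<Sum>i\<le>m. monom (coeff p i) (m - i))"

lemma act_reversal:
  "pwc f \<Longrightarrow> act (reversal m p) f = (\<lambda>t. \<Sum>i\<le>m. coeff p i * (integ ^^ (m - i)) f t)"
  unfolding reversal_def by (simp add: act_sum_poly act_monom)

lemma poly_reversal:
  assumes "degree p \<le> m" "x \<noteq> (0::'a::field)"
  shows "poly (reversal m p) x = x ^ m * poly p (1 / x)"
proof -
  have p: "poly p (1 / x) = (\<Sum>i\<le>m. coeff p i * (1 / x) ^ i)"
    unfolding poly_altdef using assms(1)
    by (intro sum.mono_neutral_left) (auto simp: coeff_eq_0)
  have e: "x ^ m * (coeff p i * (1 / x) ^ i) = coeff p i * x ^ (m - i)" if "i \<le> m" for i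
    using assms(2) that by (simp add: power_diff power_one_over field_simps)
  show ?thesis
    unfolding reversal_def poly_sum poly_monom p sum_distrib_left
    by (intro sum.cong refl) (simp only: e atMost_iff)
qed

lemma coeff_0_reversal: "poly (reversal m p) 0 = coeff p m"
proof -
  have "poly (reversal m p) 0 = (\<Sum>i\<le>m. if i = m then coeff p m else 0)"
    unfolding reversal_def poly_sum poly_monom by (intro sum.cong) (auto simp: power_0_left)
  then show ?thesis
    by simp
qed

lemma poly_eq_if_eq_nonzero:
  fixes p q :: "'a::{field,ring_char_0} poly"
  assumes "\<And>x. x \<noteq> 0 \<Longrightarrow> poly p x = poly q x"
  shows "p = q"
proof (rule ccontr)
  assume "p \<noteq> q"
  then have "finite {x. poly (p - q) x = 0}"
    by (intro poly_roots_finite) auto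
  moreover have "UNIV - {0} \<subseteq> {x. poly (p - q) x = 0}"
    using assms by auto
  ultimately show False
    using infinite_UNIV_char_0 finite_subset by fastforce
qed

lemma reversal_linear_factor:
  fixes q :: "'a::{field,ring_char_0} poly"
  assumes "degree q \<le> m"
  shows "reversal (Suc m) ([:-a, 1:] * q) = [:1, -a:] * reversal m q"
proof (rule poly_eq_if_eq_nonzero)
  fix x :: 'a assume x: "x \<noteq> 0"
  have "degree ([:-a, 1:] * q) \<le> Suc m"
    using degree_mult_le[of "[:-a, 1:]" q] assms by simp
  then show "poly (reversal (Suc m) ([:-a, 1:] * q)) x = poly ([:1, -a:] * reversal m q) x"
    using x assms by (simp add: poly_reversal field_simps)
qed

text \<open>Here \<open>J\<^sup>k f\<close> is the derivative of order \<open>m - k\<close> of \<open>\<eta> = J\<^sup>m f\<close>, the solution of \<open>p(D) \<eta> = v\<close> with decaying \<open>v\<close>.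
  Splitting off a root \<open>a\<close> of \<open>p\<close>, put \<open>g = f - a J f\<close>: then \<open>J\<^sup>k\<^sup>+\<^sup>1 f\<close> is the response of \<open>y' = a y + u\<close> to
  \<open>u = J\<^sup>k g\<close>, which decays by induction.\<close>

lemma hurwitz_decay:
  assumes "degree p = m" "lead_coeff p = 1" "\<And>z. poly p z = 0 \<Longrightarrow> Re z < 0"
    and "pwc f" "exp_decay (act (reversal m p) f)"
  shows "\<forall>k\<le>m. exp_decay ((integ ^^ k) f)"
  using assms
proof (induction m arbitrary: p f)
  case 0
  then have "reversal 0 p = 1"
    by (simp add: reversal_def monom_0 one_pCons)
  then show ?case
    using 0 by simp
next
  case (Suc m)
  have "\<not> constant (poly p)"
    using Suc.prems(1) by (simp add: constant_degree)
  then obtain a where a: "poly p a = 0"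
    using fundamental_theorem_of_algebra by blast
  then obtain q where q: "p = [:-a, 1:] * q"
    unfolding poly_eq_0_iff_dvd by (elim dvdE)
  have q0: "q \<noteq> 0"
    using q Suc.prems(1) by auto
  have dq: "degree q = m"
    using Suc.prems(1) q0 unfolding q by (subst (asm) degree_mult_eq) auto
  have lq: "lead_coeff q = 1"
    using Suc.prems(2) unfolding q by (simp only: lead_coeff_mult) simp
  define g where "g = act [:1, -a:] f"
  have g: "pwc g"
    unfolding g_def by (rule pwc_act[OF Suc.prems(4)])
  have "act (reversal (Suc m) p) f = act (reversal m q) g"
    unfolding q g_def
    using reversal_linear_factor[of q m a] act_mult[OF Suc.prems(4), of "reversal m q" "[:1, -a:]"] dq
    by (simp only: mult.commute order_refl simp_thms)
  then have IH: "\<forall>k\<le>m. exp_decay ((integ ^^ k) g)"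
  proof (intro Suc.IH[OF dq lq _ g])
    show "Re z < 0" if "poly q z = 0" for z
      using Suc.prems(3)[of z] that by (simp add: q)
  qed (use Suc.prems(5) in simp)
  have step: "(integ ^^ Suc k) f = exp_filter a ((integ ^^ k) g)" for k
  proof (rule first_order_solution_unique)
    have f: "f = (\<lambda>t. a * integ f t + g t)"
      unfolding g_def act_linear_factor by simp
    have "(integ ^^ k) f = (integ ^^ k) (\<lambda>t. a * integ f t + g t)"
      by (rule arg_cong[OF f])
    also have "\<dots> = (\<lambda>t. a * (integ ^^ k) (integ f) t + (integ ^^ k) g t)"
      using act_add[of "\<lambda>t. a * integ f t" g "monom 1 k",
          OF pwc_mult[OF pwc_const pwc_integ[OF Suc.prems(4)]] g] act_cmult[of "monom 1 k" a "integ f"]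
      unfolding act_monom by simp
    also have "(integ ^^ k) (integ f) = (integ ^^ Suc k) f"
      by (simp only: funpow_Suc_right o_apply)
    finally have F: "(integ ^^ k) f = (\<lambda>t. a * (integ ^^ Suc k) f t + (integ ^^ k) g t)" .
    have "(integ ^^ Suc k) f = integ ((integ ^^ k) f)"
      by simp
    also have "\<dots> = integ (\<lambda>t. a * (integ ^^ Suc k) f t + (integ ^^ k) g t)"
      by (rule arg_cong[OF F])
    finally show "(integ ^^ Suc k) f = integ (\<lambda>t. a * (integ ^^ Suc k) f t + (integ ^^ k) g t)" .
  qed (rule pwc_integ_pow[OF Suc.prems(4)] pwc_integ_pow[OF g])+
  have D: "exp_decay ((integ ^^ Suc k) f)" if "k \<le> m" for k
    unfolding step
    by (rule exp_decay_exp_filter[OF pwc_integ_pow[OF g] _ Suc.prems(3)[OF a]]) (use IH that in blast)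
  have "exp_decay (\<lambda>t. a * (integ ^^ Suc 0) f t + g t)"
    by (intro exp_decay_add exp_decay_cmult D) (use IH in auto)
  moreover have "(\<lambda>t. a * (integ ^^ Suc 0) f t + g t) = f"
    unfolding g_def act_linear_factor by simp
  ultimately have "exp_decay f"
    by simp
  show ?case
  proof (intro allI impI)
    fix k assume "k \<le> Suc m"
    then show "exp_decay ((integ ^^ k) f)"
      using D \<open>exp_decay f\<close> by (cases k) auto
  qed
qed

section \<open>Spectral factorization\<close>

lemma map_poly_cnj_mult: "map_poly cnj (p * q) = map_poly cnj p * map_poly cnj q"
  by (rule poly_eqI) (simp add: coeff_map_poly coeff_mult)

lemma poly_map_poly_cnj: "poly (map_poly cnj p) z = cnj (poly p (cnj z))"
proof -
  have "map_poly cnj (map_poly cnj p) = p"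
    by (simp add: map_poly_map_poly o_def)
  have "cnj (poly p (cnj z)) = poly (map_poly cnj p) (cnj (cnj z))"
    by (induction p) (simp_all add: map_poly_pCons)
  then show ?thesis
    by simp
qed

lemma poly_eq_if_eq_on_reals:
  fixes p q :: "complex poly"
  assumes "\<And>x. poly p (complex_of_real x) = poly q (complex_of_real x)"
  shows "p = q"
proof (rule ccontr)
  assume "p \<noteq> q"
  then have "finite {x. poly (p - q) x = 0}"
    by (intro poly_roots_finite) auto
  moreover have "range complex_of_real \<subseteq> {x. poly (p - q) x = 0}"
    using assms by auto
  ultimately have "finite (range complex_of_real)"
    by (rule finite_subset[rotated])
  then show False
    using infinite_UNIV_char_0[where 'a = real] by (simp add: finite_image_iff inj_on_def)
qed

text \<open>The roots are not real and come in conjugate pairs; \<open>g\<close> collects one root of each pair.\<close>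

lemma spectral_factorization:
  fixes h :: "complex poly"
  assumes "\<And>x. poly h (complex_of_real x) > 0"
  shows "\<exists>g. h = g * map_poly cnj g"
  using assms
proof (induction "degree h" arbitrary: h rule: less_induct)
  case less
  show ?case
  proof (cases "degree h = 0")
    case True
    then obtain c where c: "h = [:c:]"
      by (rule degree_eq_zeroE)
    then have c0: "0 < c"
      using less.prems[of 0] by simp
    then have "c = complex_of_real (Re c)" "0 < Re c"
      by (auto simp: less_complex_def complex_eq_iff)
    then have "c = complex_of_real (sqrt (Re c)) * complex_of_real (sqrt (Re c))"
      by (simp flip: of_real_mult)
    moreover have "map_poly cnj [:of_real (sqrt (Re c)):] = [:of_real (sqrt (Re c)):]"
      by (rule poly_eqI) (simp add: coeff_map_poly coeff_pCons split: nat.splits)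
    ultimately have "h = [:of_real (sqrt (Re c)):] * map_poly cnj [:of_real (sqrt (Re c)):]"
      by (simp add: c)
    then show ?thesis
      by blast
  next
    case False
    then have "\<not> constant (poly h)"
      by (simp add: constant_degree)
    then obtain a where a: "poly h a = 0"
      using fundamental_theorem_of_algebra by blast
    have "Im a \<noteq> 0"
    proof
      assume "Im a = 0"
      then have "a = complex_of_real (Re a)"
        by (simp add: complex_eq_iff)
      then show False
        using less.prems[of "Re a"] a by simp
    qed
    then have ac: "cnj a \<noteq> a"
      by (auto simp: complex_eq_iff)
    have "map_poly cnj h = h"
    proof (rule poly_eq_if_eq_on_reals)
      fix x
      show "poly (map_poly cnj h) (of_real x) = poly h (of_real x)"
        using less.prems[of x] by (simp add: poly_map_poly_cnj less_complex_def complex_eq_iff)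
    qed
    then have "poly h (cnj a) = 0"
      using poly_map_poly_cnj[of h "cnj a"] a by simp
    obtain k where k: "h = [:-a, 1:] * k"
      using a unfolding poly_eq_0_iff_dvd by (elim dvdE)
    then have "poly k (cnj a) = 0"
      using \<open>poly h (cnj a) = 0\<close> ac by simp
    then obtain h' where h': "k = [:- cnj a, 1:] * h'"
      unfolding poly_eq_0_iff_dvd by (elim dvdE)
    have h: "h = [:-a, 1:] * ([:- cnj a, 1:] * h')"
      using k h' by simp
    have "h' \<noteq> 0"
      using h False by auto
    then have "degree h' < degree h"
      unfolding h by (simp add: degree_mult_eq del: mult_pCons_left)
    moreover have "poly h' (complex_of_real x) > 0" for x
    proof -
      define c where "c = (cmod (of_real x - a))\<^sup>2"
      have "of_real x \<noteq> a"
        using \<open>Im a \<noteq> 0\<close> by auto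
      then have c: "0 < c"
        by (simp add: c_def)
      have "poly h (of_real x) = (of_real x - a) * cnj (of_real x - a) * poly h' (of_real x)"
        unfolding h by (simp add: algebra_simps)
      also have "(of_real x - a) * cnj (of_real x - a) = of_real c"
        by (simp only: c_def complex_norm_square)
      finally have "0 < of_real c * poly h' (of_real x)"
        using less.prems[of x] by simp
      then show ?thesis
        using c by (simp add: less_complex_def zero_less_mult_iff)
    qed
    ultimately obtain g where g: "h' = g * map_poly cnj g"
      using less.hyps by blast
    have "map_poly cnj ([:-a, 1:] * g) = [:- cnj a, 1:] * map_poly cnj g"
      by (simp only: map_poly_cnj_mult) (simp add: map_poly_pCons)
    then have "h = ([:-a, 1:] * g) * map_poly cnj ([:-a, 1:] * g)"
      unfolding h g by (simp only: mult.assoc mult.left_commute)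
    then show ?thesis
      by blast
  qed
qed

section \<open>A Plancherel identity in the time domain\<close>

text \<open>\<open>\<eta> k\<close> plays the role of the derivative of order \<open>k\<close> of \<open>\<eta> 0\<close>, up to order \<open>m\<close>. The highest derivative need not be
  continuous.\<close>

locale state_chain =
  fixes \<eta> :: "nat \<Rightarrow> real \<Rightarrow> complex" and m :: nat
  assumes pwc_chain: "k \<le> m \<Longrightarrow> pwc (\<eta> k)"
    and chain_integ: "k < m \<Longrightarrow> \<eta> k = integ (\<eta> (Suc k))"
    and chain_vanishes: "k < m \<Longrightarrow> (\<eta> k \<longlongrightarrow> 0) at_top"
begin

text \<open>The factors make \<open>Gram k l\<close> the integral of \<open>((D / \<i>)\<^sup>k \<eta>) ((D / \<i>)\<^sup>l \<eta>)\<^sup>*\<close>. As \<open>D / \<i>\<close> is formally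
  self-adjoint, it depends on \<open>k + l\<close> only, up to boundary terms.\<close>

definition Gram :: "nat \<Rightarrow> nat \<Rightarrow> real \<Rightarrow> complex" where
  "Gram k l = integ (\<lambda>t. (- \<i>) ^ k * \<i> ^ l * (\<eta> k t * cnj (\<eta> l t)))"

text \<open>Integration by parts; the boundary term at \<open>0\<close> vanishes and the one at \<open>t\<close> tends to \<open>0\<close>.\<close>

lemma Gram_shift:
  assumes "k < m" "l < m"
  shows "((\<lambda>t. Gram (Suc k) l t - Gram k (Suc l) t) \<longlongrightarrow> 0) at_top"
proof -
  let ?c = "- \<i> * ((- \<i>) ^ k * \<i> ^ l)"
  have p: "pwc (\<eta> k)" "pwc (\<eta> l)" "pwc (\<eta> (Suc k))" "pwc (\<eta> (Suc l))"
    using assms by (auto intro: pwc_chain)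
  have factor: "- j * A * B * P - A * (j * B) * Q = - j * (A * B) * (Q + P)" for j A B P Q :: complex
    by (simp add: ring_distribs mult_ac)
  have cont: "continuous_on {0..} (\<eta> k)" "continuous_on {0..} (\<eta> l)"
    using assms p continuous_on_integ by (simp_all add: chain_integ)
  have der: "(\<eta> j has_vector_derivative \<eta> (Suc j) t) (at_right t)" if "j < m" "0 \<le> t" for j t
    using integ_right_derivative[OF pwc_chain[of "Suc j"] that(2)] that(1) by (simp add: chain_integ)
  have "Gram (Suc k) l t - Gram k (Suc l) t = ?c * (\<eta> k t * cnj (\<eta> l t))" if t: "0 \<le> t" for t
  proof -
    have "Gram (Suc k) l t - Gram k (Suc l) t =
        integ (\<lambda>t. (- \<i>) ^ Suc k * \<i> ^ l * (\<eta> (Suc k) t * cnj (\<eta> l t)) -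
                   (- \<i>) ^ k * \<i> ^ Suc l * (\<eta> k t * cnj (\<eta> (Suc l) t))) t"
      unfolding Gram_def by (subst integ_diff) (intro pwc_mult pwc_const pwc_cnj p refl)+
    also have "(\<lambda>t. (- \<i>) ^ Suc k * \<i> ^ l * (\<eta> (Suc k) t * cnj (\<eta> l t)) -
                   (- \<i>) ^ k * \<i> ^ Suc l * (\<eta> k t * cnj (\<eta> (Suc l) t))) =
        (\<lambda>t. ?c * (\<eta> k t * cnj (\<eta> (Suc l) t) + \<eta> (Suc k) t * cnj (\<eta> l t)))"
      unfolding power_Suc by (rule ext) (rule factor)
    also have "integ \<dots> t = ?c * (\<eta> k t * cnj (\<eta> l t) - \<eta> k 0 * cnj (\<eta> l 0))"
      unfolding integ_mult
      by (subst integ_product_rule[of "\<eta> k" "\<lambda>t. cnj (\<eta> l t)"])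
         (use assms t p cont der in
           \<open>auto intro!: pwc_cnj continuous_on_cnj bounded_linear.has_vector_derivative[OF bounded_linear_cnj]\<close>)
    also have "\<eta> k 0 = 0"
      using assms by (simp add: chain_integ)
    finally show ?thesis
      by simp
  qed
  moreover have "((\<lambda>t. ?c * (\<eta> k t * cnj (\<eta> l t))) \<longlongrightarrow> ?c * (0 * cnj 0)) at_top"
    using assms by (intro tendsto_mult tendsto_const tendsto_cnj chain_vanishes)
  ultimately show ?thesis
    using tendsto_cong[OF eventually_mono[OF eventually_ge_at_top[of 0]],
        of "\<lambda>t. Gram (Suc k) l t - Gram k (Suc l) t" "\<lambda>t. ?c * (\<eta> k t * cnj (\<eta> l t))" 0]
    by simp
qed

text \<open>A representative of \<open>Gram k l\<close> with \<open>k + l = j\<close>, chosen so that both indices are at most \<open>m\<close> when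
  \<open>j \<le> 2 m\<close>.\<close>

definition moment :: "nat \<Rightarrow> real \<Rightarrow> complex" where
  "moment j = Gram (min j m) (j - min j m)"

lemma Gram_moment:
  assumes "k \<le> m" "l \<le> m"
  shows "((\<lambda>t. Gram k l t - moment (k + l) t) \<longlongrightarrow> 0) at_top"
proof -
  have "((\<lambda>t. Gram k l t - Gram (k + i) (l - i) t) \<longlongrightarrow> 0) at_top" if "i \<le> l" "k + i \<le> m" for i
    using that
  proof (induction i)
    case (Suc i)
    have "((\<lambda>t. Gram (Suc (k + i)) (l - Suc i) t - Gram (k + i) (Suc (l - Suc i)) t) \<longlongrightarrow> 0) at_top"
      using Suc.prems assms by (intro Gram_shift) auto
    moreover have "Suc (l - Suc i) = l - i"
      using Suc.prems by simp
    ultimately have *: "((\<lambda>t. Gram (k + Suc i) (l - Suc i) t - Gram (k + i) (l - i) t) \<longlongrightarrow> 0) at_top"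
      by simp
    show ?case
      using tendsto_diff[OF Suc.IH *] Suc.prems by simp
  qed simp
  note * = this
  show ?thesis
  proof (cases "k + l \<le> m")
    case True
    then show ?thesis
      using *[of l] by (simp add: moment_def)
  next
    case False
    then show ?thesis
      using *[of "m - k"] assms by (simp add: moment_def add.commute)
  qed
qed

text \<open>\<open>f(D / \<i>) \<eta>\<close>, for a polynomial \<open>f\<close> in the frequency variable \<open>\<omega>\<close>.\<close>

definition eval_chain :: "complex poly \<Rightarrow> real \<Rightarrow> complex" where
  "eval_chain f t = (\<Sum>k\<le>m. coeff f k * (- \<i>) ^ k * \<eta> k t)"

lemma pwc_eval_chain: "pwc (eval_chain f)"
  unfolding eval_chain_def[abs_def]
  by (intro pwc_sum pwc_mult pwc_const pwc_chain) simp

text \<open>The linear functional that sends \<open>\<omega>\<^sup>j\<close> to \<open>moment j\<close>: formally, integration against the spectral density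
  of \<open>\<eta>\<close>.\<close>

definition moment_functional :: "complex poly \<Rightarrow> real \<Rightarrow> complex" where
  "moment_functional h t = (\<Sum>j\<le>2 * m. coeff h j * moment j t)"

lemma moment_functional_sum:
  "moment_functional (\<Sum>i\<in>I. h i) t = (\<Sum>i\<in>I. moment_functional (h i) t)"
  unfolding moment_functional_def coeff_sum sum_distrib_right by (rule sum.swap)

lemma moment_functional_monom:
  "j \<le> 2 * m \<Longrightarrow> moment_functional (monom c j) t = c * moment j t"
  unfolding moment_functional_def coeff_monom by (simp add: if_distrib[of "\<lambda>x. x * _"] cong: if_cong)

text \<open>Plancherel's theorem without Fourier transforms: asymptotically the inner product of \<open>f(D / \<i>) \<eta>\<close> and
  \<open>g(D / \<i>) \<eta>\<close> depends on the product \<open>f g\<^sup>*\<close> only. An identity between polynomials in \<open>\<omega>\<close> therefore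
  becomes an identity between integrals over the half line.\<close>

lemma plancherel:
  assumes "degree f \<le> m" "degree g \<le> m"
  shows "((\<lambda>t. integ (\<lambda>s. eval_chain f s * cnj (eval_chain g s)) t -
      moment_functional (f * map_poly cnj g) t) \<longlongrightarrow> 0) at_top"
proof -
  have p: "pwc (\<lambda>t. (- \<i>) ^ k * \<i> ^ l * (\<eta> k t * cnj (\<eta> l t)))" if "k \<le> m" "l \<le> m" for k l
    using that by (intro pwc_mult pwc_const pwc_cnj pwc_chain)
  have E: "eval_chain f s * cnj (eval_chain g s) =
      (\<Sum>k\<le>m. \<Sum>l\<le>m. coeff f k * cnj (coeff g l) * ((- \<i>) ^ k * \<i> ^ l * (\<eta> k s * cnj (\<eta> l s))))" for s
    unfolding eval_chain_def cnj_sum sum_product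
    by (intro sum.cong refl) (simp add: algebra_simps)
  have "integ (\<lambda>s. \<Sum>k\<le>m. \<Sum>l\<le>m. coeff f k * cnj (coeff g l) * ((- \<i>) ^ k * \<i> ^ l * (\<eta> k s * cnj (\<eta> l s)))) t =
      (\<Sum>k\<le>m. integ (\<lambda>s. \<Sum>l\<le>m. coeff f k * cnj (coeff g l) * ((- \<i>) ^ k * \<i> ^ l * (\<eta> k s * cnj (\<eta> l s)))) t)" for t
    by (intro fun_cong[OF integ_sum] pwc_sum pwc_mult[OF pwc_const] p) auto
  also have "\<dots> t = (\<Sum>k\<le>m. \<Sum>l\<le>m. coeff f k * cnj (coeff g l) * Gram k l t)" for t
  proof (rule sum.cong[OF refl])
    fix k assume k: "k \<in> {..m}"
    have "integ (\<lambda>s. \<Sum>l\<le>m. coeff f k * cnj (coeff g l) * ((- \<i>) ^ k * \<i> ^ l * (\<eta> k s * cnj (\<eta> l s)))) t =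
        (\<Sum>l\<le>m. integ (\<lambda>s. coeff f k * cnj (coeff g l) * ((- \<i>) ^ k * \<i> ^ l * (\<eta> k s * cnj (\<eta> l s)))) t)"
      by (intro fun_cong[OF integ_sum] pwc_mult[OF pwc_const] p) (use k in auto)
    also have "\<dots> = (\<Sum>l\<le>m. coeff f k * cnj (coeff g l) * Gram k l t)"
      unfolding Gram_def by (intro sum.cong refl fun_cong[OF integ_mult])
    finally show "integ (\<lambda>s. \<Sum>l\<le>m. coeff f k * cnj (coeff g l) * ((- \<i>) ^ k * \<i> ^ l * (\<eta> k s * cnj (\<eta> l s)))) t =
        (\<Sum>l\<le>m. coeff f k * cnj (coeff g l) * Gram k l t)" .
  qed
  finally have I: "integ (\<lambda>s. eval_chain f s * cnj (eval_chain g s)) t =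
      (\<Sum>k\<le>m. \<Sum>l\<le>m. coeff f k * cnj (coeff g l) * Gram k l t)" for t
    unfolding E .
  have F: "f = (\<Sum>k\<le>m. monom (coeff f k) k)"
    using poly_as_sum_of_monoms'[OF assms(1)] by simp
  have G: "map_poly cnj g = (\<Sum>l\<le>m. monom (cnj (coeff g l)) l)"
    using poly_as_sum_of_monoms'[of "map_poly cnj g" m] assms(2) degree_map_poly_le[of cnj g]
    by (simp add: coeff_map_poly)
  have "moment_functional (f * map_poly cnj g) t =
      moment_functional (\<Sum>k\<le>m. \<Sum>l\<le>m. monom (coeff f k * cnj (coeff g l)) (k + l)) t" for t
    using arg_cong2[OF F G, of "(*)"] by (simp only: sum_product mult_monom)
  also have "\<dots> t = (\<Sum>k\<le>m. \<Sum>l\<le>m. coeff f k * cnj (coeff g l) * moment (k + l) t)" for t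
    unfolding moment_functional_sum by (intro sum.cong refl moment_functional_monom) auto
  finally have M: "moment_functional (f * map_poly cnj g) t =
      (\<Sum>k\<le>m. \<Sum>l\<le>m. coeff f k * cnj (coeff g l) * moment (k + l) t)" for t .
  have "((\<lambda>t. \<Sum>k\<le>m. \<Sum>l\<le>m. coeff f k * cnj (coeff g l) * (Gram k l t - moment (k + l) t)) \<longlongrightarrow> 0) at_top"
    by (intro tendsto_null_sum tendsto_mult_right_zero Gram_moment) auto
  then show ?thesis
    unfolding I M by (simp add: sum_subtractf right_diff_distrib)
qed

end

section \<open>The integral quadratic constraint for scalar signals\<close>

text \<open>The argument is that of the introduction: cut the input off at \<open>T\<close>, compare with the half line, and
  replace the integrand by \<open>|g(D / \<i>) \<eta>|\<^sup>2\<close>.\<close>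

lemma hard_iqc:
  fixes d n :: "complex poly" and v w :: "real \<Rightarrow> complex" and q s r :: real
  assumes d: "degree d = m" "lead_coeff d = 1" "\<And>z. poly d z = 0 \<Longrightarrow> Re z < 0"
    and n: "degree n \<le> m" and r: "r \<le> 0"
    and fdi: "\<And>\<omega>. q * (cmod (poly d (\<i> * of_real \<omega>)))\<^sup>2 +
        2 * s * Re (poly d (\<i> * of_real \<omega>) * cnj (poly n (\<i> * of_real \<omega>))) +
        r * (cmod (poly n (\<i> * of_real \<omega>)))\<^sup>2 > 0"
    and v: "pwc v" and w: "pwc w"
    and io: "act (reversal m d) w = act (reversal m n) v"
  shows "integ (\<lambda>t. q * (cmod (v t))\<^sup>2 + 2 * s * Re (v t * cnj (w t)) + r * (cmod (w t))\<^sup>2) T \<ge> 0"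
proof (cases "T \<le> 0")
  case False
  define vT where "vT = (\<lambda>t. if t < T then v t else 0)"
  have vT: "pwc vT"
    unfolding vT_def by (rule pwc_truncate[OF v])
  have d0: "poly (reversal m d) 0 = 1"
    using d by (simp add: coeff_0_reversal)
  obtain f where f: "pwc f" "act (reversal m d) f = vT"
    using act_solvable[OF d0 vT] by blast
  define wT where "wT = act (reversal m n) f"
  have wT: "pwc wT"
    unfolding wT_def by (rule pwc_act[OF f(1)])
  have wT_eq: "wT t = w t" if "t < T" for t
  proof (rule act_injective_eq[OF d0 wT w _ that])
    fix t assume "t < T"
    have "act (reversal m d) wT t = act (reversal m n) vT t"
      unfolding wT_def using act_commute[OF f(1), of "reversal m d" "reversal m n"] f(2) by simp
    also have "\<dots> = act (reversal m n) v t"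
      by (rule act_cong[OF _ \<open>t < T\<close>]) (simp add: vT_def)
    finally show "act (reversal m d) wT t = act (reversal m d) w t"
      by (simp add: io)
  qed
  \<comment> \<open>the derivative of order \<open>k\<close> of \<open>J\<^sup>m f\<close>, which solves the equation \<open>d(D) (J\<^sup>m f) = vT\<close>\<close>
  define \<eta> where "\<eta> k = (integ ^^ (m - k)) f" for k
  have "exp_decay vT"
  proof -
    obtain B where B: "\<And>t. t \<in> {0..T} \<Longrightarrow> norm (vT t) \<le> B" "0 \<le> B"
      using pwc_bounded[OF vT, of T] False by (metis linear)
    have "norm (vT t) \<le> B * exp T * exp (- 1 * t)" if "0 \<le> t" for t
    proof (cases "t < T")
      case True
      have "B * 1 \<le> B * exp (T - t)"
        using True B(2) by (intro mult_left_mono) auto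
      then have "norm (vT t) \<le> B * exp (T - t)"
        using B(1)[of t] True that by simp
      then show ?thesis
        by (simp add: exp_diff exp_minus field_simps)
    qed (use B in \<open>simp add: vT_def\<close>)
    then show ?thesis
      unfolding exp_decay_def using B(2)
      by (intro exI[of _ 1] exI[of _ "B * exp T"] conjI) auto
  qed
  then have decay: "\<forall>k\<le>m. exp_decay ((integ ^^ k) f)"
    by (intro hurwitz_decay[OF d f(1)]) (simp_all add: f(2))
  interpret state_chain \<eta> m
  proof
    show "\<eta> k = integ (\<eta> (Suc k))" if "k < m" for k
      using that by (simp add: \<eta>_def Suc_diff_Suc[symmetric])
  qed (use decay f(1) in \<open>auto simp: \<eta>_def intro: exp_decay_tendsto_0\<close>)
  \<comment> \<open>\<open>p(\<i> \<omega>)\<close> at \<open>\<omega> = D / \<i>\<close> is \<open>p(D)\<close>\<close>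
  have ev: "eval_chain (pcompose p [:0, \<i>:]) = act (reversal m p) f" for p
  proof -
    have "coeff (pcompose p [:0, \<i>:]) k * (- \<i>) ^ k = coeff p k" for k
      by (simp add: coeff_pcompose_linear flip: power_mult_distrib)
    then show ?thesis
      unfolding eval_chain_def[abs_def] act_reversal[OF f(1)] \<eta>_def by simp
  qed
  define D N where "D = pcompose d [:0, \<i>:]" and "N = pcompose n [:0, \<i>:]"
  have deg: "degree D \<le> m" "degree N \<le> m"
    using d n unfolding D_def N_def by simp_all
  define h where "h = smult (of_real q) (D * map_poly cnj D) + smult (of_real s) (D * map_poly cnj N) +
      smult (of_real s) (N * map_poly cnj D) + smult (of_real r) (N * map_poly cnj N)"
  have "poly h (of_real \<omega>) > 0" for \<omega>
  proof -
    have DN: "poly D (of_real \<omega>) = poly d (\<i> * of_real \<omega>)" "poly N (of_real \<omega>) = poly n (\<i> * of_real \<omega>)"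
      by (simp_all add: D_def N_def poly_pcompose mult.commute)
    have "poly h (of_real \<omega>) = of_real (q * (cmod (poly D (of_real \<omega>)))\<^sup>2 +
        2 * s * Re (poly D (of_real \<omega>) * cnj (poly N (of_real \<omega>))) + r * (cmod (poly N (of_real \<omega>)))\<^sup>2)"
      unfolding h_def
      by (simp add: poly_map_poly_cnj complex_eq_iff cmod_power2 distrib_left)
         (simp add: algebra_simps power2_eq_square)
    then show ?thesis
      using fdi[of \<omega>] unfolding DN by (simp add: less_complex_def)
  qed
  then obtain g where g: "h = g * map_poly cnj g"
    using spectral_factorization by blast
  have "degree g \<le> m"
  proof -
    have "degree h \<le> 2 * m"
      unfolding h_def
      by (intro degree_add_le order_trans[OF degree_smult_le] order_trans[OF degree_mult_le])
         (use deg degree_map_poly_le[of cnj D] degree_map_poly_le[of cnj N] in linarith)+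
    moreover have "degree (map_poly cnj g) = degree g"
      by (rule degree_map_poly) simp
    ultimately show ?thesis
      using degree_mult_eq[of g "map_poly cnj g"] by (cases "g = 0") (auto simp: g)
  qed
  let ?S = "\<lambda>v w t. q * (cmod (v t))\<^sup>2 + 2 * s * Re (v t * cnj (w t)) + r * (cmod (w t))\<^sup>2"
  have pS: "pwc (?S v w)" if "pwc v" "pwc w" for v w
    unfolding power2_eq_square
    by (intro pwc_add pwc_mult pwc_const pwc_Re pwc_cnj that
        pwc_map[of cmod, OF continuous_on_norm[OF continuous_on_id]])
  have ev_D: "eval_chain D = vT" and ev_N: "eval_chain N = wT"
    unfolding D_def N_def wT_def ev by (simp_all add: f(2))
  \<comment> \<open>by \<open>plancherel\<close>, as the moment functional takes the same value at \<open>h\<close> and at \<open>g g\<^sup>*\<close>\<close>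
  have parseval: "((\<lambda>t. integ (?S vT wT) t - integ (\<lambda>s. (cmod (eval_chain g s))\<^sup>2) t) \<longlongrightarrow> 0) at_top"
  proof -
    define I where "I a b = integ (\<lambda>s. eval_chain a s * cnj (eval_chain b s))" for a b
    have pI: "pwc (\<lambda>s. eval_chain a s * cnj (eval_chain b s))" for a b
      by (intro pwc_mult pwc_cnj pwc_eval_chain)
    let ?M = "\<lambda>a b. moment_functional (a * map_poly cnj b)"
    have P: "((\<lambda>t. I a b t - ?M a b t) \<longlongrightarrow> 0) at_top" if "degree a \<le> m" "degree b \<le> m" for a b
      unfolding I_def using that by (rule plancherel)
    have "((\<lambda>t. of_real q * (I D D t - ?M D D t) + of_real s * (I D N t - ?M D N t) +
        of_real s * (I N D t - ?M N D t) + of_real r * (I N N t - ?M N N t) - (I g g t - ?M g g t)) \<longlongrightarrow>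
        of_real q * 0 + of_real s * 0 + of_real s * 0 + of_real r * 0 - 0) at_top"
      by (intro tendsto_add tendsto_diff tendsto_mult tendsto_const P deg \<open>degree g \<le> m\<close>)
    moreover have "?M g g t = of_real q * ?M D D t + of_real s * ?M D N t + of_real s * ?M N D t + of_real r * ?M N N t" for t
      unfolding g[symmetric] h_def moment_functional_def
      by (simp add: sum.distrib sum_distrib_left algebra_simps)
    ultimately have "((\<lambda>t. of_real q * I D D t + of_real s * I D N t + of_real s * I N D t +
        of_real r * I N N t - I g g t) \<longlongrightarrow> 0) at_top"
      by (simp add: algebra_simps)
    moreover have "of_real (integ (?S vT wT) t) = of_real q * I D D t + of_real s * I D N t + of_real s * I N D t +
        of_real r * I N N t" for t
    proof -
      have "of_real (integ (?S vT wT) t) = integ (\<lambda>t. complex_of_real (?S vT wT t)) t"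
        by (rule integ_of_real[OF pS[OF vT wT], symmetric])
      also have "(\<lambda>t. complex_of_real (?S vT wT t)) = (\<lambda>t. of_real q * (vT t * cnj (vT t)) +
          of_real s * (vT t * cnj (wT t)) + of_real s * (wT t * cnj (vT t)) + of_real r * (wT t * cnj (wT t)))"
        by (rule ext, simp add: complex_eq_iff cmod_power2 distrib_left)
           (simp add: algebra_simps power2_eq_square)
      also have "integ \<dots> = (\<lambda>t. integ (\<lambda>t. of_real q * (vT t * cnj (vT t))) t +
          integ (\<lambda>t. of_real s * (vT t * cnj (wT t))) t + integ (\<lambda>t. of_real s * (wT t * cnj (vT t))) t +
          integ (\<lambda>t. of_real r * (wT t * cnj (wT t))) t)"
        by (subst integ_add, (intro pwc_add pwc_mult pwc_const pwc_cnj vT wT)+)+ (rule refl)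
      finally show ?thesis
        unfolding I_def ev_D ev_N integ_mult .
    qed
    moreover have "I g g t = of_real (integ (\<lambda>s. (cmod (eval_chain g s))\<^sup>2) t)" for t
    proof -
      have "pwc (\<lambda>s. (cmod (eval_chain g s))\<^sup>2)"
        by (intro pwc_map[of "\<lambda>z. (cmod z)\<^sup>2"] pwc_eval_chain continuous_intros)
      then show ?thesis
        unfolding I_def by (subst integ_of_real[symmetric]) (simp_all only: complex_norm_square)
    qed
    ultimately have "((\<lambda>t. complex_of_real (integ (?S vT wT) t - integ (\<lambda>s. (cmod (eval_chain g s))\<^sup>2) t)) \<longlongrightarrow>
        of_real 0) at_top"
      by simp
    then show ?thesis
      by (simp only: tendsto_of_real_iff)
  qed
  \<comment> \<open>before \<open>T\<close> the integrands agree, and after \<open>T\<close> only \<open>r |wT|\<^sup>2 \<le> 0\<close> is left\<close>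
  have tail: "integ (?S vT wT) t \<le> integ (?S v w) T" if "T \<le> t" for t
  proof -
    have "integ (?S vT wT) t \<le> integ (\<lambda>t. if t < T then ?S v w t else 0) t"
      by (rule integ_mono[OF pS[OF vT wT] pwc_truncate[OF pS[OF v w]]])
         (use r in \<open>auto simp: vT_def wT_eq mult_nonpos_nonneg\<close>)
    also have "\<dots> = integ (\<lambda>t. if t < T then ?S v w t else 0) T"
    proof -
      let ?F = "\<lambda>t. if t < T then ?S v w t else 0"
      have "integ ?F t = integ ?F T + integral {T..t} ?F"
        unfolding integ_def using that False
        by (intro Henstock_Kurzweil_Integration.integral_combine[symmetric]
            pwc_integrable[OF pwc_truncate[OF pS[OF v w]]]) auto
      also have "integral {T..t} ?F = integral {T..t} (\<lambda>_. 0)"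
        by (rule integral_cong) auto
      finally show ?thesis
        by simp
    qed
    also have "\<dots> = integ (?S v w) T"
      by (rule integ_cong) simp
    finally show ?thesis .
  qed
  have "((\<lambda>t. integ (?S vT wT) t - integ (\<lambda>s. (cmod (eval_chain g s))\<^sup>2) t) \<longlongrightarrow> 0) at_top \<Longrightarrow>
      0 \<le> integ (?S v w) T"
  proof (rule tendsto_upperbound)
    show "\<forall>\<^sub>F t in at_top. integ (?S vT wT) t - integ (\<lambda>s. (cmod (eval_chain g s))\<^sup>2) t \<le> integ (?S v w) T"
    proof (rule eventually_mono[OF eventually_ge_at_top[of T]])
      fix t assume "T \<le> t"
      have "0 \<le> integ (\<lambda>s. (cmod (eval_chain g s))\<^sup>2) t"
        unfolding integ_def by (cases "(\<lambda>s. (cmod (eval_chain g s))\<^sup>2) integrable_on {0..t}")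
          (auto intro: integral_nonneg simp: not_integrable_integral)
      then show "integ (?S vT wT) t - integ (\<lambda>s. (cmod (eval_chain g s))\<^sup>2) t \<le> integ (?S v w) T"
        using tail[OF \<open>T \<le> t\<close>] by linarith
    qed
  qed auto
  with parseval show ?thesis
    by blast
qed simp

section \<open>State-space systems\<close>

lemma cpoly_add: "cpoly (p + q) = cpoly p + cpoly q"
  by (rule poly_eqI) (simp add: coeff_map_poly)

lemma cpoly_mult: "cpoly (p * q) = cpoly p * cpoly q"
  by (rule poly_eqI) (simp add: coeff_map_poly coeff_mult)

lemma cpoly_sum: "cpoly (\<Sum>i\<in>I. p i) = (\<Sum>i\<in>I. cpoly (p i))"
  by (rule poly_eqI) (simp add: coeff_map_poly coeff_sum)

lemma cpoly_pCons: "cpoly (pCons a p) = pCons (of_real a) (cpoly p)"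
  by (rule poly_eqI) (simp add: coeff_map_poly coeff_pCons split: nat.splits)

lemma poly_cpoly: "poly (cpoly p) (of_real x) = of_real (poly p x)"
  by (induction p) (simp_all add: cpoly_pCons)

lemma cpoly_reversal: "cpoly (reversal m p) = reversal m (cpoly p)"
  unfolding reversal_def cpoly_sum
  by (intro sum.cong refl poly_eqI) (simp add: coeff_map_poly)

lemma poly_cpoly_0: "poly p 0 = 1 \<Longrightarrow> poly (cpoly p) 0 = 1"
  using poly_cpoly[of p 0] by simp

lemma adj_mat_mult_left:
  assumes A: "A \<in> carrier_mat n n" and "k < n" "j < n"
  shows "(\<Sum>i<n. adj_mat A $$ (k, i) * A $$ (i, j)) = (if j = k then det A else 0)"
proof -
  have "(\<Sum>i<n. adj_mat A $$ (k, i) * A $$ (i, j)) = (adj_mat A * A) $$ (k, j)"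
    using A adj_mat(1)[OF A] assms by (simp add: scalar_prod_def atLeast0LessThan)
  then show ?thesis
    unfolding adj_mat(3)[OF A] using assms by auto
qed

lemma adj_mat_mult_right:
  assumes A: "A \<in> carrier_mat n n" and "k < n" "j < n"
  shows "(\<Sum>i<n. A $$ (k, i) * adj_mat A $$ (i, j)) = (if j = k then det A else 0)"
proof -
  have "(\<Sum>i<n. A $$ (k, i) * adj_mat A $$ (i, j)) = (A * adj_mat A) $$ (k, j)"
    using A adj_mat(1)[OF A] assms by (simp add: scalar_prod_def atLeast0LessThan)
  then show ?thesis
    unfolding adj_mat(2)[OF A] using assms by auto
qed

text \<open>Cramer's rule along a ring homomorphism. It is used for the embedding of the polynomials into their
  fractions and for evaluation at a point.\<close>

lemma (in comm_ring_hom) cramer: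
  assumes A: "A \<in> carrier_mat n n" and k: "k < n"
    and eq: "\<And>i. i < n \<Longrightarrow> (\<Sum>j<n. hom (A $$ (i, j)) * y j) = b i"
  shows "hom (det A) * y k = (\<Sum>i<n. hom (adj_mat A $$ (k, i)) * b i)"
proof -
  note adj = adj_mat_mult_left[OF A k]
  have "(\<Sum>i<n. hom (adj_mat A $$ (k, i)) * b i) =
      (\<Sum>i<n. \<Sum>j<n. hom (adj_mat A $$ (k, i) * A $$ (i, j)) * y j)"
    by (intro sum.cong refl) (simp add: eq[symmetric] sum_distrib_left hom_mult mult.assoc)
  also have "\<dots> = (\<Sum>j<n. hom (\<Sum>i<n. adj_mat A $$ (k, i) * A $$ (i, j)) * y j)"
    by (subst sum.swap) (simp add: hom_sum sum_distrib_right)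
  also have "\<dots> = (\<Sum>j<n. if j = k then hom (det A) * y j else 0)"
    by (intro sum.cong refl) (simp add: adj)
  also have "\<dots> = hom (det A) * y k"
    using k by simp
  finally show ?thesis ..
qed

text \<open>The matrix \<open>1 - X A\<close>. With \<open>X = J\<close> it describes \<open>x = J (A x + B u)\<close>.\<close>

definition rev_char_matrix :: "real mat \<Rightarrow> real poly mat" where
  "rev_char_matrix A = mat (dim_row A) (dim_row A) (\<lambda>(i, j). [: if i = j then 1 else 0, - A $$ (i, j) :])"

definition rev_char_poly :: "real mat \<Rightarrow> real poly" where
  "rev_char_poly A = det (rev_char_matrix A)"

text \<open>The vector \<open>adj (1 - X A) X B\<close>, so that \<open>x = (resolvent / rev_char_poly)(J) u\<close> by Cramer's rule.\<close>

definition resolvent :: "real mat \<Rightarrow> real mat \<Rightarrow> nat \<Rightarrow> real poly" where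
  "resolvent A B k = (\<Sum>j<dim_row A. adj_mat (rev_char_matrix A) $$ (k, j) * [:0, B $$ (j, 0):])"

lemma rev_char_matrix_carrier [simp]: "A \<in> carrier_mat n n \<Longrightarrow> rev_char_matrix A \<in> carrier_mat n n"
  by (auto simp: rev_char_matrix_def)

lemma rev_char_poly_0:
  assumes "A \<in> carrier_mat n n"
  shows "poly (rev_char_poly A) 0 = 1"
proof -
  have "comm_ring_hom (\<lambda>p. poly p (0::real))"
    by unfold_locales auto
  note det = comm_ring_hom.hom_det[OF this, of "rev_char_matrix A"]
  have "map_mat (\<lambda>p. poly p 0) (rev_char_matrix A) = 1\<^sub>m n"
    using assms by (intro eq_matI) (auto simp: rev_char_matrix_def)
  then show ?thesis
    unfolding rev_char_poly_def using det by simp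
qed

lemma resolvent_eq:
  assumes A: "A \<in> carrier_mat n n" and i: "i < n"
  shows "(\<Sum>k<n. rev_char_matrix A $$ (i, k) * resolvent A B k) = rev_char_poly A * [:0, B $$ (i, 0):]"
proof -
  let ?P = "rev_char_matrix A"
  have P: "?P \<in> carrier_mat n n"
    using A by simp
  note adj = adj_mat_mult_right[OF P i, folded rev_char_poly_def]
  have "(\<Sum>k<n. ?P $$ (i, k) * resolvent A B k) =
      (\<Sum>k<n. \<Sum>j<n. (?P $$ (i, k) * adj_mat ?P $$ (k, j)) * [:0, B $$ (j, 0):])"
    using A by (intro sum.cong refl) (simp only: resolvent_def sum_distrib_left mult.assoc carrier_matD)
  also have "\<dots> = (\<Sum>j<n. (\<Sum>k<n. ?P $$ (i, k) * adj_mat ?P $$ (k, j)) * [:0, B $$ (j, 0):])"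
    by (subst sum.swap) (simp only: sum_distrib_right)
  also have "\<dots> = (\<Sum>j<n. if j = i then rev_char_poly A * [:0, B $$ (j, 0):] else 0)"
    by (intro sum.cong refl) (simp add: adj)
  also have "\<dots> = rev_char_poly A * [:0, B $$ (i, 0):]"
    using i by simp
  finally show ?thesis .
qed

lemma act_rev_char_matrix:
  assumes "A \<in> carrier_mat n n" "i < n" "k < n"
  shows "act (cpoly (rev_char_matrix A $$ (i, k))) f =
    (\<lambda>t. (if i = k then f t else 0) - of_real (A $$ (i, k)) * integ f t)"
  using assms integ_mult[of "- of_real (A $$ (i, k))" f]
  by (auto simp: rev_char_matrix_def cpoly_pCons)

text \<open>The state equation with zero initial state as an integral equation, for the input matrix \<open>B\<close> with one
  column.\<close>

definition solves :: "nat \<Rightarrow> real mat \<Rightarrow> real mat \<Rightarrow> (nat \<Rightarrow> real \<Rightarrow> complex) \<Rightarrow> (real \<Rightarrow> complex) \<Rightarrow> bool" where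
  "solves n A B x u \<longleftrightarrow> (\<forall>i<n. pwc (x i) \<and>
     x i = integ (\<lambda>t. (\<Sum>j<n. of_real (A $$ (i, j)) * x j t) + of_real (B $$ (i, 0)) * u t))"

lemma integ_system:
  assumes "\<And>j. j < n \<Longrightarrow> pwc (x j)" "pwc u"
  shows "integ (\<lambda>t. (\<Sum>j<n. of_real (a j) * x j t) + of_real b * u t) =
    (\<lambda>t. (\<Sum>j<n. of_real (a j) * integ (x j) t) + (of_real b :: complex) * integ u t)"
proof -
  have "integ (\<lambda>t. (\<Sum>j<n. of_real (a j) * x j t) + of_real b * u t) =
      (\<lambda>t. integ (\<lambda>t. \<Sum>j<n. of_real (a j) * x j t) t + integ (\<lambda>t. of_real b * u t) t)"
    by (intro integ_add pwc_sum pwc_mult pwc_const assms) auto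
  also have "integ (\<lambda>t. \<Sum>j<n. of_real (a j) * x j t) = (\<lambda>t. \<Sum>j<n. integ (\<lambda>t. of_real (a j) * x j t) t)"
    by (intro integ_sum pwc_mult pwc_const assms) auto
  finally show ?thesis
    by (simp only: integ_mult)
qed

text \<open>Existence: solve the scalar equation \<open>rev_char_poly(J) f = u\<close> and read the state off \<open>f\<close>.\<close>

lemma solves_resolvent:
  assumes A: "A \<in> carrier_mat n n" and f: "pwc f"
  shows "solves n A B (\<lambda>k. act (cpoly (resolvent A B k)) f) (act (cpoly (rev_char_poly A)) f)"
  unfolding solves_def
proof (intro allI impI conjI)
  fix i assume i: "i < n"
  let ?x = "\<lambda>k. act (cpoly (resolvent A B k)) f" and ?u = "act (cpoly (rev_char_poly A)) f"
  show "pwc (?x i)"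
    by (rule pwc_act[OF f])
  have "(\<Sum>k<n. act (cpoly (rev_char_matrix A $$ (i, k))) (?x k) t) = of_real (B $$ (i, 0)) * integ ?u t" for t
  proof -
    have "(\<Sum>k<n. act (cpoly (rev_char_matrix A $$ (i, k))) (?x k) t) =
        act (cpoly (\<Sum>k<n. rev_char_matrix A $$ (i, k) * resolvent A B k)) f t"
      unfolding cpoly_sum act_sum_poly[OF f] cpoly_mult act_mult[OF f] ..
    also have "\<dots> = act (cpoly [:0, B $$ (i, 0):]) ?u t"
      unfolding resolvent_eq[OF A i] mult.commute[of "rev_char_poly A"] cpoly_mult act_mult[OF f] ..
    also have "\<dots> = of_real (B $$ (i, 0)) * integ ?u t"
      using integ_mult[of "of_real (B $$ (i, 0))" ?u] by (simp add: cpoly_pCons)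
    finally show ?thesis .
  qed
  moreover have "(\<Sum>k<n. act (cpoly (rev_char_matrix A $$ (i, k))) (?x k) t) =
      ?x i t - (\<Sum>k<n. of_real (A $$ (i, k)) * integ (?x k) t)" for t
    using i by (simp add: act_rev_char_matrix[OF A] sum_subtractf)
  ultimately have "?x i t = (\<Sum>k<n. of_real (A $$ (i, k)) * integ (?x k) t) + of_real (B $$ (i, 0)) * integ ?u t" for t
    by (simp add: algebra_simps)
  then show "?x i = integ (\<lambda>t. (\<Sum>j<n. of_real (A $$ (i, j)) * ?x j t) + of_real (B $$ (i, 0)) * ?u t)"
    using integ_system[of n ?x ?u "\<lambda>j. A $$ (i, j)" "B $$ (i, 0)"] f by (simp add: pwc_act fun_eq_iff)
qed

text \<open>Multiplying \<open>(1 - J A) x = J B u\<close> by the adjugate gives a scalar equation for each component of \<open>x\<close>,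
  and scalar equations have unique solutions.\<close>

lemma solves_unique:
  assumes A: "A \<in> carrier_mat n n" and f: "pwc f"
    and x: "solves n A B x (act (cpoly (rev_char_poly A)) f)" and k: "k < n"
  shows "x k = act (cpoly (resolvent A B k)) f"
proof
  fix t :: real
  let ?u = "act (cpoly (rev_char_poly A)) f" and ?P = "rev_char_matrix A"
  have P: "?P \<in> carrier_mat n n"
    using A by simp
  have u: "pwc ?u"
    by (rule pwc_act[OF f])
  have px: "pwc (x i)" if "i < n" for i
    using x that unfolding solves_def by blast
  have eq: "(\<lambda>t. \<Sum>j<n. act (cpoly (?P $$ (i, j))) (x j) t) = act (cpoly [:0, B $$ (i, 0):]) ?u" if i: "i < n" for i
  proof
    fix t
    have "x i = integ (\<lambda>t. (\<Sum>j<n. of_real (A $$ (i, j)) * x j t) + of_real (B $$ (i, 0)) * ?u t)"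
      using x i unfolding solves_def by blast
    also have "\<dots> = (\<lambda>t. (\<Sum>j<n. of_real (A $$ (i, j)) * integ (x j) t) + of_real (B $$ (i, 0)) * integ ?u t)"
      by (rule integ_system[OF px u])
    finally have "x i t = (\<Sum>j<n. of_real (A $$ (i, j)) * integ (x j) t) + of_real (B $$ (i, 0)) * integ ?u t"
      by (rule fun_cong)
    moreover have "(\<Sum>j<n. act (cpoly (?P $$ (i, j))) (x j) t) =
        x i t - (\<Sum>j<n. of_real (A $$ (i, j)) * integ (x j) t)"
      using i by (simp add: act_rev_char_matrix[OF A] sum_subtractf)
    ultimately show "(\<Sum>j<n. act (cpoly (?P $$ (i, j))) (x j) t) = act (cpoly [:0, B $$ (i, 0):]) ?u t"
      using integ_mult[of "of_real (B $$ (i, 0))" ?u] by (simp add: cpoly_pCons)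
  qed
  note adj = adj_mat_mult_left[OF P k, folded rev_char_poly_def]
  have "act (cpoly (rev_char_poly A)) (x k) t = act (cpoly (resolvent A B k)) ?u t" for t
  proof -
    have "act (cpoly (resolvent A B k)) ?u t =
        (\<Sum>i<n. act (cpoly (adj_mat ?P $$ (k, i))) (act (cpoly [:0, B $$ (i, 0):]) ?u) t)"
      using A unfolding resolvent_def cpoly_sum act_sum_poly[OF u] cpoly_mult act_mult[OF u] by simp
    also have "\<dots> = (\<Sum>i<n. \<Sum>j<n. act (cpoly (adj_mat ?P $$ (k, i) * ?P $$ (i, j))) (x j) t)"
    proof (rule sum.cong[OF refl])
      fix i assume i: "i \<in> {..<n}"
      have "act (cpoly (adj_mat ?P $$ (k, i))) (act (cpoly [:0, B $$ (i, 0):]) ?u) =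
          act (cpoly (adj_mat ?P $$ (k, i))) (\<lambda>t. \<Sum>j<n. act (cpoly (?P $$ (i, j))) (x j) t)"
        using i by (intro arg_cong[OF eq[symmetric]]) simp
      also have "\<dots> = (\<lambda>t. \<Sum>j<n. act (cpoly (adj_mat ?P $$ (k, i))) (act (cpoly (?P $$ (i, j))) (x j)) t)"
        by (rule act_sum) (auto intro: px)
      also have "\<dots> = (\<lambda>t. \<Sum>j<n. act (cpoly (adj_mat ?P $$ (k, i) * ?P $$ (i, j))) (x j) t)"
        by (intro ext sum.cong refl) (simp add: cpoly_mult act_mult px)
      finally show "act (cpoly (adj_mat ?P $$ (k, i))) (act (cpoly [:0, B $$ (i, 0):]) ?u) t =
          (\<Sum>j<n. act (cpoly (adj_mat ?P $$ (k, i) * ?P $$ (i, j))) (x j) t)"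
        by (rule fun_cong)
    qed
    also have "\<dots> = (\<Sum>j<n. act (cpoly (\<Sum>i<n. adj_mat ?P $$ (k, i) * ?P $$ (i, j))) (x j) t)"
      by (subst sum.swap) (intro sum.cong refl, simp add: cpoly_sum act_sum_poly px)
    also have "\<dots> = (\<Sum>j<n. if j = k then act (cpoly (rev_char_poly A)) (x j) t else 0)"
      by (intro sum.cong refl) (simp add: adj)
    also have "\<dots> = act (cpoly (rev_char_poly A)) (x k) t"
      using k by simp
    finally show ?thesis ..
  qed
  then have "act (cpoly (rev_char_poly A)) (x k) s = act (cpoly (rev_char_poly A)) (act (cpoly (resolvent A B k)) f) s" for s
    unfolding act_commute[OF f, of "cpoly (rev_char_poly A)" "cpoly (resolvent A B k)"] .
  then show "x k t = act (cpoly (resolvent A B k)) f t"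
    by (intro act_injective_eq[OF poly_cpoly_0[OF rev_char_poly_0[OF A]] px[OF k] pwc_act[OF f], where T = "t + 1"]) auto
qed

section \<open>Transfer functions and their realizations\<close>

lemma to_fract_hom: "comm_ring_hom to_fract"
  by unfold_locales auto

lemma mat_inverse_if_det_nonzero:
  assumes A: "A \<in> carrier_mat n n" and det: "det A \<noteq> 0"
  shows "A * the (mat_inverse A) = 1\<^sub>m n" "the (mat_inverse A) \<in> carrier_mat n n"
proof -
  obtain V where "mat_inverse A = Some V"
    using mat_inverse(1)[OF A, where b = "()"] det_non_zero_imp_unit[OF A det, where b = "()"]
    by (cases "mat_inverse A") auto
  then show "A * the (mat_inverse A) = 1\<^sub>m n" "the (mat_inverse A) \<in> carrier_mat n n"
    using mat_inverse(2)[OF A] by auto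
qed

lemma tf_num_den: "\<delta> = to_fract (tf_num \<delta>) / to_fract (tf_den \<delta>)"
  unfolding tf_num_def tf_den_def by (metis Fract_conv_to_fract Fract_quot_of_fract)

lemma tf_den_nonzero: "tf_den \<delta> \<noteq> 0"
  by (simp add: tf_den_def)

lemma tf_den_monic: "lead_coeff (tf_den \<delta>) = 1"
proof -
  have "unit_factor (tf_den \<delta>) = 1"
    unfolding tf_den_def by (rule unit_factor_snd_quot_of_fract)
  then show ?thesis
    by (simp add: unit_factor_poly_def one_pCons)
qed

text \<open>The numerator of \<open>C (s I - A)\<^sup>-\<^sup>1 B + D\<close> over the denominator \<open>char_poly A\<close>; the fraction need not be reduced.\<close>

definition system_numerator :: "nat \<Rightarrow> real mat \<Rightarrow> real mat \<Rightarrow> real mat \<Rightarrow> real mat \<Rightarrow> real poly" where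
  "system_numerator n A B C D =
     (\<Sum>i<n. smult (C $$ (0, i)) (\<Sum>j<n. adj_mat (char_poly_matrix A) $$ (i, j) * [:B $$ (j, 0):]))
      + smult (D $$ (0, 0)) (char_poly A)"

lemma realization_numerator:
  assumes "realization n A B C D (mat 1 1 (\<lambda>_. \<delta>))"
  shows "tf_num \<delta> * char_poly A = tf_den \<delta> * system_numerator n A B C D"
proof -
  let ?G = "mat 1 1 (\<lambda>_. \<delta>)" and ?M = "char_poly_matrix A" and ?h = "to_fract :: real poly \<Rightarrow> _"
  interpret h: comm_ring_hom ?h
    by (rule to_fract_hom)
  have dims: "A \<in> carrier_mat n n" "B \<in> carrier_mat n 1" "C \<in> carrier_mat 1 n" "D \<in> carrier_mat 1 1"
    using assms by (auto simp: realization_def)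
  define V where "V = the (mat_inverse (map_mat ?h ?M))"
  have M: "?M \<in> carrier_mat n n"
    using dims by simp
  have hM: "map_mat ?h ?M \<in> carrier_mat n n"
    using M by simp
  have "char_poly A \<noteq> 0"
    using degree_monic_char_poly[OF dims(1)] by (cases "char_poly A = 0") auto
  moreover have det: "det (map_mat ?h ?M) = ?h (char_poly A)"
    using comm_ring_hom.hom_det[OF to_fract_hom, of ?M] by (simp add: char_poly_def)
  ultimately have V: "map_mat ?h ?M * V = 1\<^sub>m n" "V \<in> carrier_mat n n"
    unfolding V_def by (auto intro!: mat_inverse_if_det_nonzero[OF hM])
  have Vij: "?h (char_poly A) * V $$ (i, j) = ?h (adj_mat ?M $$ (i, j))" if ij: "i < n" "j < n" for i j
  proof -
    have "(\<Sum>k<n. ?h (?M $$ (i', k)) * V $$ (k, j)) = (if i' = j then 1 else 0)" if "i' < n" for i'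
    proof -
      have "(\<Sum>k<n. ?h (?M $$ (i', k)) * V $$ (k, j)) = (map_mat ?h ?M * V) $$ (i', j)"
        using V(2) M ij that by (simp add: scalar_prod_def atLeast0LessThan)
      then show ?thesis
        unfolding V(1) using that ij by simp
    qed
    from h.cramer[OF M ij(1), of "\<lambda>k. V $$ (k, j)", OF this] show ?thesis
      using ij by (simp add: char_poly_def if_distrib cong: if_cong)
  qed
  have "\<delta> = (const_tm C * V * const_tm B + const_tm D) $$ (0, 0)"
    using assms unfolding realization_def V_def by (metis index_mat(1) less_numeral_extra(1) prod.simps(2))
  also have "\<dots> = (\<Sum>i<n. ?h [:C $$ (0, i):] * (\<Sum>j<n. V $$ (i, j) * ?h [:B $$ (j, 0):])) + ?h [:D $$ (0, 0):]"
  proof -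
    have "const_tm C * V * const_tm B = const_tm C * (V * const_tm B)"
      using dims V by (intro assoc_mult_mat) (auto simp: const_tm_def)
    then show ?thesis
      using dims V by (simp add: const_tm_def scalar_prod_def atLeast0LessThan)
  qed
  finally have "\<delta> * ?h (char_poly A) = ?h (system_numerator n A B C D)"
  proof -
    assume d: "\<delta> = (\<Sum>i<n. ?h [:C $$ (0, i):] * (\<Sum>j<n. V $$ (i, j) * ?h [:B $$ (j, 0):])) + ?h [:D $$ (0, 0):]"
    have "?h (char_poly A) * \<delta> = (\<Sum>i<n. ?h [:C $$ (0, i):] *
        (\<Sum>j<n. (?h (char_poly A) * V $$ (i, j)) * ?h [:B $$ (j, 0):])) + ?h [:D $$ (0, 0):] * ?h (char_poly A)"
      unfolding d by (simp only: distrib_left sum_distrib_left mult_ac)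
    also have "\<dots> = (\<Sum>i<n. ?h [:C $$ (0, i):] *
        (\<Sum>j<n. ?h (adj_mat ?M $$ (i, j)) * ?h [:B $$ (j, 0):])) + ?h [:D $$ (0, 0):] * ?h (char_poly A)"
      by (intro arg_cong2[where f = "(+)"] sum.cong arg_cong2[where f = "(*)"] refl Vij) auto
    also have "\<dots> = ?h (system_numerator n A B C D)"
    proof -
      have "?h (smult a p) = ?h [:a:] * ?h p" for a p
        by (simp flip: to_fract_mult)
      then show ?thesis
        unfolding system_numerator_def by (simp only: to_fract_add to_fract_sum to_fract_mult)
    qed
    finally show ?thesis
      by (simp only: mult.commute)
  qed
  then have "?h (tf_num \<delta> * char_poly A) = ?h (tf_den \<delta> * system_numerator n A B C D)"
    using tf_den_nonzero[of \<delta>] by (subst (asm) tf_num_den) (simp add: field_simps)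
  then show ?thesis
    by (simp only: to_fract_eq_iff)
qed

text \<open>The resolvents of \<open>s I - A\<close> and of \<open>1 - X A\<close> agree under \<open>X = 1 / s\<close>. Both sides are cross-multiplied by
  the other determinant, so that eigenvalues need not be excluded.\<close>

lemma resolvent_char_poly:
  assumes A: "A \<in> carrier_mat n n" and x: "x \<noteq> 0" and k: "k < n"
  shows "poly (char_poly A) (1 / x) * poly (resolvent A B k) x =
    poly (rev_char_poly A) x * poly (\<Sum>j<n. adj_mat (char_poly_matrix A) $$ (k, j) * [:B $$ (j, 0):]) (1 / x)"
proof -
  let ?M = "char_poly_matrix A"
  have M: "?M \<in> carrier_mat n n"
    using A by simp
  have ev: "comm_ring_hom (\<lambda>p. poly p (1 / x))"
    by unfold_locales auto
  have "(\<Sum>j<n. poly (?M $$ (i, j)) (1 / x) * poly (resolvent A B j) x) = poly (rev_char_poly A) x * B $$ (i, 0)"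
    if i: "i < n" for i
  proof -
    have "poly (rev_char_matrix A $$ (i, j)) x = x * poly (?M $$ (i, j)) (1 / x)" if "j < n" for j
      using A i that x by (simp add: rev_char_matrix_def char_poly_matrix_def field_simps)
    then have "(\<Sum>j<n. x * poly (?M $$ (i, j)) (1 / x) * poly (resolvent A B j) x) =
        poly (\<Sum>j<n. rev_char_matrix A $$ (i, j) * resolvent A B j) x"
      by (simp add: poly_sum)
    also have "\<dots> = x * (poly (rev_char_poly A) x * B $$ (i, 0))"
      unfolding resolvent_eq[OF A i] by (simp add: mult_ac)
    finally have "x * (\<Sum>j<n. poly (?M $$ (i, j)) (1 / x) * poly (resolvent A B j) x) =
        x * (poly (rev_char_poly A) x * B $$ (i, 0))"
      by (simp only: sum_distrib_left mult.assoc)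
    then show ?thesis
      using x by simp
  qed
  from comm_ring_hom.cramer[OF ev M k, of "\<lambda>j. poly (resolvent A B j) x", OF this]
  show ?thesis
    by (simp add: char_poly_def poly_sum sum_distrib_left mult_ac)
qed

text \<open>Every realization of \<open>\<delta>\<close> has the input-output behaviour of the reduced fraction of \<open>\<delta>\<close>, as an identity of
  polynomials in \<open>X = 1 / s\<close>.\<close>

lemma io_polynomial:
  assumes R: "realization n A B C D (mat 1 1 (\<lambda>_. \<delta>))" and proper: "degree (tf_num \<delta>) \<le> m" "degree (tf_den \<delta>) \<le> m"
  shows "reversal m (tf_den \<delta>) * ((\<Sum>k<n. smult (C $$ (0, k)) (resolvent A B k)) + smult (D $$ (0, 0)) (rev_char_poly A)) =
    reversal m (tf_num \<delta>) * rev_char_poly A"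
proof -
  have A: "A \<in> carrier_mat n n"
    using R by (simp add: realization_def)
  let ?N = "(\<Sum>k<n. smult (C $$ (0, k)) (resolvent A B k)) + smult (D $$ (0, 0)) (rev_char_poly A)"
  let ?r = "reversal n (char_poly A)"
  have mon: "degree (char_poly A) = n" "coeff (char_poly A) n = 1"
    using degree_monic_char_poly[OF A] by auto
  \<comment> \<open>the factor \<open>?r\<close> makes both sides agree also where \<open>1 / x\<close> is an eigenvalue of \<open>A\<close>\<close>
  have "?r * (reversal m (tf_den \<delta>) * ?N) = ?r * (reversal m (tf_num \<delta>) * rev_char_poly A)"
  proof (rule poly_eq_if_eq_nonzero)
    fix x :: real assume x: "x \<noteq> 0"
    have N: "poly (char_poly A) (1 / x) * poly ?N x = poly (rev_char_poly A) x * poly (system_numerator n A B C D) (1 / x)"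
    proof -
      have "poly (char_poly A) (1 / x) * poly ?N x =
          (\<Sum>k<n. C $$ (0, k) * (poly (char_poly A) (1 / x) * poly (resolvent A B k) x)) +
          D $$ (0, 0) * poly (char_poly A) (1 / x) * poly (rev_char_poly A) x"
        by (simp add: poly_sum distrib_left sum_distrib_left mult_ac)
      also have "\<dots> = (\<Sum>k<n. C $$ (0, k) * (poly (rev_char_poly A) x *
            poly (\<Sum>j<n. adj_mat (char_poly_matrix A) $$ (k, j) * [:B $$ (j, 0):]) (1 / x))) +
          D $$ (0, 0) * poly (char_poly A) (1 / x) * poly (rev_char_poly A) x"
        by (intro arg_cong2[where f = "(+)"] sum.cong refl arg_cong2[where f = "(*)"] resolvent_char_poly[OF A x]) auto
      also have "\<dots> = poly (rev_char_poly A) x * poly (system_numerator n A B C D) (1 / x)"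
        unfolding system_numerator_def poly_add poly_sum[of _ "{..<n}"] poly_smult distrib_left sum_distrib_left
        by (simp only: mult_ac)
      finally show ?thesis .
    qed
    have num: "poly (tf_num \<delta>) (1 / x) * poly (char_poly A) (1 / x) =
        poly (tf_den \<delta>) (1 / x) * poly (system_numerator n A B C D) (1 / x)"
      using arg_cong[OF realization_numerator[OF R], of "\<lambda>p. poly p (1 / x)"] by simp
    have "poly (tf_den \<delta>) (1 / x) * (poly (char_poly A) (1 / x) * poly ?N x) =
        poly (tf_num \<delta>) (1 / x) * poly (char_poly A) (1 / x) * poly (rev_char_poly A) x"
      unfolding N num by (simp only: mult_ac)
    then show "poly (?r * (reversal m (tf_den \<delta>) * ?N)) x = poly (?r * (reversal m (tf_num \<delta>) * rev_char_poly A)) x"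
      by (simp only: poly_mult poly_reversal[OF proper(1) x] poly_reversal[OF proper(2) x]
          poly_reversal[OF eq_refl[OF mon(1)] x]) (simp only: mult_ac)
  qed
  moreover have "?r \<noteq> 0"
    using coeff_0_reversal[of n "char_poly A"] mon by auto
  ultimately show ?thesis
    by simp
qed

section \<open>Causal signals and input-output relations\<close>

lemma pwc_cong:
  assumes "\<And>t. 0 \<le> t \<Longrightarrow> f t = g t" "pwc f"
  shows "pwc g"
proof -
  have ev: "\<forall>\<^sub>F s in at t. f s = g s" if "0 < t" for t
    using assms(1) by (intro eventually_mono[OF order_tendstoD(1)[OF tendsto_ident_at that]]) auto
  have "(g \<longlongrightarrow> g t) (at_right t)" if "0 \<le> t" for t
  proof -
    have "\<forall>\<^sub>F s in at_right t. f s = g s"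
      unfolding eventually_at_filter using assms(1) that by (auto intro!: always_eventually)
    then show ?thesis
      using assms that tendsto_cong[of f g "at_right t" "f t"] by (auto simp: pwc_def)
  qed
  moreover have "\<exists>c. (g \<longlongrightarrow> c) (at_left t)" if t: "0 < t" for t
  proof -
    obtain c where "(f \<longlongrightarrow> c) (at_left t)"
      using assms(2) t unfolding pwc_def by blast
    moreover have "\<forall>\<^sub>F s in at_left t. f s = g s"
      using filter_leD[OF at_le[OF subset_UNIV] ev[OF t]] .
    ultimately show ?thesis
      using tendsto_cong by blast
  qed
  moreover have "{t \<in> {0<..T}. \<not> isCont g t} \<subseteq> {t \<in> {0<..T}. \<not> isCont f t}" for T
    using ev assms(1) tendsto_cong unfolding isCont_def by fastforce
  then have "finite {t \<in> {0<..T}. \<not> isCont g t}" for T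
    by (rule finite_subset) (use assms(2) in \<open>simp add: pwc_def\<close>)
  ultimately show ?thesis
    unfolding pwc_def by blast
qed

text \<open>Setting a signal to zero on negative times turns statements about the half line into equations between
  functions, on which \<^const>\<open>act\<close> operates.\<close>

definition causal :: "(real \<Rightarrow> real) \<Rightarrow> real \<Rightarrow> real" where
  "causal u t = (if t < 0 then 0 else u t)"

lemma pwc_causal: "pwc u \<Longrightarrow> pwc (causal u)"
  by (rule pwc_cong) (auto simp: causal_def)

lemma causal_nonneg [simp]: "0 \<le> t \<Longrightarrow> causal u t = u t"
  by (simp add: causal_def)

abbreviation ccausal :: "(real \<Rightarrow> real) \<Rightarrow> real \<Rightarrow> complex" where
  "ccausal u \<equiv> \<lambda>t. of_real (causal u t)"

lemma pwc_ccausal: "pwc u \<Longrightarrow> pwc (ccausal u)"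
  by (intro pwc_of_real pwc_causal)

lemma dim_scalar_vec [simp]: "scalar_vec a \<in> carrier_vec 1" "dim_vec (scalar_vec a) = 1" "scalar_vec a $ 0 = a"
  by (auto simp: scalar_vec_def)

lemma mult_mat_vec_sum:
  "M \<in> carrier_mat a b \<Longrightarrow> i < a \<Longrightarrow> v \<in> carrier_vec b \<Longrightarrow> (M *\<^sub>v v) $ i = (\<Sum>j<b. M $$ (i, j) * v $ j)"
  by (auto simp: scalar_prod_def atLeast0LessThan intro!: sum.cong)

lemma state_equation_component:
  assumes "A \<in> carrier_mat n n" "B \<in> carrier_mat n 1" "x \<in> carrier_vec n" "i < n"
  shows "(A *\<^sub>v x + B *\<^sub>v scalar_vec u) $ i = (\<Sum>j<n. A $$ (i, j) * x $ j) + B $$ (i, 0) * u"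
proof -
  have "(B *\<^sub>v scalar_vec u) $ i = B $$ (i, 0) * u"
    by (subst mult_mat_vec_sum[OF assms(2,4) dim_scalar_vec(1)]) simp
  moreover have "(A *\<^sub>v x + B *\<^sub>v scalar_vec u) $ i = (A *\<^sub>v x) $ i + (B *\<^sub>v scalar_vec u) $ i"
    using assms by (intro index_add_vec(1)) simp
  ultimately show ?thesis
    by (simp only: mult_mat_vec_sum[OF assms(1,4,3)])
qed

lemma output_equation_component:
  assumes "C \<in> carrier_mat 1 n" "D \<in> carrier_mat 1 1" "x \<in> carrier_vec n"
  shows "(C *\<^sub>v x + D *\<^sub>v scalar_vec u) $ 0 = (\<Sum>j<n. C $$ (0, j) * x $ j) + D $$ (0, 0) * u"
proof -
  have "(D *\<^sub>v scalar_vec u) $ 0 = D $$ (0, 0) * u"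
    by (subst mult_mat_vec_sum[OF assms(2) _ dim_scalar_vec(1)]) simp_all
  moreover have "(C *\<^sub>v x + D *\<^sub>v scalar_vec u) $ 0 = (C *\<^sub>v x) $ 0 + (D *\<^sub>v scalar_vec u) $ 0"
    using assms by (intro index_add_vec(1)) simp
  ultimately show ?thesis
    by (simp only: mult_mat_vec_sum[OF assms(1) less_numeral_extra(1) assms(3)])
qed

lemma state_trajectory_integ:
  assumes x: "state_trajectory n x v" and i: "i < n" and t: "0 \<le> t"
  shows "integ (\<lambda>t. v t $ i) t = x t $ i - x 0 $ i" "pwc (\<lambda>t. v t $ i)" "pwc (\<lambda>t. x t $ i)"
proof -
  have c: "continuous_on {0..} (\<lambda>t. x t $ i)"
    using x i by (simp add: state_trajectory_def)
  then show "pwc (\<lambda>t. x t $ i)"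
    by (rule pwc_continuous_on)
  show p: "pwc (\<lambda>t. v t $ i)"
    using x i by (simp add: state_trajectory_def vec_signals_def signals_iff_pwc)
  show "integ (\<lambda>t. v t $ i) t = x t $ i - x 0 $ i"
  proof (rule integral_right_derivative[OF c p _ t])
    show "((\<lambda>t. x t $ i) has_vector_derivative v t $ i) (at_right t)" if "0 \<le> t" for t
      using x i that by (simp add: state_trajectory_def has_real_derivative_iff_has_vector_derivative)
  qed
qed

lemma state_trajectory_solves:
  assumes A: "A \<in> carrier_mat n n" and B: "B \<in> carrier_mat n 1" and z: "pwc z"
    and x: "state_trajectory n x (\<lambda>t. A *\<^sub>v x t + B *\<^sub>v scalar_vec (z t))" "x 0 = 0\<^sub>v n"
  shows "solves n A B (\<lambda>i. ccausal (\<lambda>t. x t $ i)) (ccausal z)"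
  unfolding solves_def
proof (intro allI impI conjI)
  fix i assume i: "i < n"
  let ?v = "\<lambda>t. A *\<^sub>v x t + B *\<^sub>v scalar_vec (z t)"
  note X = state_trajectory_integ[OF x(1)]
  show "pwc (ccausal (\<lambda>t. x t $ i))"
    by (rule pwc_ccausal[OF X(3)[OF i order_refl]])
  show "ccausal (\<lambda>t. x t $ i) = integ (\<lambda>t. (\<Sum>j<n. of_real (A $$ (i, j)) * ccausal (\<lambda>t. x t $ j) t) +
      of_real (B $$ (i, 0)) * ccausal z t)" (is "_ = integ ?f")
  proof
    fix t
    show "ccausal (\<lambda>t. x t $ i) t = integ ?f t"
    proof (cases "0 \<le> t")
      case True
      have "?f s = of_real (?v s $ i)" if "0 \<le> s" for s
      proof -
        have "x s \<in> carrier_vec n"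
          using x(1) that by (simp add: state_trajectory_def)
        from state_equation_component[OF A B this i] show ?thesis
          using that by simp
      qed
      then have "integ ?f t = integ (\<lambda>t. of_real (?v t $ i)) t"
        by (intro integ_cong) auto
      also have "\<dots> = of_real (x t $ i - x 0 $ i)"
        by (simp only: integ_of_real[OF X(2)[OF i True]] X(1)[OF i True])
      finally show ?thesis
        using x(2) i True by simp
    qed (simp add: causal_def)
  qed
qed

text \<open>The relation \<open>w = \<delta> z\<close> with \<open>\<delta> = num / den\<close> reads \<open>(J\<^sup>m den(D)) w = (J\<^sup>m num(D)) z\<close>. State and output are
  polynomials in \<open>J\<close> applied to one auxiliary signal \<open>f\<close>, which turns the claim into \<open>io_polynomial\<close>.\<close>

lemma tf_output_act:
  assumes out: "tf_output \<delta> z w" and z: "pwc z" and m: "degree (tf_num \<delta>) \<le> m" "degree (tf_den \<delta>) \<le> m"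
  shows "act (reversal m (cpoly (tf_den \<delta>))) (ccausal w) = act (reversal m (cpoly (tf_num \<delta>))) (ccausal z)"
proof -
  obtain n A B C D x where R: "realization n A B C D (mat 1 1 (\<lambda>_. \<delta>))"
    and x: "state_trajectory n x (\<lambda>t. A *\<^sub>v x t + B *\<^sub>v scalar_vec (z t))" "x 0 = 0\<^sub>v n"
    and w: "\<And>t. 0 \<le> t \<Longrightarrow> scalar_vec (w t) = C *\<^sub>v x t + D *\<^sub>v scalar_vec (z t)"
    using out unfolding tf_output_def minimal_realization_def by blast
  have dims: "A \<in> carrier_mat n n" "B \<in> carrier_mat n 1" "C \<in> carrier_mat 1 n" "D \<in> carrier_mat 1 1"
    using R by (auto simp: realization_def)
  obtain f where f: "pwc f" "act (cpoly (rev_char_poly A)) f = ccausal z"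
    using act_solvable[OF poly_cpoly_0[OF rev_char_poly_0[OF dims(1)]] pwc_ccausal[OF z]] by blast
  have xf: "ccausal (\<lambda>t. x t $ k) = act (cpoly (resolvent A B k)) f" if "k < n" for k
    by (rule solves_unique[OF dims(1) f(1) _ that]) (simp only: f(2) state_trajectory_solves[OF dims(1,2) z x])
  let ?N = "(\<Sum>k<n. smult (C $$ (0, k)) (resolvent A B k)) + smult (D $$ (0, 0)) (rev_char_poly A)"
  have csm: "cpoly (smult a p) = smult (of_real a) (cpoly p)" for a p
    by (rule poly_eqI) (simp add: coeff_map_poly)
  have "ccausal w t = act (cpoly ?N) f t" for t
  proof -
    have "act (cpoly ?N) f t = (\<Sum>k<n. of_real (C $$ (0, k)) * ccausal (\<lambda>t. x t $ k) t) + of_real (D $$ (0, 0)) * ccausal z t"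
      unfolding cpoly_add cpoly_sum csm act_add_poly[OF f(1)] act_sum_poly[OF f(1)] act_smult f(2)
      by (intro arg_cong2[where f = "(+)"] sum.cong arg_cong2[where f = "(*)"] refl fun_cong[OF xf, symmetric]) auto
    also have "\<dots> = ccausal w t"
    proof (cases "0 \<le> t")
      case True
      have "x t \<in> carrier_vec n"
        using x(1) True by (simp add: state_trajectory_def)
      from output_equation_component[OF dims(3,4) this, of "z t", folded w[OF True]] have
        "w t = (\<Sum>j<n. C $$ (0, j) * x t $ j) + D $$ (0, 0) * z t"
        by simp
      then show ?thesis
        using True by simp
    qed (simp add: causal_def)
    finally show ?thesis ..
  qed
  then have w: "ccausal w = act (cpoly ?N) f"
    by (rule ext)
  show ?thesis
    unfolding w f(2)[symmetric] cpoly_reversal[symmetric] act_mult[OF f(1), symmetric] cpoly_mult[symmetric]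
    by (simp only: io_polynomial[OF R m])
qed

text \<open>The constraint on \<open>\<delta>\<close> at the frequency \<open>\<omega>\<close>, multiplied by \<open>|den(\<i> \<omega>)|\<^sup>2\<close>, which is positive by stability.\<close>

lemma uncertainty_fdi:
  assumes stable: "tf_stable \<delta>" and P\<^sub>0: "P\<^sub>0 = mat_of_rows_list 2 [[q, s], [s, r]]"
    and pd: "\<And>H. H \<in> imag_axis_values (mat_of_rows_list 1 [[1], [\<delta>]]) \<Longrightarrow>
      pos_def (mat_adjoint H * map_mat of_real P\<^sub>0 * H)"
  shows "q * (cmod (poly (cpoly (tf_den \<delta>)) (\<i> * of_real \<omega>)))\<^sup>2 +
    2 * s * Re (poly (cpoly (tf_den \<delta>)) (\<i> * of_real \<omega>) * cnj (poly (cpoly (tf_num \<delta>)) (\<i> * of_real \<omega>))) +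
    r * (cmod (poly (cpoly (tf_num \<delta>)) (\<i> * of_real \<omega>)))\<^sup>2 > 0"
proof -
  define d n where "d = poly (cpoly (tf_den \<delta>)) (\<i> * of_real \<omega>)" and "n = poly (cpoly (tf_num \<delta>)) (\<i> * of_real \<omega>)"
  have d0: "d \<noteq> 0"
    using stable unfolding tf_stable_def tf_poles_def d_def by fastforce
  define c where "c = n / d"
  define H where "H = map_mat (tf_at (\<i> * of_real \<omega>)) (mat_of_rows_list 1 [[1], [\<delta>]])"
  have "tf_at (\<i> * of_real \<omega>) 1 = 1"
    by (simp add: tf_at_def tf_num_def tf_den_def)
  moreover have "tf_at (\<i> * of_real \<omega>) \<delta> = c"
    by (simp add: tf_at_def c_def n_def d_def)
  ultimately have H: "H = mat_of_rows_list 1 [[1], [c]]"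
    unfolding H_def by (intro eq_matI) (auto simp: mat_of_rows_list_def less_Suc_eq)
  have "H \<in> imag_axis_values (mat_of_rows_list 1 [[1], [\<delta>]])"
    unfolding imag_axis_values_def H_def by blast
  from pd[OF this] have pdH: "pos_def (mat_adjoint H * map_mat of_real P\<^sub>0 * H)" .
  let ?F = "mat_adjoint H * map_mat complex_of_real P\<^sub>0 * H"
  have F: "?F \<in> carrier_mat 1 1"
    by (auto simp: H mat_adjoint_def mat_of_rows_list_def mat_of_rows_def)
  have entry: "?F $$ (0, 0) = of_real q + of_real s * c + of_real s * cnj c + of_real r * (c * cnj c)"
    unfolding H P\<^sub>0
    by (simp add: mat_adjoint_def mat_of_rows_list_def mat_of_rows_def scalar_prod_def cols_def col_def row_def
        numeral_2_eq_2 algebra_simps)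
  have "0 < ?F $$ (0, 0)"
  proof -
    have "vec 1 (\<lambda>_. 1) \<noteq> (0\<^sub>v 1 :: complex vec)"
      by (metis index_vec index_zero_vec(1) less_one zero_neq_one)
    then have "0 < scalar_prod (?F *\<^sub>v vec 1 (\<lambda>_. 1)) (conjugate (vec 1 (\<lambda>_. 1)))"
      using pdH F unfolding pos_def_def by (metis carrier_matD(1) vec_carrier)
    moreover have "scalar_prod (G *\<^sub>v vec 1 (\<lambda>_. 1)) (conjugate (vec 1 (\<lambda>_. 1))) = G $$ (0, 0)"
      if "G \<in> carrier_mat 1 1" for G :: "complex mat"
      using that by (simp add: scalar_prod_def)
    ultimately show ?thesis
      using F by metis
  qed
  then have pos: "0 < q + 2 * s * Re c + r * (cmod c)\<^sup>2"
    unfolding entry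
    by (simp add: less_complex_def cmod_power2) (simp add: power2_eq_square algebra_simps)
  have "q * (cmod d)\<^sup>2 + 2 * s * Re (d * cnj n) + r * (cmod n)\<^sup>2 = (cmod d)\<^sup>2 * (q + 2 * s * Re c + r * (cmod c)\<^sup>2)"
  proof -
    have n: "n = c * d"
      using d0 by (simp add: c_def)
    have "d * cnj n = cnj c * of_real ((cmod d)\<^sup>2)"
      unfolding n complex_norm_square by simp
    then have "Re (d * cnj n) = Re c * (cmod d)\<^sup>2"
      by simp
    then show ?thesis
      by (simp add: n norm_mult power_mult_distrib algebra_simps)
  qed
  then show ?thesis
    using pos d0 unfolding d_def[symmetric] n_def[symmetric] by simp
qed

section \<open>The integral quadratic constraint for filtered signals\<close>

text \<open>The signal \<open>f\<close> that generates the trajectory is part of the conclusion: through it the two copies of the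
  filter are compared.\<close>

lemma linear_system_trajectory:
  assumes A: "A \<in> carrier_mat n n" and B: "B \<in> carrier_mat n 1" and z: "pwc z"
  obtains f x where "pwc f" "act (cpoly (rev_char_poly A)) (\<lambda>t. of_real (f t)) = ccausal z"
    "state_trajectory n x (\<lambda>t. A *\<^sub>v x t + B *\<^sub>v scalar_vec (z t))" "x 0 = 0\<^sub>v n"
    "\<And>i t. i < n \<Longrightarrow> of_real (x t $ i) = act (cpoly (resolvent A B i)) (\<lambda>t. of_real (f t)) t"
proof -
  obtain f where f: "pwc f" "act (cpoly (rev_char_poly A)) (\<lambda>t. of_real (f t)) = ccausal z"
    using act_cpoly_solvable[OF rev_char_poly_0[OF A] pwc_causal[OF z]] by blast
  define X where "X = (\<lambda>i. act (cpoly (resolvent A B i)) (\<lambda>t. of_real (f t)))"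
  define x where "x = (\<lambda>t. vec n (\<lambda>i. Re (X i t)))"
  have xX: "of_real (x t $ i) = X i t" if "i < n" for i t
    using act_cpoly_real[OF f(1), of "resolvent A B i" t] that by (simp add: x_def X_def)
  have sol: "solves n A B X (ccausal z)"
    unfolding X_def f(2)[symmetric] by (rule solves_resolvent[OF A pwc_of_real[OF f(1)]])
  define g where "g = (\<lambda>i t. (\<Sum>j<n. of_real (A $$ (i, j)) * X j t) + of_real (B $$ (i, 0)) * ccausal z t)"
  have Xg: "X i = integ (g i)" and pX: "pwc (X i)" if "i < n" for i
    using sol that unfolding solves_def g_def by blast+
  have pg: "pwc (g i)" for i
    unfolding g_def by (intro pwc_add pwc_sum pwc_mult pwc_const pwc_ccausal z pX) simp
  let ?v = "\<lambda>t. A *\<^sub>v x t + B *\<^sub>v scalar_vec (z t)"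
  have xc: "x t \<in> carrier_vec n" for t
    by (simp add: x_def)
  have v: "Re (g i t) = ?v t $ i" if "i < n" "0 \<le> t" for i t
  proof -
    have "g i t = of_real (?v t $ i)"
      unfolding state_equation_component[OF A B xc that(1)] g_def using that(2) by (simp add: xX[symmetric])
    then show ?thesis
      by simp
  qed
  have "state_trajectory n x ?v"
    unfolding state_trajectory_def vec_signals_def signals_iff_pwc
  proof (intro conjI allI impI CollectI)
    show "x t \<in> carrier_vec n" for t
      by (rule xc)
    show "?v t \<in> carrier_vec n" for t
      by (intro add_carrier_vec mult_mat_vec_carrier[OF A] mult_mat_vec_carrier[OF B] xc dim_scalar_vec)
    show "pwc (\<lambda>t. ?v t $ i)" if "i < n" for i
      by (rule pwc_cong[OF v[OF that] pwc_Re[OF pg]])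
    have xi: "(\<lambda>t. x t $ i) = (\<lambda>t. Re (integ (g i) t))" if "i < n" for i
      using that by (simp add: x_def flip: Xg)
    show "continuous_on {0..} (\<lambda>t. x t $ i)" if "i < n" for i
      unfolding xi[OF that] by (intro continuous_on_Re continuous_on_integ pg)
    show "((\<lambda>t. x t $ i) has_real_derivative ?v t $ i) (at_right t)" if "i < n" "0 \<le> t" for i t
      unfolding xi[OF that(1)] has_real_derivative_iff_has_vector_derivative v[OF that, symmetric]
      by (rule bounded_linear.has_vector_derivative[OF bounded_linear_Re integ_right_derivative[OF pg that(2)]])
  qed
  moreover have "x 0 = 0\<^sub>v n"
    by (intro eq_vecI) (auto simp: x_def Xg)
  ultimately show ?thesis
    using that f xX unfolding X_def by blast
qed

text \<open>Completing the square in the last variable.\<close>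

lemma cholesky:
  fixes N :: "nat \<Rightarrow> nat \<Rightarrow> real"
  assumes "\<And>i j. i < n \<Longrightarrow> j < n \<Longrightarrow> N i j = N j i"
    and "\<And>v. \<exists>i<n. v i \<noteq> 0 \<Longrightarrow> 0 < (\<Sum>i<n. \<Sum>j<n. N i j * v i * v j)"
  shows "\<exists>L. \<forall>i<n. \<forall>j<n. N i j = (\<Sum>k<n. L k i * L k j)"
  using assms
proof (induction n arbitrary: N)
  case (Suc n)
  define a where "a = N n n"
  have expand: "(\<Sum>i<Suc n. \<Sum>j<Suc n. N i j * v i * v j) =
      (\<Sum>i<n. \<Sum>j<n. N i j * v i * v j) + 2 * v n * (\<Sum>i<n. N i n * v i) + a * (v n)\<^sup>2" for v
  proof -
    have "(\<Sum>j<n. N n j * v n * v j) = v n * (\<Sum>i<n. N i n * v i)"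
      unfolding sum_distrib_left using Suc.prems(1) by (intro sum.cong) auto
    moreover have "(\<Sum>i<n. N i n * v i * v n) = v n * (\<Sum>i<n. N i n * v i)"
      unfolding sum_distrib_left by (intro sum.cong) auto
    ultimately show ?thesis
      by (simp add: sum.distrib a_def power2_eq_square)
  qed
  have "0 < (\<Sum>i<Suc n. \<Sum>j<Suc n. N i j * (if i = n then 1 else 0) * (if j = n then 1 else 0))"
    by (rule Suc.prems(2)) auto
  then have a: "0 < a"
    unfolding expand by simp
  define N' where "N' i j = N i j - N i n * N j n / a" for i j
  have "\<exists>L. \<forall>i<n. \<forall>j<n. N' i j = (\<Sum>k<n. L k i * L k j)"
  proof (rule Suc.IH)
    show "N' i j = N' j i" if "i < n" "j < n" for i j
      using Suc.prems(1)[of i j] that by (simp add: N'_def)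
    fix v :: "nat \<Rightarrow> real" assume v: "\<exists>i<n. v i \<noteq> 0"
    define s where "s = (\<Sum>i<n. N i n * v i)"
    \<comment> \<open>the choice of the last variable that minimizes the form\<close>
    define u where "u = v(n := - s / a)"
    have us: "(\<Sum>i<n. N i n * u i) = s" "(\<Sum>i<n. \<Sum>j<n. N i j * u i * u j) = (\<Sum>i<n. \<Sum>j<n. N i j * v i * v j)"
      by (simp_all add: s_def u_def)
    have "(\<Sum>i<n. \<Sum>j<n. N' i j * v i * v j) =
        (\<Sum>i<n. \<Sum>j<n. N i j * v i * v j) - (\<Sum>i<n. \<Sum>j<n. (N i n * v i) * (N j n * v j)) / a"
    proof -
      have "N' i j * v i * v j = N i j * v i * v j - (N i n * v i) * (N j n * v j) / a" for i j
        using a by (simp add: N'_def field_simps)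
      then show ?thesis
        by (simp only: sum_subtractf sum_divide_distrib)
    qed
    also have "(\<Sum>i<n. \<Sum>j<n. (N i n * v i) * (N j n * v j)) = s * s"
      by (simp add: s_def sum_product)
    also have "(\<Sum>i<n. \<Sum>j<n. N i j * v i * v j) - s * s / a = (\<Sum>i<Suc n. \<Sum>j<Suc n. N i j * u i * u j)"
      unfolding expand us using a by (simp add: u_def field_simps power2_eq_square)
    also have "\<dots> > 0"
      by (rule Suc.prems(2)) (use v in \<open>auto simp: u_def\<close>)
    finally show "0 < (\<Sum>i<n. \<Sum>j<n. N' i j * v i * v j)" .
  qed
  then obtain L where L: "\<And>i j. i < n \<Longrightarrow> j < n \<Longrightarrow> N' i j = (\<Sum>k<n. L k i * L k j)"
    by blast
  define L' where "L' k i = (if k < n then if i < n then L k i else 0 else N i n / sqrt a)" for k i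
  have "N i j = (\<Sum>k<Suc n. L' k i * L' k j)" if ij: "i < Suc n" "j < Suc n" for i j
  proof -
    have sq: "N i n / sqrt a * (N j n / sqrt a) = N i n * N j n / a"
      using a by simp
    have "(\<Sum>k<Suc n. L' k i * L' k j) = (\<Sum>k<n. L' k i * L' k j) + N i n * N j n / a"
      using sq by (simp add: L'_def)
    moreover have "(\<Sum>k<n. L' k i * L' k j) = (if i < n \<and> j < n then N' i j else 0)"
      using L[of i j] by (auto simp: L'_def)
    ultimately show ?thesis
      using ij a Suc.prems(1)[of i j] by (auto simp: N'_def a_def less_Suc_eq)
  qed
  then show ?case
    by blast
qed simp

lemma quad_form_sum:
  fixes N :: "real mat"
  assumes "N \<in> carrier_mat m m" "u \<in> carrier_vec m" "v \<in> carrier_vec m"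
  shows "u \<bullet> (N *\<^sub>v v) = (\<Sum>i<m. \<Sum>j<m. N $$ (i, j) * u $ i * v $ j)"
proof -
  have "u \<bullet> (N *\<^sub>v v) = (\<Sum>i<m. u $ i * (N *\<^sub>v v) $ i)"
    using assms by (simp add: scalar_prod_def atLeast0LessThan)
  also have "\<dots> = (\<Sum>i<m. \<Sum>j<m. N $$ (i, j) * u $ i * v $ j)"
  proof (rule sum.cong[OF refl])
    fix i assume "i \<in> {..<m}"
    then have "i < m" by simp
    then show "u $ i * (N *\<^sub>v v) $ i = (\<Sum>j<m. N $$ (i, j) * u $ i * v $ j)"
      unfolding mult_mat_vec_sum[OF assms(1) \<open>i < m\<close> assms(3)] sum_distrib_left
      by (intro sum.cong) (auto simp: mult_ac)
  qed
  finally show ?thesis .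
qed

lemma mat_adjoint_real: "mat_adjoint (A :: real mat) = transpose_mat A"
  unfolding mat_adjoint_def by (intro eq_matI) (auto simp: mat_of_rows_def)

lemma pos_def_real:
  assumes "pos_def (A :: real mat)" "A \<in> carrier_mat n n"
  shows "transpose_mat A = A" "v \<in> carrier_vec n \<Longrightarrow> v \<noteq> 0\<^sub>v n \<Longrightarrow> 0 < v \<bullet> (A *\<^sub>v v)"
    "v \<in> carrier_vec n \<Longrightarrow> 0 \<le> v \<bullet> (A *\<^sub>v v)"
proof -
  show "transpose_mat A = A"
    using assms(1) by (simp add: pos_def_def mat_adjoint_real)
  have conj: "conjugate v = v" for v :: "real vec"
    by (intro eq_vecI) auto
  show pos: "0 < v \<bullet> (A *\<^sub>v v)" if "v \<in> carrier_vec n" "v \<noteq> 0\<^sub>v n" for v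
  proof -
    have "0 < (A *\<^sub>v v) \<bullet> conjugate v"
      using assms that unfolding pos_def_def by auto
    moreover have "(A *\<^sub>v v) \<bullet> v = v \<bullet> (A *\<^sub>v v)"
      using assms(2) that(1) by (intro comm_scalar_prod[of _ n]) auto
    ultimately show ?thesis
      by (simp add: conj)
  qed
  show "0 \<le> v \<bullet> (A *\<^sub>v v)" if "v \<in> carrier_vec n" for v
    using pos[OF that] assms(2) that by (cases "v = 0\<^sub>v n") auto
qed

text \<open>The factorization \<open>N = L\<^sup>T L\<close> splits the form of \<open>N\<close> into scalar products of single components.\<close>

lemma pos_def_factorization:
  assumes pd: "pos_def (N :: real mat)" and N: "N \<in> carrier_mat m m"
  shows "\<exists>L. \<forall>u\<in>carrier_vec m. \<forall>v\<in>carrier_vec m.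
    u \<bullet> (N *\<^sub>v v) = (\<Sum>k<m. (\<Sum>i<m. L k i * u $ i) * (\<Sum>j<m. L k j * v $ j))"
proof -
  note P = pos_def_real[OF pd N]
  have "\<exists>L. \<forall>i<m. \<forall>j<m. N $$ (i, j) = (\<Sum>k<m. L k i * L k j)"
  proof (rule cholesky)
    show "N $$ (i, j) = N $$ (j, i)" if "i < m" "j < m" for i j
      using arg_cong[OF P(1), of "\<lambda>M. M $$ (i, j)"] N that by simp
    fix v :: "nat \<Rightarrow> real" assume "\<exists>i<m. v i \<noteq> 0"
    then have "vec m v \<noteq> 0\<^sub>v m"
      by (metis index_vec index_zero_vec(1))
    then show "0 < (\<Sum>i<m. \<Sum>j<m. N $$ (i, j) * v i * v j)"
      using P(2)[of "vec m v"] quad_form_sum[OF N, of "vec m v" "vec m v"] by simp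
  qed
  then obtain L where L: "\<And>i j. i < m \<Longrightarrow> j < m \<Longrightarrow> N $$ (i, j) = (\<Sum>k<m. L k i * L k j)"
    by blast
  have "u \<bullet> (N *\<^sub>v v) = (\<Sum>k<m. (\<Sum>i<m. L k i * u $ i) * (\<Sum>j<m. L k j * v $ j))"
    if "u \<in> carrier_vec m" "v \<in> carrier_vec m" for u v
  proof -
    have "u \<bullet> (N *\<^sub>v v) = (\<Sum>i<m. \<Sum>j<m. \<Sum>k<m. (L k i * u $ i) * (L k j * v $ j))"
      unfolding quad_form_sum[OF N that]
      by (intro sum.cong refl) (simp only: L lessThan_iff sum_distrib_right, simp only: mult_ac)
    also have "\<dots> = (\<Sum>i<m. \<Sum>k<m. \<Sum>j<m. (L k i * u $ i) * (L k j * v $ j))"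
      by (intro sum.cong[OF refl] sum.swap)
    also have "\<dots> = (\<Sum>k<m. \<Sum>i<m. \<Sum>j<m. (L k i * u $ i) * (L k j * v $ j))"
      by (rule sum.swap)
    finally show ?thesis
      by (simp only: sum_product)
  qed
  then show ?thesis
    by blast
qed

text \<open>The form of \<open>P\<^sub>0 \<otimes> \<beta>\<close> at \<open>(a, b)\<close>, where \<open>P\<^sub>0\<close> has the rows \<open>(q, s)\<close> and \<open>(s, r)\<close> and \<open>\<beta>\<close> is a symmetric
  bilinear form.\<close>

definition kronecker_form :: "real \<Rightarrow> real \<Rightarrow> real \<Rightarrow> (real vec \<Rightarrow> real vec \<Rightarrow> real) \<Rightarrow> real vec \<Rightarrow> real vec \<Rightarrow> real" where
  "kronecker_form q s r \<beta> a b = q * \<beta> a a + 2 * s * \<beta> a b + r * \<beta> b b"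

text \<open>Both filter states are polynomials in \<open>J\<close> applied to auxiliary signals \<open>F1\<close> and \<open>F2\<close>. These are again related
  by \<open>\<delta>\<close>, because the common factor \<open>rev_char_poly\<close> can be cancelled; hence \<open>p(J) F1\<close> and \<open>p(J) F2\<close> are as
  well, for every polynomial \<open>p\<close>. The components of \<open>L v1\<close> and \<open>L v2\<close> have this form with the same \<open>p\<close>.\<close>

lemma filtered_iqc:
  assumes w\<Delta>: "w \<in> Delta_dy P\<^sub>0 z" and P\<^sub>0: "P\<^sub>0 = mat_of_rows_list 2 [[q, s], [s, r]]" and r: "r \<le> 0"
    and z: "pwc z" and w: "pwc w" and A: "A \<in> carrier_mat n n" and B: "B \<in> carrier_mat n 1"
  obtains \<xi>1 \<xi>2 where
    "state_trajectory n \<xi>1 (\<lambda>t. A *\<^sub>v \<xi>1 t + B *\<^sub>v scalar_vec (z t))" "\<xi>1 0 = 0\<^sub>v n"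
    "state_trajectory n \<xi>2 (\<lambda>t. A *\<^sub>v \<xi>2 t + B *\<^sub>v scalar_vec (w t))" "\<xi>2 0 = 0\<^sub>v n"
    "\<forall>N \<in> carrier_mat (n + 1) (n + 1). \<forall>T. pos_def N \<longrightarrow>
      0 \<le> integ (\<lambda>t. kronecker_form q s r (\<lambda>a b. a \<bullet> (N *\<^sub>v b))
        (\<xi>1 t @\<^sub>v scalar_vec (z t)) (\<xi>2 t @\<^sub>v scalar_vec (w t))) T"
proof -
  obtain \<delta> where stable: "tf_stable \<delta>" and out: "tf_output \<delta> z w"
    and pd: "\<And>H. H \<in> imag_axis_values (mat_of_rows_list 1 [[1], [\<delta>]]) \<Longrightarrow>
      pos_def (mat_adjoint H * map_mat of_real P\<^sub>0 * H)"
    using w\<Delta> unfolding Delta_dy_def by blast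
  obtain f1 \<xi>1 where f1: "pwc f1" "act (cpoly (rev_char_poly A)) (\<lambda>t. of_real (f1 t)) = ccausal z"
    and \<xi>1: "state_trajectory n \<xi>1 (\<lambda>t. A *\<^sub>v \<xi>1 t + B *\<^sub>v scalar_vec (z t))" "\<xi>1 0 = 0\<^sub>v n"
      "\<And>i t. i < n \<Longrightarrow> of_real (\<xi>1 t $ i) = act (cpoly (resolvent A B i)) (\<lambda>t. of_real (f1 t)) t"
    using linear_system_trajectory[OF A B z] by blast
  obtain f2 \<xi>2 where f2: "pwc f2" "act (cpoly (rev_char_poly A)) (\<lambda>t. of_real (f2 t)) = ccausal w"
    and \<xi>2: "state_trajectory n \<xi>2 (\<lambda>t. A *\<^sub>v \<xi>2 t + B *\<^sub>v scalar_vec (w t))" "\<xi>2 0 = 0\<^sub>v n"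
      "\<And>i t. i < n \<Longrightarrow> of_real (\<xi>2 t $ i) = act (cpoly (resolvent A B i)) (\<lambda>t. of_real (f2 t)) t"
    using linear_system_trajectory[OF A B w] by blast
  define F1 F2 where "F1 = (\<lambda>t. complex_of_real (f1 t))" and "F2 = (\<lambda>t. complex_of_real (f2 t))"
  have pF: "pwc F1" "pwc F2"
    unfolding F1_def F2_def by (intro pwc_of_real f1 f2)+
  let ?\<chi> = "cpoly (rev_char_poly A)"
  have \<chi>F: "act ?\<chi> F1 = ccausal z" "act ?\<chi> F2 = ccausal w"
    unfolding F1_def F2_def by (rule f1 f2)+
  define m where "m = degree (tf_den \<delta>)"
  define d nn where "d = cpoly (tf_den \<delta>)" and "nn = cpoly (tf_num \<delta>)"
  have deg: "degree (tf_num \<delta>) \<le> m"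
    using stable by (simp add: tf_stable_def tf_proper_def m_def)
  have degree_cpoly: "degree (cpoly p) = degree p" for p
    by (rule degree_map_poly) simp
  have d: "degree d = m" "lead_coeff d = 1" "degree nn \<le> m"
    using tf_den_monic[of \<delta>] deg by (simp_all add: d_def nn_def degree_cpoly m_def coeff_map_poly)
  have hurwitz: "Re y < 0" if "poly d y = 0" for y
    using stable that by (auto simp: tf_stable_def tf_poles_def d_def)
  have io: "act (reversal m d) F2 = act (reversal m nn) F1"
  proof
    fix t :: real
    have "act ?\<chi> (act (reversal m d) F2) = act ?\<chi> (act (reversal m nn) F1)"
      unfolding act_commute[OF pF(1), of ?\<chi>] act_commute[OF pF(2), of ?\<chi>] \<chi>F d_def nn_def
      by (rule tf_output_act[OF out z deg]) (simp add: m_def)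
    then show "act (reversal m d) F2 t = act (reversal m nn) F1 t"
      by (intro act_injective_eq[OF poly_cpoly_0[OF rev_char_poly_0[OF A]] pwc_act[OF pF(2)] pwc_act[OF pF(1)],
          where T = "t + 1"]) simp_all
  qed
  have scalar: "0 \<le> integ (\<lambda>t. q * (cmod (act p F1 t))\<^sup>2 +
      2 * s * Re (act p F1 t * cnj (act p F2 t)) + r * (cmod (act p F2 t))\<^sup>2) T" for p T
  proof (rule hard_iqc[OF d(1,2) hurwitz d(3) r])
    show "0 < q * (cmod (poly d (\<i> * of_real \<omega>)))\<^sup>2 +
        2 * s * Re (poly d (\<i> * of_real \<omega>) * cnj (poly nn (\<i> * of_real \<omega>))) +
        r * (cmod (poly nn (\<i> * of_real \<omega>)))\<^sup>2" for \<omega>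
      unfolding d_def nn_def by (rule uncertainty_fdi[OF stable P\<^sub>0 pd])
    show "act (reversal m d) (act p F2) = act (reversal m nn) (act p F1)"
      unfolding act_commute[OF pF(2), of _ p] act_commute[OF pF(1), of _ p] io ..
  qed (use pF in auto)
  have "0 \<le> integ (\<lambda>t. kronecker_form q s r (\<lambda>a b. a \<bullet> (N *\<^sub>v b))
        (\<xi>1 t @\<^sub>v scalar_vec (z t)) (\<xi>2 t @\<^sub>v scalar_vec (w t))) T"
    if N: "pos_def N" "N \<in> carrier_mat (n + 1) (n + 1)" for N T
  proof -
    obtain L where L: "\<And>u v. u \<in> carrier_vec (n + 1) \<Longrightarrow> v \<in> carrier_vec (n + 1) \<Longrightarrow>
        u \<bullet> (N *\<^sub>v v) = (\<Sum>k<n + 1. (\<Sum>i<n + 1. L k i * u $ i) * (\<Sum>j<n + 1. L k j * v $ j))"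
      using pos_def_factorization[OF N] by blast
    \<comment> \<open>\<open>p k\<close> generates the component \<open>k\<close> of \<open>L v1\<close> from \<open>F1\<close>, and that of \<open>L v2\<close> from \<open>F2\<close>\<close>
    define p where "p k = (\<Sum>j<n. smult (of_real (L k j)) (cpoly (resolvent A B j))) + smult (of_real (L k n)) ?\<chi>" for k
    have V: "act (p k) F t = of_real (\<Sum>i<n + 1. L k i * (y @\<^sub>v scalar_vec (u t)) $ i)"
      if "pwc F" "act ?\<chi> F = ccausal u" "y \<in> carrier_vec n"
        "\<And>i. i < n \<Longrightarrow> of_real (y $ i) = act (cpoly (resolvent A B i)) F t" "0 \<le> t" for F u y k t
    proof -
      have "act (p k) F t = (\<Sum>j<n. of_real (L k j) * of_real (y $ j)) + of_real (L k n) * of_real (u t)"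
        unfolding p_def act_add_poly[OF that(1)] act_sum_poly[OF that(1)] act_smult that(2)
        using that(4,5) by simp
      also have "\<dots> = of_real (\<Sum>i<n + 1. L k i * (y @\<^sub>v scalar_vec (u t)) $ i)"
        using that(3) by simp
      finally show ?thesis .
    qed
    let ?I = "\<lambda>k t. q * (cmod (act (p k) F1 t))\<^sup>2 + 2 * s * Re (act (p k) F1 t * cnj (act (p k) F2 t)) +
        r * (cmod (act (p k) F2 t))\<^sup>2"
    have pI: "pwc (?I k)" for k
      unfolding power2_eq_square
      by (intro pwc_add pwc_mult pwc_const pwc_Re pwc_cnj pwc_act pF
          pwc_map[of cmod, OF continuous_on_norm[OF continuous_on_id]])
    have "kronecker_form q s r (\<lambda>a b. a \<bullet> (N *\<^sub>v b)) (\<xi>1 t @\<^sub>v scalar_vec (z t)) (\<xi>2 t @\<^sub>v scalar_vec (w t)) =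
        (\<Sum>k<n + 1. ?I k t)" if t: "0 \<le> t" for t
    proof -
      have c: "\<xi>1 t \<in> carrier_vec n" "\<xi>2 t \<in> carrier_vec n"
        using \<xi>1(1) \<xi>2(1) t by (auto simp: state_trajectory_def)
      have c': "\<xi>1 t @\<^sub>v scalar_vec (z t) \<in> carrier_vec (n + 1)" "\<xi>2 t @\<^sub>v scalar_vec (w t) \<in> carrier_vec (n + 1)"
        by (rule append_carrier_vec[OF c(1) dim_scalar_vec(1)] append_carrier_vec[OF c(2) dim_scalar_vec(1)])+
      have V1: "act (p k) F1 t = of_real (\<Sum>i<n + 1. L k i * (\<xi>1 t @\<^sub>v scalar_vec (z t)) $ i)" for k
        by (rule V[OF pF(1) \<chi>F(1) c(1) _ t]) (simp add: \<xi>1(3) F1_def)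
      have V2: "act (p k) F2 t = of_real (\<Sum>i<n + 1. L k i * (\<xi>2 t @\<^sub>v scalar_vec (w t)) $ i)" for k
        by (rule V[OF pF(2) \<chi>F(2) c(2) _ t]) (simp add: \<xi>2(3) F2_def)
      have "Re (of_real a * cnj (of_real b)) = a * b" "(cmod (of_real a))\<^sup>2 = a * a" for a b
        by (simp_all add: power2_eq_square)
      then show ?thesis
        unfolding kronecker_form_def V1 V2 L[OF c'(1) c'(1)] L[OF c'(1) c'(2)] L[OF c'(2) c'(2)]
        by (simp only: sum.distrib sum_distrib_left mult.assoc)
    qed
    then have "integ (\<lambda>t. kronecker_form q s r (\<lambda>a b. a \<bullet> (N *\<^sub>v b))
        (\<xi>1 t @\<^sub>v scalar_vec (z t)) (\<xi>2 t @\<^sub>v scalar_vec (w t))) T = integ (\<lambda>t. \<Sum>k<n + 1. ?I k t) T"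
      by (intro integ_cong)
    also have "\<dots> = (\<Sum>k<n + 1. integ (?I k) T)"
      by (rule fun_cong[OF integ_sum[OF pI]])
    also have "\<dots> \<ge> 0"
      by (intro sum_nonneg scalar)
    finally show ?thesis .
  qed
  then show ?thesis
    using that \<xi>1(1,2) \<xi>2(1,2) by blast
qed

section \<open>Quadratic forms along trajectories\<close>

lemma vec_signalsD:
  assumes "u \<in> vec_signals n"
  shows "0 \<le> t \<Longrightarrow> u t \<in> carrier_vec n" "i < n \<Longrightarrow> pwc (\<lambda>t. u t $ i)"
  using assms by (auto simp: vec_signals_def signals_iff_pwc)

lemma vec_signalsI:
  assumes "\<And>t. 0 \<le> t \<Longrightarrow> u t \<in> carrier_vec n" "\<And>i. i < n \<Longrightarrow> pwc (\<lambda>t. u t $ i)"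
  shows "u \<in> vec_signals n"
  using assms by (auto simp: vec_signals_def signals_iff_pwc)

lemma vec_signals_append:
  assumes u: "u \<in> vec_signals n" and v: "v \<in> vec_signals m"
  shows "(\<lambda>t. u t @\<^sub>v v t) \<in> vec_signals (n + m)"
proof (rule vec_signalsI)
  have dim: "dim_vec (u t) = n" "dim_vec (v t) = m" if "0 \<le> t" for t
    using vec_signalsD(1)[OF u that] vec_signalsD(1)[OF v that] by auto
  show "u t @\<^sub>v v t \<in> carrier_vec (n + m)" if "0 \<le> t" for t
    by (rule append_carrier_vec[OF vec_signalsD(1)[OF u that] vec_signalsD(1)[OF v that]])
  show "pwc (\<lambda>t. (u t @\<^sub>v v t) $ i)" if i: "i < n + m" for i
  proof (cases "i < n")
    case True
    show ?thesis
      by (rule pwc_cong[OF _ vec_signalsD(2)[OF u True]])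
         (use dim True in simp)
  next
    case False
    then have "i - n < m"
      using i by simp
    show ?thesis
      by (rule pwc_cong[OF _ vec_signalsD(2)[OF v \<open>i - n < m\<close>]])
         (use dim False i in simp)
  qed
qed

lemma scalar_vec_signals: "pwc z \<Longrightarrow> (\<lambda>t. scalar_vec (z t)) \<in> vec_signals 1"
  by (rule vec_signalsI) (simp_all add: scalar_vec_def)

lemma pwc_bilinear:
  assumes N: "(N :: real mat) \<in> carrier_mat m m" and u: "u \<in> vec_signals m" and v: "v \<in> vec_signals m"
  shows "pwc (\<lambda>t. u t \<bullet> (N *\<^sub>v v t))"
proof (rule pwc_cong)
  show "pwc (\<lambda>t. \<Sum>i<m. \<Sum>j<m. N $$ (i, j) * u t $ i * v t $ j)"
    by (intro pwc_sum pwc_mult pwc_const vec_signalsD(2)[OF u] vec_signalsD(2)[OF v]) auto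
  show "(\<Sum>i<m. \<Sum>j<m. N $$ (i, j) * u t $ i * v t $ j) = u t \<bullet> (N *\<^sub>v v t)" if "0 \<le> t" for t
    by (rule quad_form_sum[OF N vec_signalsD(1)[OF u that] vec_signalsD(1)[OF v that], symmetric])
qed

text \<open>The integrated form of \<^const>\<open>state_trajectory\<close>. It passes to concatenated states without any reference
  to derivatives.\<close>

definition integral_trajectory :: "nat \<Rightarrow> (real \<Rightarrow> real vec) \<Rightarrow> (real \<Rightarrow> real vec) \<Rightarrow> bool" where
  "integral_trajectory n x v \<longleftrightarrow> x \<in> vec_signals n \<and> v \<in> vec_signals n \<and>
     (\<forall>i<n. \<forall>t\<ge>0. x t $ i = x 0 $ i + integ (\<lambda>t. v t $ i) t)"

lemma state_trajectory_imp_integral_trajectory: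
  assumes "state_trajectory n x v"
  shows "integral_trajectory n x v"
  unfolding integral_trajectory_def
proof (intro conjI allI impI)
  show "x \<in> vec_signals n"
    using assms state_trajectory_integ(3)[OF assms _ order_refl]
    by (intro vec_signalsI) (auto simp: state_trajectory_def)
  show "v \<in> vec_signals n"
    using assms by (simp add: state_trajectory_def)
  show "x t $ i = x 0 $ i + integ (\<lambda>t. v t $ i) t" if "i < n" "0 \<le> t" for i t
    using state_trajectory_integ(1)[OF assms that] by simp
qed

lemma integral_trajectory_append:
  assumes x: "integral_trajectory n x v" and y: "integral_trajectory m y u"
  shows "integral_trajectory (n + m) (\<lambda>t. x t @\<^sub>v y t) (\<lambda>t. v t @\<^sub>v u t)"
proof -
  have s: "x \<in> vec_signals n" "v \<in> vec_signals n" "y \<in> vec_signals m" "u \<in> vec_signals m"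
    and X: "\<And>i t. i < n \<Longrightarrow> 0 \<le> t \<Longrightarrow> x t $ i = x 0 $ i + integ (\<lambda>t. v t $ i) t"
    and Y: "\<And>i t. i < m \<Longrightarrow> 0 \<le> t \<Longrightarrow> y t $ i = y 0 $ i + integ (\<lambda>t. u t $ i) t"
    using x y unfolding integral_trajectory_def by blast+
  have dim: "dim_vec (x t) = n" "dim_vec (v t) = n" "dim_vec (y t) = m" "dim_vec (u t) = m" if "0 \<le> t" for t
    using s[THEN vec_signalsD(1)] that by auto
  have "(x t @\<^sub>v y t) $ i = (x 0 @\<^sub>v y 0) $ i + integ (\<lambda>t. (v t @\<^sub>v u t) $ i) t"
    if i: "i < n + m" and t: "0 \<le> t" for i t
  proof (cases "i < n")
    case True
    have "integ (\<lambda>t. (v t @\<^sub>v u t) $ i) t = integ (\<lambda>t. v t $ i) t"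
      by (rule integ_cong) (use True dim in simp)
    then show ?thesis
      using X[OF True t] True dim t by simp
  next
    case False
    have "integ (\<lambda>t. (v t @\<^sub>v u t) $ i) t = integ (\<lambda>t. u t $ (i - n)) t"
      by (rule integ_cong) (use False i dim in simp)
    then show ?thesis
      using Y[of "i - n" t] False i dim t by simp
  qed
  then show ?thesis
    unfolding integral_trajectory_def using vec_signals_append[OF s(1,3)] vec_signals_append[OF s(2,4)] by blast
qed

lemma quad_form_along_trajectory:
  assumes x: "integral_trajectory n x v" and Y: "Y \<in> carrier_mat n n" and T: "0 \<le> T"
  shows "integ (\<lambda>t. v t \<bullet> (Y *\<^sub>v x t) + x t \<bullet> (Y *\<^sub>v v t)) T = quad_form Y (x T) - quad_form Y (x 0)"
proof -
  have s: "x \<in> vec_signals n" "v \<in> vec_signals n"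
    and X: "\<And>i t. i < n \<Longrightarrow> 0 \<le> t \<Longrightarrow> x t $ i = x 0 $ i + integ (\<lambda>t. v t $ i) t"
    using x unfolding integral_trajectory_def by blast+
  define g where "g i = (\<lambda>t. x 0 $ i + integ (\<lambda>t. v t $ i) t)" for i
  have pv: "pwc (\<lambda>t. v t $ i)" if "i < n" for i
    by (rule vec_signalsD(2)[OF s(2) that])
  have g: "continuous_on {0..} (g i)" "pwc (g i)" if "i < n" for i
  proof -
    show "continuous_on {0..} (g i)"
      unfolding g_def by (intro continuous_intros continuous_on_integ pv that)
    then show "pwc (g i)"
      by (rule pwc_continuous_on)
  qed
  have dg: "(g i has_vector_derivative v t $ i) (at_right t)" if "i < n" "0 \<le> t" for i t
    unfolding g_def using integ_right_derivative[OF pv[OF that(1)] that(2)]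
    by (auto intro!: derivative_eq_intros)
  have xg: "x t $ i = g i t" if "i < n" "0 \<le> t" for i t
    using X[OF that] by (simp add: g_def)
  have Q: "quad_form Y (x t) = (\<Sum>i<n. \<Sum>j<n. Y $$ (i, j) * (g i t * g j t))" if "0 \<le> t" for t
    unfolding quad_form_def quad_form_sum[OF Y vec_signalsD(1)[OF s(1) that] vec_signalsD(1)[OF s(1) that]]
    by (intro sum.cong refl) (simp add: xg that)
  have "v t \<bullet> (Y *\<^sub>v x t) + x t \<bullet> (Y *\<^sub>v v t) =
      (\<Sum>i<n. \<Sum>j<n. Y $$ (i, j) * (g i t * v t $ j + v t $ i * g j t))" if t: "0 \<le> t" for t
    unfolding quad_form_sum[OF Y vec_signalsD(1)[OF s(1) t] vec_signalsD(1)[OF s(2) t]]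
      quad_form_sum[OF Y vec_signalsD(1)[OF s(2) t] vec_signalsD(1)[OF s(1) t]] sum.distrib[symmetric]
    by (intro sum.cong refl) (simp add: xg t algebra_simps)
  then have "integ (\<lambda>t. v t \<bullet> (Y *\<^sub>v x t) + x t \<bullet> (Y *\<^sub>v v t)) T =
      integ (\<lambda>t. \<Sum>i<n. \<Sum>j<n. Y $$ (i, j) * (g i t * v t $ j + v t $ i * g j t)) T"
    by (intro integ_cong)
  also have "\<dots> = (\<Sum>i<n. integ (\<lambda>t. \<Sum>j<n. Y $$ (i, j) * (g i t * v t $ j + v t $ i * g j t)) T)"
    by (rule fun_cong[OF integ_sum]) (auto intro!: pwc_sum pwc_mult pwc_add g pv)
  also have "\<dots> = (\<Sum>i<n. \<Sum>j<n. Y $$ (i, j) * (g i T * g j T - g i 0 * g j 0))"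
  proof (rule sum.cong[OF refl])
    fix i assume i: "i \<in> {..<n}"
    have "integ (\<lambda>t. \<Sum>j<n. Y $$ (i, j) * (g i t * v t $ j + v t $ i * g j t)) T =
        (\<Sum>j<n. integ (\<lambda>t. Y $$ (i, j) * (g i t * v t $ j + v t $ i * g j t)) T)"
      by (rule fun_cong[OF integ_sum]) (use i in \<open>auto intro!: pwc_mult pwc_add g pv\<close>)
    also have "\<dots> = (\<Sum>j<n. Y $$ (i, j) * (g i T * g j T - g i 0 * g j 0))"
    proof (rule sum.cong[OF refl])
      fix j assume j: "j \<in> {..<n}"
      have "integ (\<lambda>t. g i t * v t $ j + v t $ i * g j t) T = g i T * g j T - g i 0 * g j 0"
        using i j T by (intro integ_product_rule g dg pv) auto
      then show "integ (\<lambda>t. Y $$ (i, j) * (g i t * v t $ j + v t $ i * g j t)) T =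
          Y $$ (i, j) * (g i T * g j T - g i 0 * g j 0)"
        by (simp only: integ_mult)
    qed
    finally show "integ (\<lambda>t. \<Sum>j<n. Y $$ (i, j) * (g i t * v t $ j + v t $ i * g j t)) T =
        (\<Sum>j<n. Y $$ (i, j) * (g i T * g j T - g i 0 * g j 0))" .
  qed
  also have "\<dots> = quad_form Y (x T) - quad_form Y (x 0)"
    unfolding Q[OF T] Q[OF order_refl] by (simp add: right_diff_distrib sum_subtractf)
  finally show ?thesis .
qed

section \<open>Block matrices\<close>

lemma bilinear_sandwich:
  assumes F: "(F :: real mat) \<in> carrier_mat a b" and P: "P \<in> carrier_mat a a"
    and u: "u \<in> carrier_vec b" and v: "v \<in> carrier_vec b"
  shows "u \<bullet> ((transpose_mat F * P * F) *\<^sub>v v) = (F *\<^sub>v u) \<bullet> (P *\<^sub>v (F *\<^sub>v v))"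
proof -
  let ?w = "P *\<^sub>v (F *\<^sub>v v)"
  have FT: "transpose_mat F \<in> carrier_mat b a" and w: "?w \<in> carrier_vec a"
    using F P v by auto
  have "(transpose_mat F * P * F) *\<^sub>v v = (transpose_mat F * P) *\<^sub>v (F *\<^sub>v v)"
    by (rule assoc_mult_mat_vec[OF mult_carrier_mat[OF FT P] F v])
  also have "\<dots> = transpose_mat F *\<^sub>v ?w"
    by (rule assoc_mult_mat_vec[OF FT P mult_mat_vec_carrier[OF F v]])
  finally have "u \<bullet> ((transpose_mat F * P * F) *\<^sub>v v) = u \<bullet> (transpose_mat F *\<^sub>v ?w)"
    by simp
  also have "\<dots> = (transpose_mat F *\<^sub>v ?w) \<bullet> u"
    by (rule comm_scalar_prod[OF u mult_mat_vec_carrier[OF FT w]])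
  also have "\<dots> = ?w \<bullet> (F *\<^sub>v u)"
    by (rule transpose_vec_mult_scalar[OF F u w])
  also have "\<dots> = (F *\<^sub>v u) \<bullet> ?w"
    by (rule comm_scalar_prod[OF w mult_mat_vec_carrier[OF F u]])
  finally show ?thesis .
qed

lemma zero_mat_mult_vec [simp]: "v \<in> carrier_vec m \<Longrightarrow> (0\<^sub>m n m :: real mat) *\<^sub>v v = 0\<^sub>v n"
  by (intro eq_vecI) auto

lemma mat_mult_zero_vec [simp]: "A \<in> carrier_mat n m \<Longrightarrow> (A :: real mat) *\<^sub>v 0\<^sub>v m = 0\<^sub>v n"
  by (intro eq_vecI) auto

lemma bilinear_four_block:
  assumes "(A :: real mat) \<in> carrier_mat n n" "B \<in> carrier_mat n m" "C \<in> carrier_mat m n" "D \<in> carrier_mat m m"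
    and "a \<in> carrier_vec n" "b \<in> carrier_vec m" "c \<in> carrier_vec n" "d \<in> carrier_vec m"
  shows "(a @\<^sub>v b) \<bullet> (four_block_mat A B C D *\<^sub>v (c @\<^sub>v d)) =
    a \<bullet> (A *\<^sub>v c) + a \<bullet> (B *\<^sub>v d) + b \<bullet> (C *\<^sub>v c) + b \<bullet> (D *\<^sub>v d)"
proof -
  have "(a @\<^sub>v b) \<bullet> (four_block_mat A B C D *\<^sub>v (c @\<^sub>v d)) =
      a \<bullet> (A *\<^sub>v c + B *\<^sub>v d) + b \<bullet> (C *\<^sub>v c + D *\<^sub>v d)"
    unfolding four_block_mat_mult_vec[OF assms(1-4,7,8)]
    using assms by (intro scalar_prod_append[of _ n _ m]) auto
  then show ?thesis
    using assms by (simp add: scalar_prod_add_distrib[of _ n] scalar_prod_add_distrib[of _ m])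
qed

lemma append_cols_carrier [simp]:
  "A \<in> carrier_mat r n \<Longrightarrow> B \<in> carrier_mat r m \<Longrightarrow> A @\<^sub>c B \<in> carrier_mat r (n + m)"
  by (auto simp: append_cols_def)

lemma append_cols_mult_vec:
  assumes "(A :: real mat) \<in> carrier_mat r n" "B \<in> carrier_mat r m" "a \<in> carrier_vec n" "b \<in> carrier_vec m"
  shows "(A @\<^sub>c B) *\<^sub>v (a @\<^sub>v b) = A *\<^sub>v a + B *\<^sub>v b"
proof -
  have "dim_col A = n" "dim_col B = m"
    using assms by auto
  then have "(A @\<^sub>c B) *\<^sub>v (a @\<^sub>v b) = (A *\<^sub>v a + B *\<^sub>v b) @\<^sub>v (0\<^sub>m 0 n *\<^sub>v a + 0\<^sub>m 0 m *\<^sub>v b)"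
    unfolding append_cols_def
    by (simp only: four_block_mat_mult_vec[OF assms(1,2) zero_carrier_mat zero_carrier_mat assms(3,4)])
  also have "\<dots> = A *\<^sub>v a + B *\<^sub>v b"
    by (intro eq_vecI) auto
  finally show ?thesis .
qed

lemma kyp_form_carrier [simp]:
  "A \<in> carrier_mat n n \<Longrightarrow> B \<in> carrier_mat n m \<Longrightarrow> X \<in> carrier_mat n n \<Longrightarrow> kyp_form A B X \<in> carrier_mat (n + m) (n + m)"
  by (auto simp: kyp_form_def Let_def)

lemma bilinear_kyp_form:
  assumes A: "A \<in> carrier_mat n n" and B: "B \<in> carrier_mat n m" and X: "X \<in> carrier_mat n n"
    and a: "a \<in> carrier_vec n" and c: "c \<in> carrier_vec m" and b: "b \<in> carrier_vec n" and d: "d \<in> carrier_vec m"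
  shows "(a @\<^sub>v c) \<bullet> (kyp_form A B X *\<^sub>v (b @\<^sub>v d)) =
    (A *\<^sub>v a + B *\<^sub>v c) \<bullet> (X *\<^sub>v b) + a \<bullet> (X *\<^sub>v (A *\<^sub>v b + B *\<^sub>v d))"
proof -
  let ?F = "four_block_mat A B (1\<^sub>m n) (0\<^sub>m n m)" and ?X = "four_block_mat (0\<^sub>m n n) X X (0\<^sub>m n n)"
  have F: "?F \<in> carrier_mat (n + n) (n + m)" and X2: "?X \<in> carrier_mat (n + n) (n + n)"
    using A B X by auto
  have Fv: "?F *\<^sub>v (a @\<^sub>v c) = (A *\<^sub>v a + B *\<^sub>v c) @\<^sub>v a" if "a \<in> carrier_vec n" "c \<in> carrier_vec m" for a c
    using four_block_mat_mult_vec[OF A B one_carrier_mat zero_carrier_mat that] that by simp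
  have "(a @\<^sub>v c) \<bullet> (kyp_form A B X *\<^sub>v (b @\<^sub>v d)) = (?F *\<^sub>v (a @\<^sub>v c)) \<bullet> (?X *\<^sub>v (?F *\<^sub>v (b @\<^sub>v d)))"
  proof -
    have "kyp_form A B X = transpose_mat ?F * ?X * ?F"
      using A B by (simp add: kyp_form_def Let_def)
    then show ?thesis
      using bilinear_sandwich[OF F X2 append_carrier_vec[OF a c] append_carrier_vec[OF b d]] by simp
  qed
  also have "\<dots> = (A *\<^sub>v a + B *\<^sub>v c) \<bullet> (X *\<^sub>v b) + a \<bullet> (X *\<^sub>v (A *\<^sub>v b + B *\<^sub>v d))"
    unfolding Fv[OF a c] Fv[OF b d] using A B X a b c d
    by (subst bilinear_four_block[of _ n _ n]) auto
  finally show ?thesis .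
qed

lemma kronecker_two:
  assumes M: "(M :: real mat) \<in> carrier_mat l l" and l: "P\<^sub>0 = mat_of_rows_list 2 [[q, s], [s, r]]"
  shows "P\<^sub>0 \<otimes>\<^sub>k M = four_block_mat (q \<cdot>\<^sub>m M) (s \<cdot>\<^sub>m M) (s \<cdot>\<^sub>m M) (r \<cdot>\<^sub>m M)"
proof (rule eq_matI)
  fix i j assume ij: "i < dim_row (four_block_mat (q \<cdot>\<^sub>m M) (s \<cdot>\<^sub>m M) (s \<cdot>\<^sub>m M) (r \<cdot>\<^sub>m M))"
    "j < dim_col (four_block_mat (q \<cdot>\<^sub>m M) (s \<cdot>\<^sub>m M) (s \<cdot>\<^sub>m M) (r \<cdot>\<^sub>m M))"
  then have ij': "i < 2 * l" "j < 2 * l"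
    using M by auto
  have div: "k div l = (if k < l then 0 else 1)" "k mod l = (if k < l then k else k - l)" if "k < 2 * l" for k
    using that by (auto simp: div_if mod_if)
  show "(P\<^sub>0 \<otimes>\<^sub>k M) $$ (i, j) = four_block_mat (q \<cdot>\<^sub>m M) (s \<cdot>\<^sub>m M) (s \<cdot>\<^sub>m M) (r \<cdot>\<^sub>m M) $$ (i, j)"
    using M ij' by (auto simp: kronecker_def l mat_of_rows_list_def div)
qed (use M in \<open>auto simp: kronecker_def l mat_of_rows_list_def\<close>)

lemma bilinear_sym:
  assumes "(M :: real mat) \<in> carrier_mat l l" "transpose_mat M = M" "a \<in> carrier_vec l" "b \<in> carrier_vec l"
  shows "a \<bullet> (M *\<^sub>v b) = b \<bullet> (M *\<^sub>v a)"
  using transpose_vec_mult_scalar[OF assms(1,4,3)] assms by (simp add: comm_scalar_prod[of _ l])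

lemma bilinear_kronecker:
  assumes M: "(M :: real mat) \<in> carrier_mat l l" and P: "P\<^sub>0 = mat_of_rows_list 2 [[q, s], [s, r]]"
    and v: "a \<in> carrier_vec l" "b \<in> carrier_vec l" "c \<in> carrier_vec l" "d \<in> carrier_vec l"
  shows "(a @\<^sub>v b) \<bullet> ((P\<^sub>0 \<otimes>\<^sub>k M) *\<^sub>v (c @\<^sub>v d)) =
    q * (a \<bullet> (M *\<^sub>v c)) + s * (a \<bullet> (M *\<^sub>v d)) + s * (b \<bullet> (M *\<^sub>v c)) + r * (b \<bullet> (M *\<^sub>v d))"
proof -
  have sm: "u \<bullet> ((k \<cdot>\<^sub>m M) *\<^sub>v v) = k * (u \<bullet> (M *\<^sub>v v))" if "u \<in> carrier_vec l" "v \<in> carrier_vec l" for k u v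
    using that M by (simp add: quad_form_sum[of _ l] sum_distrib_left mult.assoc)
  show ?thesis
    unfolding kronecker_two[OF M P] using M v
    by (subst bilinear_four_block[of _ l _ l]) (auto simp: sm)
qed

text \<open>Minimization over the filter state by completing the square with \<open>g = Y\<^sup>-\<^sup>1 W x\<close>:
  the difference of both sides is the form of \<open>Y\<close> at \<open>v + g\<close>.\<close>

lemma schur_complement_le:
  assumes Y: "(Y :: real mat) \<in> carrier_mat m m" and W: "W \<in> carrier_mat m n" and X: "X \<in> carrier_mat n n"
    and pd: "pos_def (four_block_mat Y W (transpose_mat W) X)"
    and v: "v \<in> carrier_vec m" and x: "x \<in> carrier_vec n"
  shows "x \<bullet> ((X - transpose_mat W * the (mat_inverse Y) * W) *\<^sub>v x) \<le> quad_form (four_block_mat Y W (transpose_mat W) X) (v @\<^sub>v x)"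
proof -
  let ?B = "four_block_mat Y W (transpose_mat W) X" and ?V = "the (mat_inverse Y)"
  have B: "?B \<in> carrier_mat (m + n) (m + n)"
    using Y W X by auto
  note P = pos_def_real[OF pd B]
  have blk: "(a @\<^sub>v b) \<bullet> (?B *\<^sub>v (c @\<^sub>v d)) = a \<bullet> (Y *\<^sub>v c) + a \<bullet> (W *\<^sub>v d) + b \<bullet> (transpose_mat W *\<^sub>v c) + b \<bullet> (X *\<^sub>v d)"
    if "a \<in> carrier_vec m" "b \<in> carrier_vec n" "c \<in> carrier_vec m" "d \<in> carrier_vec n" for a b c d
    using Y W X that by (intro bilinear_four_block) auto
  have YB: "a \<bullet> (Y *\<^sub>v c) = (a @\<^sub>v 0\<^sub>v n) \<bullet> (?B *\<^sub>v (c @\<^sub>v 0\<^sub>v n))" if "a \<in> carrier_vec m" "c \<in> carrier_vec m" for a c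
    unfolding blk[OF that(1) zero_carrier_vec that(2) zero_carrier_vec] using that Y W X by simp
  have "det Y \<noteq> 0"
  proof
    assume "det Y = 0"
    then obtain c where c: "c \<in> carrier_vec m" "c \<noteq> 0\<^sub>v m" "Y *\<^sub>v c = 0\<^sub>v m"
      using det_0_iff_vec_prod_zero[OF Y] by blast
    have "c @\<^sub>v 0\<^sub>v n \<noteq> 0\<^sub>v (m + n)"
    proof
      assume eq: "c @\<^sub>v 0\<^sub>v n = 0\<^sub>v (m + n)"
      have "c = 0\<^sub>v m"
      proof (rule eq_vecI)
        fix i assume "i < dim_vec (0\<^sub>v m :: real vec)"
        then show "c $ i = 0\<^sub>v m $ i"
          using arg_cong[OF eq, of "\<lambda>v. v $ i"] c(1) by simp
      qed (use c(1) in simp)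
      then show False
        using c(2) by simp
    qed
    then have "0 < c \<bullet> (Y *\<^sub>v c)"
      unfolding YB[OF c(1) c(1)] using c(1) by (intro P(2)) auto
    then show False
      using c by simp
  qed
  then have V: "Y * ?V = 1\<^sub>m m" "?V \<in> carrier_mat m m"
    using mat_inverse_if_det_nonzero[OF Y] by auto
  define g where "g = ?V *\<^sub>v (W *\<^sub>v x)"
  have g: "g \<in> carrier_vec m"
    unfolding g_def using V(2) W x by (intro mult_mat_vec_carrier) auto
  have Yg: "Y *\<^sub>v g = W *\<^sub>v x"
    unfolding g_def using V Y W x
    by (subst assoc_mult_mat_vec[symmetric, of _ m m _ m]) auto
  have symY: "a \<bullet> (Y *\<^sub>v c) = c \<bullet> (Y *\<^sub>v a)" if "a \<in> carrier_vec m" "c \<in> carrier_vec m" for a c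
    unfolding YB[OF that] YB[OF that(2,1)] using that by (intro bilinear_sym[OF B P(1)]) auto
  have tW: "x \<bullet> (transpose_mat W *\<^sub>v c) = (W *\<^sub>v x) \<bullet> c" if "c \<in> carrier_vec m" for c
    using transpose_vec_mult_scalar[OF W x that] W x that
    by (simp add: comm_scalar_prod[of _ n] comm_scalar_prod[of _ m])
  have "(X - transpose_mat W * ?V * W) *\<^sub>v x = X *\<^sub>v x - transpose_mat W *\<^sub>v g"
    unfolding g_def using X V(2) W x
    by (simp add: minus_mult_distrib_mat_vec[of _ n n] assoc_mult_mat_vec[of _ n m _ n] assoc_mult_mat_vec[of _ n m _ m])
  then have "x \<bullet> ((X - transpose_mat W * ?V * W) *\<^sub>v x) = x \<bullet> (X *\<^sub>v x) - (W *\<^sub>v x) \<bullet> g"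
    using X W x g by (simp add: scalar_prod_minus_distrib[of _ n] tW)
  moreover have "quad_form ?B (v @\<^sub>v x) = v \<bullet> (Y *\<^sub>v v) + 2 * (v \<bullet> (Y *\<^sub>v g)) + x \<bullet> (X *\<^sub>v x)"
    unfolding quad_form_def blk[OF v x v x] tW[OF v] Yg[symmetric]
    using Y v g by (simp add: comm_scalar_prod[of "Y *\<^sub>v g" m v])
  moreover have "0 \<le> v \<bullet> (Y *\<^sub>v v) + 2 * (v \<bullet> (Y *\<^sub>v g)) + (W *\<^sub>v x) \<bullet> g"
  proof -
    have "0 \<le> (v + g) \<bullet> (Y *\<^sub>v (v + g))"
      using v g by (subst YB) (auto intro!: P(3))
    also have "(v + g) \<bullet> (Y *\<^sub>v (v + g)) = v \<bullet> (Y *\<^sub>v v) + v \<bullet> (Y *\<^sub>v g) + (g \<bullet> (Y *\<^sub>v v) + g \<bullet> (Y *\<^sub>v g))"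
      using v g Y by (simp add: mult_add_distrib_mat_vec[of _ m m] scalar_prod_add_distrib[of _ m] add_scalar_prod_distrib[of _ m])
    also have "g \<bullet> (Y *\<^sub>v v) = v \<bullet> (Y *\<^sub>v g)"
      by (rule symY[OF g v])
    also have "g \<bullet> (Y *\<^sub>v g) = (W *\<^sub>v x) \<bullet> g"
      unfolding Yg using W x g by (intro comm_scalar_prod[of _ m]) auto
    finally show ?thesis
      by simp
  qed
  ultimately show ?thesis
    by linarith
qed

section \<open>The augmented system\<close>

lemma append_vec_assoc: "(a @\<^sub>v b) @\<^sub>v c = a @\<^sub>v (b @\<^sub>v c)"
  by (intro eq_vecI) auto

lemma mat_less_zeroD:
  assumes less: "Q \<prec>\<^sub>m 0\<^sub>m N N" and Q: "(Q :: real mat) \<in> carrier_mat N N" and v: "v \<in> carrier_vec N"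
  shows "v \<bullet> (Q *\<^sub>v v) \<le> 0"
proof -
  have "pos_def (0\<^sub>m N N - Q)"
    using less by (simp add: mat_less_def)
  then have "0 \<le> v \<bullet> ((0\<^sub>m N N - Q) *\<^sub>v v)"
    using Q v by (intro pos_def_real(3)) auto
  also have "(0\<^sub>m N N - Q) *\<^sub>v v = 0\<^sub>v N - Q *\<^sub>v v"
    using Q v by (subst minus_mult_distrib_mat_vec[of _ N N]) auto
  also have "v \<bullet> \<dots> = - (v \<bullet> (Q *\<^sub>v v))"
    using Q v by (subst scalar_prod_minus_distrib[of _ N]) auto
  finally show ?thesis
    by simp
qed

lemma diag2_carrier [simp]: "G \<in> carrier_mat a k \<Longrightarrow> diag2 G \<in> carrier_mat (a + a) (k + k)"
  by (auto simp: diag2_def)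

lemma diag2_col_carrier [simp]:
  assumes "H \<in> carrier_mat a k"
  shows "diag2_col1 H \<in> carrier_mat (a + a) k" "diag2_col2 H \<in> carrier_mat (a + a) k"
  using assms by (auto simp: diag2_col1_def diag2_col2_def intro!: carrier_append_rows)

lemma diag2_mult_vec:
  assumes "G \<in> carrier_mat a k" "u \<in> carrier_vec k" "v \<in> carrier_vec k"
  shows "diag2 G *\<^sub>v (u @\<^sub>v v) = (G *\<^sub>v u) @\<^sub>v (G *\<^sub>v v)"
  using four_block_mat_mult_vec[OF assms(1) zero_carrier_mat zero_carrier_mat assms(1-3)] assms
  by (simp add: diag2_def)

lemma diag2_col_mult_vec:
  assumes "H \<in> carrier_mat a k" "u \<in> carrier_vec k"
  shows "diag2_col1 H *\<^sub>v u = (H *\<^sub>v u) @\<^sub>v 0\<^sub>v a" "diag2_col2 H *\<^sub>v u = 0\<^sub>v a @\<^sub>v (H *\<^sub>v u)"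
  using mat_mult_append[OF assms(1) zero_carrier_mat assms(2), of a] mat_mult_append[OF zero_carrier_mat assms, of a] assms
  by (simp_all add: diag2_col1_def diag2_col2_def)

text \<open>The block rows of the augmented system in terms of its parts. With \<open>(G, H)\<close> the state matrices of the
  filter this is the state equation of both filter copies, with its output matrices their outputs.\<close>

lemma filter_interconnection:
  assumes G: "G \<in> carrier_mat a k" and H: "H \<in> carrier_mat a 1"
    and C: "C \<in> carrier_mat 1 n" and D: "D \<in> carrier_mat 1 1" and Dd: "Dd \<in> carrier_mat 1 nd"
    and v: "\<xi>1 \<in> carrier_vec k" "\<xi>2 \<in> carrier_vec k" "x \<in> carrier_vec n" "w \<in> carrier_vec 1" "d \<in> carrier_vec nd"
    and z: "z = C *\<^sub>v x + D *\<^sub>v w + Dd *\<^sub>v d"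
  shows "(diag2 G *\<^sub>v (\<xi>1 @\<^sub>v \<xi>2) + (diag2_col1 H * C) *\<^sub>v x) +
      ((diag2_col1 H * D + diag2_col2 H) *\<^sub>v w + (diag2_col1 H * Dd) *\<^sub>v d) =
    (G *\<^sub>v \<xi>1 + H *\<^sub>v z) @\<^sub>v (G *\<^sub>v \<xi>2 + H *\<^sub>v w)"
proof -
  have zc: "z \<in> carrier_vec 1"
    unfolding z using C D Dd v by auto
  have H1: "(diag2_col1 H * F) *\<^sub>v u = (H *\<^sub>v (F *\<^sub>v u)) @\<^sub>v 0\<^sub>v a"
    if "F \<in> carrier_mat 1 b" "u \<in> carrier_vec b" for F b u
    using assoc_mult_mat_vec[OF diag2_col_carrier(1)[OF H] that] diag2_col_mult_vec(1)[OF H, of "F *\<^sub>v u"] that by simp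
  have H2: "(diag2_col1 H * D + diag2_col2 H) *\<^sub>v w = (H *\<^sub>v (D *\<^sub>v w)) @\<^sub>v (H *\<^sub>v w)"
  proof -
    have "(diag2_col1 H * D + diag2_col2 H) *\<^sub>v w = (diag2_col1 H * D) *\<^sub>v w + diag2_col2 H *\<^sub>v w"
      by (rule add_mult_distrib_mat_vec[OF mult_carrier_mat[OF diag2_col_carrier(1)[OF H] D] diag2_col_carrier(2)[OF H] v(4)])
    also have "\<dots> = ((H *\<^sub>v (D *\<^sub>v w)) @\<^sub>v 0\<^sub>v a) + (0\<^sub>v a @\<^sub>v (H *\<^sub>v w))"
      unfolding H1[OF D v(4)] diag2_col_mult_vec(2)[OF H v(4)] ..
    also have "\<dots> = (H *\<^sub>v (D *\<^sub>v w)) @\<^sub>v (H *\<^sub>v w)"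
      using H D v by (subst append_vec_add[of _ a _ _ a]) auto
    finally show ?thesis .
  qed
  have Hz: "H *\<^sub>v z = H *\<^sub>v (C *\<^sub>v x) + H *\<^sub>v (D *\<^sub>v w) + H *\<^sub>v (Dd *\<^sub>v d)"
    unfolding z using H C D Dd v by (simp add: mult_add_distrib_mat_vec[of _ a 1])
  show ?thesis
    unfolding diag2_mult_vec[OF G v(1,2)] H1[OF C v(3)] H2 H1[OF Dd v(5)] Hz
    using G H C D Dd v by (intro eq_vecI) (auto simp: scalar_prod_add_distrib)
qed

lemma aug_carrier:
  assumes Ap: "Ap \<in> carrier_mat k k" and Bp: "Bp \<in> carrier_mat k 1"
    and A: "A \<in> carrier_mat n n" and Bd: "Bd \<in> carrier_mat n nd"
  shows "aug_A Ap Bp A C \<in> carrier_mat (k + k + n) (k + k + n)"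
    and "aug_B Bp B Bd D Dd \<in> carrier_mat (k + k + n) (1 + nd)"
  unfolding aug_A_def aug_B_def
  by (rule four_block_carrier_mat[OF diag2_carrier[OF Ap] A]
      four_block_carrier_mat[OF add_carrier_mat[OF diag2_col_carrier(2)[OF Bp]] Bd])+

lemma aug_state:
  assumes Ap: "Ap \<in> carrier_mat k k" and Bp: "Bp \<in> carrier_mat k 1"
    and A: "A \<in> carrier_mat n n" and B: "B \<in> carrier_mat n 1" and Bd: "Bd \<in> carrier_mat n nd"
    and C: "C \<in> carrier_mat 1 n" and D: "D \<in> carrier_mat 1 1" and Dd: "Dd \<in> carrier_mat 1 nd"
    and v: "\<xi>1 \<in> carrier_vec k" "\<xi>2 \<in> carrier_vec k" "x \<in> carrier_vec n" "w \<in> carrier_vec 1" "d \<in> carrier_vec nd"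
    and z: "z = C *\<^sub>v x + D *\<^sub>v w + Dd *\<^sub>v d"
  shows "aug_A Ap Bp A C *\<^sub>v ((\<xi>1 @\<^sub>v \<xi>2) @\<^sub>v x) + aug_B Bp B Bd D Dd *\<^sub>v (w @\<^sub>v d) =
    ((Ap *\<^sub>v \<xi>1 + Bp *\<^sub>v z) @\<^sub>v (Ap *\<^sub>v \<xi>2 + Bp *\<^sub>v w)) @\<^sub>v (A *\<^sub>v x + B *\<^sub>v w + Bd *\<^sub>v d)"
proof -
  have \<xi>: "\<xi>1 @\<^sub>v \<xi>2 \<in> carrier_vec (k + k)"
    using v by simp
  have k2: "2 * dim_row Ap = k + k" "dim_row A = n"
    using Ap A by auto
  have c: "diag2_col1 Bp * C \<in> carrier_mat (k + k) n" "diag2_col1 Bp * D + diag2_col2 Bp \<in> carrier_mat (k + k) 1"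
    "diag2_col1 Bp * Dd \<in> carrier_mat (k + k) nd"
    using diag2_col_carrier[OF Bp] C D Dd by auto
  have "aug_A Ap Bp A C *\<^sub>v ((\<xi>1 @\<^sub>v \<xi>2) @\<^sub>v x) =
      (diag2 Ap *\<^sub>v (\<xi>1 @\<^sub>v \<xi>2) + (diag2_col1 Bp * C) *\<^sub>v x) @\<^sub>v (A *\<^sub>v x)"
    unfolding aug_A_def k2
    by (subst four_block_mat_mult_vec[OF diag2_carrier[OF Ap] c(1) zero_carrier_mat A \<xi> v(3)]) (use \<xi> A v in simp)
  moreover have "aug_B Bp B Bd D Dd *\<^sub>v (w @\<^sub>v d) =
      ((diag2_col1 Bp * D + diag2_col2 Bp) *\<^sub>v w + (diag2_col1 Bp * Dd) *\<^sub>v d) @\<^sub>v (B *\<^sub>v w + Bd *\<^sub>v d)"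
    unfolding aug_B_def by (rule four_block_mat_mult_vec[OF c(2,3) B Bd v(4,5)])
  moreover have "A *\<^sub>v x + (B *\<^sub>v w + Bd *\<^sub>v d) = A *\<^sub>v x + B *\<^sub>v w + Bd *\<^sub>v d"
    using A B Bd v by (intro assoc_add_vec[symmetric, of _ n]) auto
  moreover have "diag2 Ap *\<^sub>v (\<xi>1 @\<^sub>v \<xi>2) + (diag2_col1 Bp * C) *\<^sub>v x \<in> carrier_vec (k + k)"
    "(diag2_col1 Bp * D + diag2_col2 Bp) *\<^sub>v w + (diag2_col1 Bp * Dd) *\<^sub>v d \<in> carrier_vec (k + k)"
    "A *\<^sub>v x \<in> carrier_vec n" "B *\<^sub>v w + Bd *\<^sub>v d \<in> carrier_vec n"
    by (intro add_carrier_vec mult_mat_vec_carrier[OF diag2_carrier[OF Ap] \<xi>] mult_mat_vec_carrier[OF c(1) v(3)]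
        mult_mat_vec_carrier[OF c(2) v(4)] mult_mat_vec_carrier[OF c(3) v(5)] mult_mat_vec_carrier[OF A v(3)]
        mult_mat_vec_carrier[OF B v(4)] mult_mat_vec_carrier[OF Bd v(5)])+
  ultimately show ?thesis
    by (simp only: append_vec_add filter_interconnection[OF Ap Bp C D Dd v z])
qed

lemma aug_output:
  assumes Cp: "Cp \<in> carrier_mat l k" and Dp: "Dp \<in> carrier_mat l 1"
    and C: "C \<in> carrier_mat 1 n" and D: "D \<in> carrier_mat 1 1" and Dd: "Dd \<in> carrier_mat 1 nd"
    and v: "\<xi>1 \<in> carrier_vec k" "\<xi>2 \<in> carrier_vec k" "x \<in> carrier_vec n" "w \<in> carrier_vec 1" "d \<in> carrier_vec nd"
    and z: "z = C *\<^sub>v x + D *\<^sub>v w + Dd *\<^sub>v d"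
  shows "aug_C Cp Dp C @\<^sub>c aug_D Dp D Dd \<in> carrier_mat (l + l) ((k + k + n) + (1 + nd))"
    and "(aug_C Cp Dp C @\<^sub>c aug_D Dp D Dd) *\<^sub>v (((\<xi>1 @\<^sub>v \<xi>2) @\<^sub>v x) @\<^sub>v (w @\<^sub>v d)) =
      (Cp *\<^sub>v \<xi>1 + Dp *\<^sub>v z) @\<^sub>v (Cp *\<^sub>v \<xi>2 + Dp *\<^sub>v w)"
proof -
  have \<xi>: "\<xi>1 @\<^sub>v \<xi>2 \<in> carrier_vec (k + k)"
    using v by simp
  have c: "diag2_col1 Dp * C \<in> carrier_mat (l + l) n" "diag2_col1 Dp * D + diag2_col2 Dp \<in> carrier_mat (l + l) 1"
    "diag2_col1 Dp * Dd \<in> carrier_mat (l + l) nd"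
    using diag2_col_carrier[OF Dp] C D Dd by auto
  have CD: "aug_C Cp Dp C \<in> carrier_mat (l + l) (k + k + n)" "aug_D Dp D Dd \<in> carrier_mat (l + l) (1 + nd)"
    unfolding aug_C_def aug_D_def
    by (rule append_cols_carrier[OF diag2_carrier[OF Cp] c(1)] append_cols_carrier[OF c(2,3)])+
  then show "aug_C Cp Dp C @\<^sub>c aug_D Dp D Dd \<in> carrier_mat (l + l) ((k + k + n) + (1 + nd))"
    by (rule append_cols_carrier)
  have "(aug_C Cp Dp C @\<^sub>c aug_D Dp D Dd) *\<^sub>v (((\<xi>1 @\<^sub>v \<xi>2) @\<^sub>v x) @\<^sub>v (w @\<^sub>v d)) =
      aug_C Cp Dp C *\<^sub>v ((\<xi>1 @\<^sub>v \<xi>2) @\<^sub>v x) + aug_D Dp D Dd *\<^sub>v (w @\<^sub>v d)"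
    by (rule append_cols_mult_vec[OF CD append_carrier_vec[OF \<xi> v(3)] append_carrier_vec[OF v(4,5)]])
  also have "\<dots> = (diag2 Cp *\<^sub>v (\<xi>1 @\<^sub>v \<xi>2) + (diag2_col1 Dp * C) *\<^sub>v x) +
      ((diag2_col1 Dp * D + diag2_col2 Dp) *\<^sub>v w + (diag2_col1 Dp * Dd) *\<^sub>v d)"
    unfolding aug_C_def aug_D_def append_cols_mult_vec[OF diag2_carrier[OF Cp] c(1) \<xi> v(3)]
      append_cols_mult_vec[OF c(2,3) v(4,5)] ..
  finally show "(aug_C Cp Dp C @\<^sub>c aug_D Dp D Dd) *\<^sub>v (((\<xi>1 @\<^sub>v \<xi>2) @\<^sub>v x) @\<^sub>v (w @\<^sub>v d)) =
      (Cp *\<^sub>v \<xi>1 + Dp *\<^sub>v z) @\<^sub>v (Cp *\<^sub>v \<xi>2 + Dp *\<^sub>v w)"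
    by (simp only: filter_interconnection[OF Cp Dp C D Dd v z])
qed

lemma perf_outer_mult_vec:
  assumes Ce: "Ce \<in> carrier_mat ne n" and De: "De \<in> carrier_mat ne 1" and Ded: "Ded \<in> carrier_mat ne nd"
    and v: "\<xi> \<in> carrier_vec k" "x \<in> carrier_vec n" "w \<in> carrier_vec 1" "d \<in> carrier_vec nd"
  shows "perf_outer k Ce De Ded \<in> carrier_mat (ne + nd) (k + (n + (1 + nd)))"
    and "perf_outer k Ce De Ded *\<^sub>v (\<xi> @\<^sub>v (x @\<^sub>v (w @\<^sub>v d))) = (Ce *\<^sub>v x + De *\<^sub>v w + Ded *\<^sub>v d) @\<^sub>v d"
proof -
  let ?U = "0\<^sub>m ne k @\<^sub>c Ce @\<^sub>c De @\<^sub>c Ded" and ?L = "0\<^sub>m nd k @\<^sub>c 0\<^sub>m nd n @\<^sub>c 0\<^sub>m nd 1 @\<^sub>c 1\<^sub>m nd"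
  have U: "?U \<in> carrier_mat ne (k + (n + (1 + nd)))"
    by (intro append_cols_carrier zero_carrier_mat Ce De Ded)
  have L: "(?L :: real mat) \<in> carrier_mat nd (k + (n + (1 + nd)))"
    by (intro append_cols_carrier zero_carrier_mat one_carrier_mat)
  have dims: "dim_col Ce = n" "dim_row Ce = ne" "dim_col Ded = nd"
    using Ce Ded by auto
  have eq: "perf_outer k Ce De Ded = ?U @\<^sub>r ?L"
    unfolding perf_outer_def Let_def dims ..
  show "perf_outer k Ce De Ded \<in> carrier_mat (ne + nd) (k + (n + (1 + nd)))"
    unfolding eq by (rule carrier_append_rows[OF U L])
  have wd: "w @\<^sub>v d \<in> carrier_vec (1 + nd)" and xwd: "x @\<^sub>v (w @\<^sub>v d) \<in> carrier_vec (n + (1 + nd))"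
    by (rule append_carrier_vec[OF v(3,4)], rule append_carrier_vec[OF v(2) append_carrier_vec[OF v(3,4)]])
  have row: "(F0 @\<^sub>c F1 @\<^sub>c F2 @\<^sub>c F3) *\<^sub>v (\<xi> @\<^sub>v (x @\<^sub>v (w @\<^sub>v d))) =
      F0 *\<^sub>v \<xi> + (F1 *\<^sub>v x + (F2 *\<^sub>v w + F3 *\<^sub>v d))"
    if F: "F0 \<in> carrier_mat a k" "F1 \<in> carrier_mat a n" "F2 \<in> carrier_mat a 1" "F3 \<in> carrier_mat a nd"
    for a and F0 F1 F2 F3 :: "real mat"
    unfolding append_cols_mult_vec[OF F(1) append_cols_carrier[OF F(2) append_cols_carrier[OF F(3,4)]] v(1) xwd]
      append_cols_mult_vec[OF F(2) append_cols_carrier[OF F(3,4)] v(2) wd] append_cols_mult_vec[OF F(3,4) v(3,4)] ..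
  have "perf_outer k Ce De Ded *\<^sub>v (\<xi> @\<^sub>v (x @\<^sub>v (w @\<^sub>v d))) =
      (0\<^sub>m ne k *\<^sub>v \<xi> + (Ce *\<^sub>v x + (De *\<^sub>v w + Ded *\<^sub>v d))) @\<^sub>v
      (0\<^sub>m nd k *\<^sub>v \<xi> + (0\<^sub>m nd n *\<^sub>v x + (0\<^sub>m nd 1 *\<^sub>v w + 1\<^sub>m nd *\<^sub>v d)))"
    unfolding eq mat_mult_append[OF U L append_carrier_vec[OF v(1) xwd]]
      row[OF zero_carrier_mat Ce De Ded] row[OF zero_carrier_mat zero_carrier_mat zero_carrier_mat one_carrier_mat] ..
  also have "0\<^sub>m ne k *\<^sub>v \<xi> + (Ce *\<^sub>v x + (De *\<^sub>v w + Ded *\<^sub>v d)) = Ce *\<^sub>v x + De *\<^sub>v w + Ded *\<^sub>v d"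
    using Ce De Ded v by (simp add: assoc_add_vec[of _ ne])
  also have "0\<^sub>m nd k *\<^sub>v \<xi> + (0\<^sub>m nd n *\<^sub>v x + (0\<^sub>m nd 1 *\<^sub>v w + 1\<^sub>m nd *\<^sub>v d)) = d"
    using v by simp
  finally show "perf_outer k Ce De Ded *\<^sub>v (\<xi> @\<^sub>v (x @\<^sub>v (w @\<^sub>v d))) = (Ce *\<^sub>v x + De *\<^sub>v w + Ded *\<^sub>v d) @\<^sub>v d" .
qed

section \<open>The performance certificate\<close>

theorem corollary22:
  fixes n n\<^sub>d n\<^sub>e n\<^sub>\<psi> l :: nat
    and A B B\<^sub>d C D D\<^sub>d C\<^sub>e D\<^sub>e D\<^sub>e\<^sub>d Q\<^sub>p S\<^sub>p R\<^sub>p P\<^sub>p P\<^sub>0 P Z :: "real mat"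
    and q s r :: real
    and \<psi> :: "real poly fract mat"
    and A\<^sub>\<psi> B\<^sub>\<psi> C\<^sub>\<psi> D\<^sub>\<psi> X X\<^sub>1 X\<^sub>1\<^sub>2 X\<^sub>2 K M :: "real mat"
  assumes system_dims:
      "A \<in> carrier_mat n n" "B \<in> carrier_mat n 1" "B\<^sub>d \<in> carrier_mat n n\<^sub>d"
      "C \<in> carrier_mat 1 n" "D \<in> carrier_mat 1 1" "D\<^sub>d \<in> carrier_mat 1 n\<^sub>d"
      "C\<^sub>e \<in> carrier_mat n\<^sub>e n" "D\<^sub>e \<in> carrier_mat n\<^sub>e 1" "D\<^sub>e\<^sub>d \<in> carrier_mat n\<^sub>e n\<^sub>d"
    and performance:
      "P\<^sub>p = four_block_mat Q\<^sub>p S\<^sub>p (transpose_mat S\<^sub>p) R\<^sub>p"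
      "symmetric_mat n\<^sub>e Q\<^sub>p" "S\<^sub>p \<in> carrier_mat n\<^sub>e n\<^sub>d" "symmetric_mat n\<^sub>d R\<^sub>p" "pos_semidef Q\<^sub>p"
    and uncertainty: "P\<^sub>0 = mat_of_rows_list 2 [[q, s], [s, r]]" "r \<le> 0"
    and filter:
      "\<psi> \<in> carrier_mat l 1" "tm_stable \<psi>"
      "\<forall>H \<in> imag_axis_values \<psi>. vec_space.rank l H = 1"
      "minimal_realization n\<^sub>\<psi> A\<^sub>\<psi> B\<^sub>\<psi> C\<^sub>\<psi> D\<^sub>\<psi> \<psi>"
    and variables:
      "X = four_block_mat X\<^sub>1 X\<^sub>1\<^sub>2 (transpose_mat X\<^sub>1\<^sub>2) X\<^sub>2"
      "symmetric_mat (2 * n\<^sub>\<psi>) X\<^sub>1" "X\<^sub>1\<^sub>2 \<in> carrier_mat (2 * n\<^sub>\<psi>) n" "symmetric_mat n X\<^sub>2"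
      "symmetric_mat n\<^sub>\<psi> K" "symmetric_mat l M"
      "P = P\<^sub>0 \<otimes>\<^sub>k M" "Z = P\<^sub>0 \<otimes>\<^sub>k K"
    and lmi_positivity:
      "pos_def (four_block_mat (X\<^sub>1 + Z) X\<^sub>1\<^sub>2 (transpose_mat X\<^sub>1\<^sub>2) X\<^sub>2)"
    and lmi_system:
      "kyp_form (aug_A A\<^sub>\<psi> B\<^sub>\<psi> A C) (aug_B B\<^sub>\<psi> B B\<^sub>d D D\<^sub>d) X
         + transpose_mat (aug_C C\<^sub>\<psi> D\<^sub>\<psi> C @\<^sub>c aug_D D\<^sub>\<psi> D D\<^sub>d) * P
             * (aug_C C\<^sub>\<psi> D\<^sub>\<psi> C @\<^sub>c aug_D D\<^sub>\<psi> D D\<^sub>d)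
         + transpose_mat (perf_outer (2 * n\<^sub>\<psi>) C\<^sub>e D\<^sub>e D\<^sub>e\<^sub>d) * P\<^sub>p
             * perf_outer (2 * n\<^sub>\<psi>) C\<^sub>e D\<^sub>e D\<^sub>e\<^sub>d
       \<prec>\<^sub>m 0\<^sub>m (2 * n\<^sub>\<psi> + n + 1 + n\<^sub>d) (2 * n\<^sub>\<psi> + n + 1 + n\<^sub>d)"
    and lmi_filter:
      "kyp_form A\<^sub>\<psi> B\<^sub>\<psi> K \<prec>\<^sub>m transpose_mat (C\<^sub>\<psi> @\<^sub>c D\<^sub>\<psi>) * M * (C\<^sub>\<psi> @\<^sub>c D\<^sub>\<psi>)"
  shows
    "\<forall>x w z e d. interconnection_trajectory P\<^sub>0 A B B\<^sub>d C D D\<^sub>d C\<^sub>e D\<^sub>e D\<^sub>e\<^sub>d x w z e d \<longrightarrow>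
       (\<forall>T\<ge>0. quad_form (E_mat X\<^sub>1 X\<^sub>1\<^sub>2 X\<^sub>2 Z) (x T)
                + integral {0..T} (\<lambda>t. quad_form P\<^sub>p (e t @\<^sub>v d t))
              \<le> quad_form X\<^sub>2 (x 0))"
proof (intro allI impI)
  fix x w z e d and T :: real
  assume tr: "interconnection_trajectory P\<^sub>0 A B B\<^sub>d C D D\<^sub>d C\<^sub>e D\<^sub>e D\<^sub>e\<^sub>d x w z e d" and T: "0 \<le> T"
  have dims: "dim_row C\<^sub>e = n\<^sub>e" "dim_col B\<^sub>d = n\<^sub>d" "dim_row A = n" "dim_row \<psi> = l" "dim_col \<psi> = 1"
    using system_dims filter(1) by auto
  have signals: "pwc w" "pwc z" "e \<in> vec_signals n\<^sub>e" "d \<in> vec_signals n\<^sub>d"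
    and x: "state_trajectory n x (\<lambda>t. A *\<^sub>v x t + B *\<^sub>v scalar_vec (w t) + B\<^sub>d *\<^sub>v d t)"
    and z: "\<And>t. 0 \<le> t \<Longrightarrow> scalar_vec (z t) = C *\<^sub>v x t + D *\<^sub>v scalar_vec (w t) + D\<^sub>d *\<^sub>v d t"
    and e: "\<And>t. 0 \<le> t \<Longrightarrow> e t = C\<^sub>e *\<^sub>v x t + D\<^sub>e *\<^sub>v scalar_vec (w t) + D\<^sub>e\<^sub>d *\<^sub>v d t"
    and w\<Delta>: "w \<in> Delta_dy P\<^sub>0 z"
    using tr unfolding interconnection_trajectory_def signals_iff_pwc dims by blast+
  have real: "A\<^sub>\<psi> \<in> carrier_mat n\<^sub>\<psi> n\<^sub>\<psi>" "B\<^sub>\<psi> \<in> carrier_mat n\<^sub>\<psi> 1" "C\<^sub>\<psi> \<in> carrier_mat l n\<^sub>\<psi>" "D\<^sub>\<psi> \<in> carrier_mat l 1"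
    using filter(4) unfolding minimal_realization_def realization_def dims by blast+
  have X1: "X\<^sub>1 \<in> carrier_mat (n\<^sub>\<psi> + n\<^sub>\<psi>) (n\<^sub>\<psi> + n\<^sub>\<psi>)" and X12: "X\<^sub>1\<^sub>2 \<in> carrier_mat (n\<^sub>\<psi> + n\<^sub>\<psi>) n"
    and X2: "X\<^sub>2 \<in> carrier_mat n n" and K: "K \<in> carrier_mat n\<^sub>\<psi> n\<^sub>\<psi>" "transpose_mat K = K"
    and M: "M \<in> carrier_mat l l" "transpose_mat M = M"
    using variables unfolding symmetric_mat_def mult_2 by auto
  have X: "X \<in> carrier_mat (n\<^sub>\<psi> + n\<^sub>\<psi> + n) (n\<^sub>\<psi> + n\<^sub>\<psi> + n)"
    unfolding variables(1) using X1 X12 X2 by auto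
  have Z: "Z \<in> carrier_mat (n\<^sub>\<psi> + n\<^sub>\<psi>) (n\<^sub>\<psi> + n\<^sub>\<psi>)"
    unfolding variables(8) kronecker_two[OF K(1) uncertainty(1)] using K by auto
  have P: "P \<in> carrier_mat (l + l) (l + l)"
    unfolding variables(7) kronecker_two[OF M(1) uncertainty(1)] using M by auto
  have Pp: "P\<^sub>p \<in> carrier_mat (n\<^sub>e + n\<^sub>d) (n\<^sub>e + n\<^sub>d)"
    using performance unfolding symmetric_mat_def by auto
  define Y where "Y = four_block_mat (X\<^sub>1 + Z) X\<^sub>1\<^sub>2 (transpose_mat X\<^sub>1\<^sub>2) X\<^sub>2"
  have Y: "Y \<in> carrier_mat (n\<^sub>\<psi> + n\<^sub>\<psi> + n) (n\<^sub>\<psi> + n\<^sub>\<psi> + n)"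
    unfolding Y_def using X1 X12 X2 Z by auto
  define N where "N = transpose_mat (C\<^sub>\<psi> @\<^sub>c D\<^sub>\<psi>) * M * (C\<^sub>\<psi> @\<^sub>c D\<^sub>\<psi>) - kyp_form A\<^sub>\<psi> B\<^sub>\<psi> K"
  have CD: "C\<^sub>\<psi> @\<^sub>c D\<^sub>\<psi> \<in> carrier_mat l (n\<^sub>\<psi> + 1)"
    by (rule append_cols_carrier[OF real(3,4)])
  have kyp: "kyp_form A\<^sub>\<psi> B\<^sub>\<psi> K \<in> carrier_mat (n\<^sub>\<psi> + 1) (n\<^sub>\<psi> + 1)"
    by (rule kyp_form_carrier[OF real(1,2) K(1)])
  have CMC: "transpose_mat (C\<^sub>\<psi> @\<^sub>c D\<^sub>\<psi>) * M * (C\<^sub>\<psi> @\<^sub>c D\<^sub>\<psi>) \<in> carrier_mat (n\<^sub>\<psi> + 1) (n\<^sub>\<psi> + 1)"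
    using CD M(1) by auto
  have N: "pos_def N" "N \<in> carrier_mat (n\<^sub>\<psi> + 1) (n\<^sub>\<psi> + 1)"
    using lmi_filter CMC kyp unfolding N_def mat_less_def by auto
  \<comment> \<open>along filter trajectories, the form of \<open>M\<close> at the outputs minus the derivative of the form of \<open>K\<close>\<close>
  have N_bilinear: "(a @\<^sub>v scalar_vec u) \<bullet> (N *\<^sub>v (b @\<^sub>v scalar_vec v)) =
      (C\<^sub>\<psi> *\<^sub>v a + D\<^sub>\<psi> *\<^sub>v scalar_vec u) \<bullet> (M *\<^sub>v (C\<^sub>\<psi> *\<^sub>v b + D\<^sub>\<psi> *\<^sub>v scalar_vec v)) -
      ((A\<^sub>\<psi> *\<^sub>v a + B\<^sub>\<psi> *\<^sub>v scalar_vec u) \<bullet> (K *\<^sub>v b) + a \<bullet> (K *\<^sub>v (A\<^sub>\<psi> *\<^sub>v b + B\<^sub>\<psi> *\<^sub>v scalar_vec v)))"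
    if ab: "a \<in> carrier_vec n\<^sub>\<psi>" "b \<in> carrier_vec n\<^sub>\<psi>" for a b u v
  proof -
    let ?a = "a @\<^sub>v scalar_vec u" and ?b = "b @\<^sub>v scalar_vec v"
    have c: "?a \<in> carrier_vec (n\<^sub>\<psi> + 1)" "?b \<in> carrier_vec (n\<^sub>\<psi> + 1)"
      by (rule append_carrier_vec[OF ab(1) dim_scalar_vec(1)] append_carrier_vec[OF ab(2) dim_scalar_vec(1)])+
    have "N *\<^sub>v ?b = (transpose_mat (C\<^sub>\<psi> @\<^sub>c D\<^sub>\<psi>) * M * (C\<^sub>\<psi> @\<^sub>c D\<^sub>\<psi>)) *\<^sub>v ?b - kyp_form A\<^sub>\<psi> B\<^sub>\<psi> K *\<^sub>v ?b"
      unfolding N_def by (rule minus_mult_distrib_mat_vec[OF CMC kyp c(2)])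
    then have "?a \<bullet> (N *\<^sub>v ?b) = ?a \<bullet> ((transpose_mat (C\<^sub>\<psi> @\<^sub>c D\<^sub>\<psi>) * M * (C\<^sub>\<psi> @\<^sub>c D\<^sub>\<psi>)) *\<^sub>v ?b) -
        ?a \<bullet> (kyp_form A\<^sub>\<psi> B\<^sub>\<psi> K *\<^sub>v ?b)"
      using scalar_prod_minus_distrib[OF c(1) mult_mat_vec_carrier[OF CMC c(2)] mult_mat_vec_carrier[OF kyp c(2)]] by simp
    then show ?thesis
      unfolding bilinear_sandwich[OF CD M(1) c] append_cols_mult_vec[OF real(3,4) ab(1) dim_scalar_vec(1)]
        append_cols_mult_vec[OF real(3,4) ab(2) dim_scalar_vec(1)]
        bilinear_kyp_form[OF real(1,2) K(1) ab(1) dim_scalar_vec(1) ab(2) dim_scalar_vec(1)] .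
  qed
  obtain \<xi>1 \<xi>2 where
    \<xi>1: "state_trajectory n\<^sub>\<psi> \<xi>1 (\<lambda>t. A\<^sub>\<psi> *\<^sub>v \<xi>1 t + B\<^sub>\<psi> *\<^sub>v scalar_vec (z t))" "\<xi>1 0 = 0\<^sub>v n\<^sub>\<psi>" and
    \<xi>2: "state_trajectory n\<^sub>\<psi> \<xi>2 (\<lambda>t. A\<^sub>\<psi> *\<^sub>v \<xi>2 t + B\<^sub>\<psi> *\<^sub>v scalar_vec (w t))" "\<xi>2 0 = 0\<^sub>v n\<^sub>\<psi>" and
    iqc: "\<forall>N \<in> carrier_mat (n\<^sub>\<psi> + 1) (n\<^sub>\<psi> + 1). \<forall>T. pos_def N \<longrightarrow>
      0 \<le> integ (\<lambda>t. kronecker_form q s r (\<lambda>a b. a \<bullet> (N *\<^sub>v b))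
        (\<xi>1 t @\<^sub>v scalar_vec (z t)) (\<xi>2 t @\<^sub>v scalar_vec (w t))) T"
    by (rule filtered_iqc[OF w\<Delta> uncertainty signals(2,1) real(1,2)])
  define \<eta> where "\<eta> = (\<lambda>t. (\<xi>1 t @\<^sub>v \<xi>2 t) @\<^sub>v x t)"
  define \<eta>' where "\<eta>' = (\<lambda>t. ((A\<^sub>\<psi> *\<^sub>v \<xi>1 t + B\<^sub>\<psi> *\<^sub>v scalar_vec (z t)) @\<^sub>v (A\<^sub>\<psi> *\<^sub>v \<xi>2 t + B\<^sub>\<psi> *\<^sub>v scalar_vec (w t))) @\<^sub>v
      (A *\<^sub>v x t + B *\<^sub>v scalar_vec (w t) + B\<^sub>d *\<^sub>v d t))"
  have traj: "integral_trajectory (n\<^sub>\<psi> + n\<^sub>\<psi> + n) \<eta> \<eta>'"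
    unfolding \<eta>_def \<eta>'_def
    by (intro integral_trajectory_append state_trajectory_imp_integral_trajectory \<xi>1(1) \<xi>2(1) x)
  then have \<eta>_signals: "\<eta> \<in> vec_signals (n\<^sub>\<psi> + n\<^sub>\<psi> + n)" "\<eta>' \<in> vec_signals (n\<^sub>\<psi> + n\<^sub>\<psi> + n)"
    unfolding integral_trajectory_def by blast+
  let ?outer = "\<lambda>t. kronecker_form q s r (\<lambda>a b. a \<bullet> (N *\<^sub>v b)) (\<xi>1 t @\<^sub>v scalar_vec (z t)) (\<xi>2 t @\<^sub>v scalar_vec (w t))"
  let ?storage = "\<lambda>t. \<eta>' t \<bullet> (Y *\<^sub>v \<eta> t) + \<eta> t \<bullet> (Y *\<^sub>v \<eta>' t)"
  let ?perf = "\<lambda>t. quad_form P\<^sub>p (e t @\<^sub>v d t)"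
  \<comment> \<open>the storage matrix is \<open>Y\<close> rather than \<open>X\<close>: adding the terms of \<open>Z\<close> trades the form of \<open>P\<close> at the
    filter outputs for the form of \<open>N\<close>, whose integral is nonnegative\<close>
  have dissipation: "?storage t + ?perf t \<le> - ?outer t" if t: "0 \<le> t" for t
  proof -
    let ?z = "scalar_vec (z t)" and ?w = "scalar_vec (w t)"
    define \<xi>1' \<xi>2' x' y1 y2 where "\<xi>1' = A\<^sub>\<psi> *\<^sub>v \<xi>1 t + B\<^sub>\<psi> *\<^sub>v ?z" and "\<xi>2' = A\<^sub>\<psi> *\<^sub>v \<xi>2 t + B\<^sub>\<psi> *\<^sub>v ?w"
      and "x' = A *\<^sub>v x t + B *\<^sub>v ?w + B\<^sub>d *\<^sub>v d t" and "y1 = C\<^sub>\<psi> *\<^sub>v \<xi>1 t + D\<^sub>\<psi> *\<^sub>v ?z" and "y2 = C\<^sub>\<psi> *\<^sub>v \<xi>2 t + D\<^sub>\<psi> *\<^sub>v ?w"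
    note derivs = \<xi>1'_def \<xi>2'_def x'_def y1_def y2_def
    have c: "\<xi>1 t \<in> carrier_vec n\<^sub>\<psi>" "\<xi>2 t \<in> carrier_vec n\<^sub>\<psi>" "x t \<in> carrier_vec n" "d t \<in> carrier_vec n\<^sub>d" "e t \<in> carrier_vec n\<^sub>e"
      using \<xi>1(1) \<xi>2(1) x t vec_signalsD(1)[OF signals(3) t] vec_signalsD(1)[OF signals(4) t]
      unfolding state_trajectory_def by blast+
    have w1: "?w \<in> carrier_vec 1" and z1: "?z \<in> carrier_vec 1"
      by (rule dim_scalar_vec)+
    have c': "\<xi>1' \<in> carrier_vec n\<^sub>\<psi>" "\<xi>2' \<in> carrier_vec n\<^sub>\<psi>" "x' \<in> carrier_vec n" "y1 \<in> carrier_vec l" "y2 \<in> carrier_vec l"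
      unfolding derivs
      by (intro add_carrier_vec mult_mat_vec_carrier[OF real(1)] mult_mat_vec_carrier[OF real(2)] mult_mat_vec_carrier[OF real(3)]
          mult_mat_vec_carrier[OF real(4)] mult_mat_vec_carrier[OF system_dims(1)] mult_mat_vec_carrier[OF system_dims(2)]
          mult_mat_vec_carrier[OF system_dims(3)] c w1 z1)+
    have \<xi>: "\<xi>1 t @\<^sub>v \<xi>2 t \<in> carrier_vec (n\<^sub>\<psi> + n\<^sub>\<psi>)" and \<xi>': "\<xi>1' @\<^sub>v \<xi>2' \<in> carrier_vec (n\<^sub>\<psi> + n\<^sub>\<psi>)"
      using c c' by auto
    have \<eta>: "\<eta> t \<in> carrier_vec (n\<^sub>\<psi> + n\<^sub>\<psi> + n)" "\<eta>' t \<in> carrier_vec (n\<^sub>\<psi> + n\<^sub>\<psi> + n)"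
      by (rule vec_signalsD(1)[OF \<eta>_signals(1) t] vec_signalsD(1)[OF \<eta>_signals(2) t])+
    have \<eta>': "\<eta>' t = (\<xi>1' @\<^sub>v \<xi>2') @\<^sub>v x'"
      by (simp add: \<eta>'_def derivs)
    have wd: "?w @\<^sub>v d t \<in> carrier_vec (1 + n\<^sub>d)"
      by (rule append_carrier_vec[OF w1 c(4)])
    note \<alpha> = aug_carrier(1)[OF real(1,2) system_dims(1,3), of C]
      aug_carrier(2)[OF real(1,2) system_dims(1,3), of B D D\<^sub>d]
    let ?v = "\<eta> t @\<^sub>v (?w @\<^sub>v d t)" and ?m = "(n\<^sub>\<psi> + n\<^sub>\<psi> + n) + (1 + n\<^sub>d)"
    have v: "?v \<in> carrier_vec ?m"
      by (rule append_carrier_vec[OF \<eta>(1) wd])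
    define S1 where "S1 = kyp_form (aug_A A\<^sub>\<psi> B\<^sub>\<psi> A C) (aug_B B\<^sub>\<psi> B B\<^sub>d D D\<^sub>d) X"
    define F2 where "F2 = aug_C C\<^sub>\<psi> D\<^sub>\<psi> C @\<^sub>c aug_D D\<^sub>\<psi> D D\<^sub>d"
    define F3 where "F3 = perf_outer (2 * n\<^sub>\<psi>) C\<^sub>e D\<^sub>e D\<^sub>e\<^sub>d"
    have S1: "S1 \<in> carrier_mat ?m ?m"
      unfolding S1_def by (rule kyp_form_carrier[OF \<alpha> X])
    have F2: "F2 \<in> carrier_mat (l + l) ?m" "F2 *\<^sub>v ?v = y1 @\<^sub>v y2"
      unfolding F2_def \<eta>_def y1_def y2_def
      by (rule aug_output[OF real(3,4) system_dims(4-6) c(1-3) w1 c(4) z[OF t]])+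
    have F3: "F3 \<in> carrier_mat (n\<^sub>e + n\<^sub>d) ?m" "F3 *\<^sub>v ?v = e t @\<^sub>v d t"
      using perf_outer_mult_vec[OF system_dims(7-9) \<xi> c(3) w1 c(4)]
      unfolding F3_def \<eta>_def e[OF t] append_vec_assoc mult_2 by (simp_all only: add.assoc)
    have S23: "transpose_mat F2 * P * F2 \<in> carrier_mat ?m ?m" "transpose_mat F3 * P\<^sub>p * F3 \<in> carrier_mat ?m ?m"
      using F2(1) F3(1) P Pp by auto
    have "?v \<bullet> ((S1 + transpose_mat F2 * P * F2 + transpose_mat F3 * P\<^sub>p * F3) *\<^sub>v ?v) \<le> 0"
    proof (rule mat_less_zeroD[OF _ _ v])
      have m: "2 * n\<^sub>\<psi> + n + 1 + n\<^sub>d = ?m"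
        by simp
      show "S1 + transpose_mat F2 * P * F2 + transpose_mat F3 * P\<^sub>p * F3 \<prec>\<^sub>m 0\<^sub>m ?m ?m"
        using lmi_system unfolding S1_def F2_def F3_def m .
    qed (intro add_carrier_mat S1 S23)
    also have "(S1 + transpose_mat F2 * P * F2 + transpose_mat F3 * P\<^sub>p * F3) *\<^sub>v ?v =
        S1 *\<^sub>v ?v + (transpose_mat F2 * P * F2) *\<^sub>v ?v + (transpose_mat F3 * P\<^sub>p * F3) *\<^sub>v ?v"
      unfolding add_mult_distrib_mat_vec[OF add_carrier_mat[OF S23(1)] S23(2) v] add_mult_distrib_mat_vec[OF S1 S23(1) v] ..
    also have "?v \<bullet> \<dots> = ?v \<bullet> (S1 *\<^sub>v ?v) + ?v \<bullet> ((transpose_mat F2 * P * F2) *\<^sub>v ?v) + ?v \<bullet> ((transpose_mat F3 * P\<^sub>p * F3) *\<^sub>v ?v)"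
      unfolding scalar_prod_add_distrib[OF v add_carrier_vec[OF mult_mat_vec_carrier[OF S1 v] mult_mat_vec_carrier[OF S23(1) v]]
          mult_mat_vec_carrier[OF S23(2) v]]
        scalar_prod_add_distrib[OF v mult_mat_vec_carrier[OF S1 v] mult_mat_vec_carrier[OF S23(1) v]] ..
    also have "?v \<bullet> (S1 *\<^sub>v ?v) = \<eta>' t \<bullet> (X *\<^sub>v \<eta> t) + \<eta> t \<bullet> (X *\<^sub>v \<eta>' t)"
    proof -
      have "aug_A A\<^sub>\<psi> B\<^sub>\<psi> A C *\<^sub>v \<eta> t + aug_B B\<^sub>\<psi> B B\<^sub>d D D\<^sub>d *\<^sub>v (?w @\<^sub>v d t) = \<eta>' t"
        unfolding \<eta>_def \<eta>'_def
        by (rule aug_state[OF real(1,2) system_dims(1-6) c(1-3) w1 c(4) z[OF t]])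
      then show ?thesis
        unfolding S1_def bilinear_kyp_form[OF \<alpha> X \<eta>(1) wd \<eta>(1) wd] by simp
    qed
    also have "?v \<bullet> ((transpose_mat F2 * P * F2) *\<^sub>v ?v) = (y1 @\<^sub>v y2) \<bullet> (P *\<^sub>v (y1 @\<^sub>v y2))"
      unfolding bilinear_sandwich[OF F2(1) P v v] F2(2) ..
    also have "?v \<bullet> ((transpose_mat F3 * P\<^sub>p * F3) *\<^sub>v ?v) = ?perf t"
      unfolding bilinear_sandwich[OF F3(1) Pp v v] F3(2) quad_form_def ..
    finally have lmi: "\<eta>' t \<bullet> (X *\<^sub>v \<eta> t) + \<eta> t \<bullet> (X *\<^sub>v \<eta>' t) + (y1 @\<^sub>v y2) \<bullet> (P *\<^sub>v (y1 @\<^sub>v y2)) + ?perf t \<le> 0" .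
    have YX: "(a @\<^sub>v b) \<bullet> (Y *\<^sub>v (a' @\<^sub>v b')) = (a @\<^sub>v b) \<bullet> (X *\<^sub>v (a' @\<^sub>v b')) + a \<bullet> (Z *\<^sub>v a')"
      if "a \<in> carrier_vec (n\<^sub>\<psi> + n\<^sub>\<psi>)" "b \<in> carrier_vec n" "a' \<in> carrier_vec (n\<^sub>\<psi> + n\<^sub>\<psi>)" "b' \<in> carrier_vec n" for a b a' b'
    proof -
      have "a \<bullet> ((X\<^sub>1 + Z) *\<^sub>v a') = a \<bullet> (X\<^sub>1 *\<^sub>v a') + a \<bullet> (Z *\<^sub>v a')"
        unfolding add_mult_distrib_mat_vec[OF X1 Z that(3)]
        by (rule scalar_prod_add_distrib[OF that(1) mult_mat_vec_carrier[OF X1 that(3)] mult_mat_vec_carrier[OF Z that(3)]])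
      moreover have X12T: "transpose_mat X\<^sub>1\<^sub>2 \<in> carrier_mat n (n\<^sub>\<psi> + n\<^sub>\<psi>)"
        using X12 by simp
      ultimately show ?thesis
        unfolding Y_def variables(1) bilinear_four_block[OF add_carrier_mat[OF Z] X12 X12T X2 that]
          bilinear_four_block[OF X1 X12 X12T X2 that]
        by simp
    qed
    have storage: "?storage t = \<eta>' t \<bullet> (X *\<^sub>v \<eta> t) + \<eta> t \<bullet> (X *\<^sub>v \<eta>' t) +
        ((\<xi>1' @\<^sub>v \<xi>2') \<bullet> (Z *\<^sub>v (\<xi>1 t @\<^sub>v \<xi>2 t)) + (\<xi>1 t @\<^sub>v \<xi>2 t) \<bullet> (Z *\<^sub>v (\<xi>1' @\<^sub>v \<xi>2')))"
      unfolding \<eta>' \<eta>_def YX[OF \<xi> c(3) \<xi>' c'(3)] YX[OF \<xi>' c'(3) \<xi> c(3)] by simp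
    have outer: "?outer t = (y1 @\<^sub>v y2) \<bullet> (P *\<^sub>v (y1 @\<^sub>v y2)) -
        ((\<xi>1' @\<^sub>v \<xi>2') \<bullet> (Z *\<^sub>v (\<xi>1 t @\<^sub>v \<xi>2 t)) + (\<xi>1 t @\<^sub>v \<xi>2 t) \<bullet> (Z *\<^sub>v (\<xi>1' @\<^sub>v \<xi>2')))"
    proof -
      have "y2 \<bullet> (M *\<^sub>v y1) = y1 \<bullet> (M *\<^sub>v y2)" "\<xi>2 t \<bullet> (K *\<^sub>v \<xi>1') = \<xi>1' \<bullet> (K *\<^sub>v \<xi>2 t)"
        "\<xi>2' \<bullet> (K *\<^sub>v \<xi>1 t) = \<xi>1 t \<bullet> (K *\<^sub>v \<xi>2')"
        by (rule bilinear_sym[OF M c'(5,4)] bilinear_sym[OF K c(2) c'(1)] bilinear_sym[OF K c'(2) c(1)])+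
      then show ?thesis
        unfolding kronecker_form_def N_bilinear[OF c(1) c(1)] N_bilinear[OF c(1) c(2)] N_bilinear[OF c(2) c(2)]
          derivs[symmetric] variables(7,8) bilinear_kronecker[OF M(1) uncertainty(1) c'(4,5) c'(4,5)]
          bilinear_kronecker[OF K(1) uncertainty(1) c'(1,2) c(1,2)] bilinear_kronecker[OF K(1) uncertainty(1) c(1,2) c'(1,2)]
        by (simp add: algebra_simps)
    qed
    show ?thesis
      using lmi unfolding storage outer by linarith
  qed
  have pwc_perf: "pwc ?perf"
    unfolding quad_form_def by (intro pwc_bilinear[OF Pp] vec_signals_append signals)
  have pwc_storage: "pwc ?storage"
    by (intro pwc_add pwc_bilinear[OF Y] \<eta>_signals)
  have pwc_outer: "pwc ?outer"
  proof -
    have "\<xi>1 \<in> vec_signals n\<^sub>\<psi>" "\<xi>2 \<in> vec_signals n\<^sub>\<psi>"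
      using \<xi>1(1) \<xi>2(1) state_trajectory_imp_integral_trajectory unfolding integral_trajectory_def by blast+
    then show ?thesis
      unfolding kronecker_form_def
      by (intro pwc_add pwc_mult pwc_const pwc_bilinear[OF N(2)] vec_signals_append scalar_vec_signals signals)
  qed
  have "integ ?storage T + integ ?perf T = integ (\<lambda>t. ?storage t + ?perf t) T"
    by (simp only: integ_add[OF pwc_storage pwc_perf])
  also have "\<dots> \<le> integ (\<lambda>t. -1 * ?outer t) T"
    by (intro integ_mono pwc_add pwc_mult pwc_const pwc_storage pwc_perf pwc_outer) (use dissipation in simp)
  also have "\<dots> = - integ ?outer T"
    by (simp only: integ_mult)
  also have "\<dots> \<le> 0"
    using iqc N by simp
  also have "integ ?storage T = quad_form Y (\<eta> T) - quad_form Y (\<eta> 0)"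
    by (rule quad_form_along_trajectory[OF traj Y T])
  also have "quad_form Y (\<eta> 0) = quad_form X\<^sub>2 (x 0)"
  proof -
    have x0: "x 0 \<in> carrier_vec n"
      using x by (simp add: state_trajectory_def)
    \<comment> \<open>the filters start at rest, so only the plant contributes to the initial storage\<close>
    have zero: "0\<^sub>v n\<^sub>\<psi> @\<^sub>v 0\<^sub>v n\<^sub>\<psi> = (0\<^sub>v (n\<^sub>\<psi> + n\<^sub>\<psi>) :: real vec)"
      by (intro eq_vecI) auto
    have X12T: "transpose_mat X\<^sub>1\<^sub>2 \<in> carrier_mat n (n\<^sub>\<psi> + n\<^sub>\<psi>)"
      using X12 by simp
    have "\<eta> 0 = 0\<^sub>v (n\<^sub>\<psi> + n\<^sub>\<psi>) @\<^sub>v x 0"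
      by (simp only: \<eta>_def \<xi>1(2) \<xi>2(2) zero)
    then show ?thesis
      unfolding quad_form_def Y_def
      using bilinear_four_block[OF add_carrier_mat[OF Z] X12 X12T X2 zero_carrier_vec x0 zero_carrier_vec x0, of X\<^sub>1]
        mat_mult_zero_vec[OF X12T] mult_mat_vec_carrier[OF X12 x0] mult_mat_vec_carrier[OF add_carrier_mat[OF Z] zero_carrier_vec, of X\<^sub>1] x0
      by simp
  qed
  finally have "quad_form Y (\<eta> T) + integ ?perf T \<le> quad_form X\<^sub>2 (x 0)"
    by simp
  moreover have "quad_form (E_mat X\<^sub>1 X\<^sub>1\<^sub>2 X\<^sub>2 Z) (x T) \<le> quad_form Y (\<eta> T)"
  proof -
    have "\<xi>1 T @\<^sub>v \<xi>2 T \<in> carrier_vec (n\<^sub>\<psi> + n\<^sub>\<psi>)" "x T \<in> carrier_vec n"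
      using \<xi>1(1) \<xi>2(1) x T by (auto simp: state_trajectory_def)
    from schur_complement_le[OF add_carrier_mat[OF Z] X12 X2 lmi_positivity this] show ?thesis
      unfolding Y_def \<eta>_def E_mat_def quad_form_def[of "X\<^sub>2 - _"] .
  qed
  ultimately show "quad_form (E_mat X\<^sub>1 X\<^sub>1\<^sub>2 X\<^sub>2 Z) (x T) + integral {0..T} (\<lambda>t. quad_form P\<^sub>p (e t @\<^sub>v d t))
      \<le> quad_form X\<^sub>2 (x 0)"
    unfolding integ_def by linarith
qed

end
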